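(* There are universal constants $C_0,C_1>0$ such that the following holds. Fix a positive semidefinite (psd) matrix $\mathbf A\in\mathbb{R}^{d^n\times d^n}$ and a target rank $1\le r\le d^n$. Let $\mathbf\Omega\in\mathbb{R}^{d^n\times k}$ be a real rMPS test matrix with bond dimension $\chi$ and embedding dimension $k\ge C_0(1+2/\chi)^{n-1}r$, and let $\widehat{\mathbf A}=\mathbf A\langle\mathbf\Omega\rangle$ be the Nyström approximation. Then with probability at least $0.99$: (a) $\|\mathbf A-\widehat{\mathbf A}\|_*\le C_1\|\mathbf A-[\![\mathbf A]\!]_r\|_*$; (b) $\|\mathbf A-\widehat{\mathbf A}\|_{\rm F}^2\le C_1\left(\|\mathbf A-[\![\mathbf A]\!]_r\|_{\rm F}^2+\frac1r\|\mathbf A-[\![\mathbf A]\!]_r\|_*^2\right)$. In particular, there are universal constants $C_2,C_3>0$ such that if $\chi\ge C_2n$, then embedding dimension $k\ge C_3r$ suffices to achieve these guarantees.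
   Context: $\|\cdot\|_{\rm F}$, $\|\cdot\|_*$: Frobenius and nuclear norms. $[\![\mathbf A]\!]_r$: a best rank-$r$ approximation of $\mathbf A$ (truncated SVD, Eckart–Young–Mirsky). Nyström approximation: $\mathbf A\langle\mathbf\Omega\rangle=\mathbf A\mathbf\Omega(\mathbf\Omega^*\mathbf A\mathbf\Omega)^+\mathbf\Omega^*\mathbf A$, with $^+$ the Moore–Penrose pseudoinverse. Let $d,\chi\ge1$ and $n\ge2$ be integers. A real rMPS (random matrix product state) of order $n$, physical dimension $d$ and bond dimension $\chi$ is the random vector $\boldsymbol\omega\in\mathbb{R}^{d^n}$ with entries $$\boldsymbol\omega(i_1,\dots,i_n)=\sum_{\alpha_1,\dots,\alpha_{n-1}=1}^{\chi}G_1(i_1,\alpha_1)\,G_2(\alpha_1,i_2,\alpha_2)\cdots G_{n-1}(\alpha_{n-2},i_{n-1},\alpha_{n-1})\,G_n(\alpha_{n-1},i_n),\quad (i_1,\dots,i_n)\in\{1,\dots,d\}^n,$$ where $G_1\in\mathbb{R}^{d\times\chi}$, $G_n\in\mathbb{R}^{\chi\times d}$, $G_p\in\mathbb{R}^{\chi\times d\times\chi}$ for $1<p<n$, and all entries of all cores are independent centered real Gaussians, with variance $1/\chi$ for the entries of $G_p$, $1<p<n$, and variance $1/\sqrt\chi$ for the entries of $G_1,G_n$. A real rMPS test matrix with embedding dimension $k$ is $\mathbf\Omega=k^{-1/2}[\boldsymbol\omega_1,\dots,\boldsymbol\omega_k]$ with $\boldsymbol\omega_1,\dots,\boldsymbol\omega_k$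 iid rMPS vectors. *)

theory Defs
  imports
    "HOL-Probability.Probability"
    "Jordan_Normal_Form.Char_Poly"
    "Jordan_Normal_Form.DL_Rank"
begin

unbundle no vec_syntax
unbundle no inner_syntax

text \<open>
  Dimensions such as \<open>d ^ n\<close> and \<open>k\<close> vary under the quantifiers that follow the universal
  constants, so matrices are those of \<open>Jordan_Normal_Form\<close>, with explicit carriers.
\<close>

section \<open>Matrix notions\<close>

definition psd :: "real mat \<Rightarrow> bool" where
  "psd A \<longleftrightarrow> A \<in> carrier_mat (dim_row A) (dim_row A) \<and> transpose_mat A = A \<and>
     (\<forall>v \<in> carrier_vec (dim_row A). 0 \<le> v \<bullet> (A *\<^sub>v v))"

definition frob_norm :: "real mat \<Rightarrow> real" where
  "frob_norm A = sqrt (\<Sum>i<dim_row A. \<Sum>j<dim_col A. (A $$ (i, j))\<^sup>2)"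

text \<open>
  The characteristic polynomial of \<open>A\<^sup>T A\<close> splits over the reals, so its multiset of roots
  consists of all squared singular values of \<open>A\<close>, one for each column (extra zeros included).
\<close>

definition singular_values :: "real mat \<Rightarrow> real multiset" where
  "singular_values A = image_mset sqrt (proots (char_poly (transpose_mat A * A)))"

definition nuclear_norm :: "real mat \<Rightarrow> real" where
  "nuclear_norm A = (\<Sum>s\<in>#singular_values A. s)"

abbreviation mat_rank :: "real mat \<Rightarrow> nat" where
  "mat_rank A \<equiv> vec_space.rank (dim_row A) A"

text \<open>
  Best approximation is taken in the Frobenius norm. Its minimizers are exactly the truncated
  singular value decompositions, which are also best in every unitarily invariant norm; they need
  not be unique, hence a predicate.
\<close>

definition best_rank_approx :: "nat \<Rightarrow> real mat \<Rightarrow> real mat \<Rightarrow> bool" where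
  "best_rank_approx r A B \<longleftrightarrow>
     B \<in> carrier_mat (dim_row A) (dim_col A) \<and> mat_rank B \<le> r \<and>
     (\<forall>X \<in> carrier_mat (dim_row A) (dim_col A).
        mat_rank X \<le> r \<longrightarrow> frob_norm (A - B) \<le> frob_norm (A - X))"

definition is_pinv :: "real mat \<Rightarrow> real mat \<Rightarrow> bool" where
  "is_pinv A X \<longleftrightarrow> X \<in> carrier_mat (dim_col A) (dim_row A) \<and>
     A * X * A = A \<and> X * A * X = X \<and>
     transpose_mat (A * X) = A * X \<and> transpose_mat (X * A) = X * A"

definition pinv :: "real mat \<Rightarrow> real mat" where
  "pinv A = (THE X. is_pinv A X)"

definition nystrom :: "real mat \<Rightarrow> real mat \<Rightarrow> real mat" where
  "nystrom A \<Omega> =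
     A * \<Omega> * pinv (transpose_mat \<Omega> * A * \<Omega>) * (transpose_mat \<Omega> * A)"


section \<open>Random matrix product states\<close>

text \<open>
  Names of the core entries: \<open>First i \<alpha>\<close> is the entry of \<open>G\<^sub>1\<close> at \<open>(i, \<alpha>)\<close>,
  \<open>Inner p \<alpha> i \<beta>\<close> that of \<open>G\<^sub>p\<close> at \<open>(\<alpha>, i, \<beta>)\<close>, and \<open>Last \<alpha> i\<close> that of \<open>G\<^sub>n\<close> at \<open>(\<alpha>, i)\<close>.
  Sites \<open>p\<close> are numbered from 1 to \<open>n\<close>; physical and bond indices start at 0.
\<close>

datatype core_entry = First nat nat | Inner nat nat nat nat | Last nat nat

definition core_entries :: "nat \<Rightarrow> nat \<Rightarrow> nat \<Rightarrow> core_entry set" where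
  "core_entries d n \<chi> =
     {First i \<alpha> | i \<alpha>. i < d \<and> \<alpha> < \<chi>} \<union>
     {Inner p \<alpha> i \<beta> | p \<alpha> i \<beta>. 1 < p \<and> p < n \<and> \<alpha> < \<chi> \<and> i < d \<and> \<beta> < \<chi>} \<union>
     {Last \<alpha> i | \<alpha> i. \<alpha> < \<chi> \<and> i < d}"

fun entry_variance :: "nat \<Rightarrow> core_entry \<Rightarrow> real" where
  "entry_variance \<chi> (First i \<alpha>) = 1 / sqrt (real \<chi>)"
| "entry_variance \<chi> (Inner p \<alpha> i \<beta>) = 1 / real \<chi>"
| "entry_variance \<chi> (Last \<alpha> i) = 1 / sqrt (real \<chi>)"

text \<open>The second parameter of \<^const>\<open>normal_density\<close> is the standard deviation.\<close>

definition core_law :: "nat \<Rightarrow> nat \<Rightarrow> nat \<Rightarrow> (core_entry \<Rightarrow> real) measure" where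
  "core_law d n \<chi> =
     Pi\<^sub>M (core_entries d n \<chi>)
       (\<lambda>e. density lborel (\<lambda>x. ennreal (normal_density 0 (sqrt (entry_variance \<chi> e)) x)))"

text \<open>
  Vector positions \<open>I < d ^ n\<close> enumerate the multi-indices \<open>(i\<^sub>1, \<dots>, i\<^sub>n)\<close> lexicographically:
  \<open>i\<^sub>p\<close> is the \<open>p\<close>-th digit of \<open>I\<close> in base \<open>d\<close>, most significant first.
\<close>

definition phys_index :: "nat \<Rightarrow> nat \<Rightarrow> nat \<Rightarrow> nat \<Rightarrow> nat" where
  "phys_index d n I p = (I div d ^ (n - p)) mod d"

definition mps_vec :: "nat \<Rightarrow> nat \<Rightarrow> nat \<Rightarrow> (core_entry \<Rightarrow> real) \<Rightarrow> real vec" where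
  "mps_vec d n \<chi> G = vec (d ^ n) (\<lambda>I.
     \<Sum>\<alpha> \<in> {1..n - 1} \<rightarrow>\<^sub>E {..<\<chi>}.
       G (First (phys_index d n I 1) (\<alpha> 1)) *
       (\<Prod>p = 2..n - 1. G (Inner p (\<alpha> (p - 1)) (phys_index d n I p) (\<alpha> p))) *
       G (Last (\<alpha> (n - 1)) (phys_index d n I n)))"

text \<open>
  The canonical sample space: \<open>k\<close> independent copies of the cores. Only the law of the test matrix
  matters, and fixing the space keeps the constants independent of any sample space type.
\<close>

definition rmps_space :: "nat \<Rightarrow> nat \<Rightarrow> nat \<Rightarrow> nat \<Rightarrow> (nat \<Rightarrow> core_entry \<Rightarrow> real) measure" where
  "rmps_space d n \<chi> k = Pi\<^sub>M {..<k} (\<lambda>_. core_law d n \<chi>)"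

definition rmps_test_matrix ::
  "nat \<Rightarrow> nat \<Rightarrow> nat \<Rightarrow> nat \<Rightarrow> (nat \<Rightarrow> core_entry \<Rightarrow> real) \<Rightarrow> real mat" where
  "rmps_test_matrix d n \<chi> k \<omega> =
     (1 / sqrt (real k)) \<cdot>\<^sub>m mat_of_cols (d ^ n) (map (\<lambda>j. mps_vec d n \<chi> (\<omega> j)) [0..<k])"

text \<open>The two error bounds; \<open>B\<close> is a best rank-\<open>r\<close> approximation and \<open>A'\<close> the computed one.\<close>

definition nystrom_guarantees ::
  "real \<Rightarrow> nat \<Rightarrow> real mat \<Rightarrow> real mat \<Rightarrow> real mat \<Rightarrow> bool" where
  "nystrom_guarantees C r A B A' \<longleftrightarrow>
     nuclear_norm (A - A') \<le> C * nuclear_norm (A - B) \<and>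
     (frob_norm (A - A'))\<^sup>2 \<le>
       C * ((frob_norm (A - B))\<^sup>2 + 1 / real r * (nuclear_norm (A - B))\<^sup>2)"

end

theory Submission
  imports Defs
begin

text \<open>
  Let \<open>l 0 \<ge> l 1 \<ge> \<dots>\<close> be the eigenvalues of \<open>A\<close> with orthonormal eigenvectors \<open>v i\<close>, and call the
  indices \<open>i \<ge> r\<close> the tail. Three independent facts give the theorem.

  \<^item> \<^emph>\<open>Deterministic part.\<close> The Nystrom residual \<open>R\<close> is a Schur complement:
    \<open>x \<bullet> R x = min\<^sub>y (x - W y) \<bullet> A (x - W y)\<close>. If the sketch \<open>W\<close> is injective on the leading
    eigenvectors, \<open>y\<close> can be chosen linearly in \<open>x\<close>, and with controlled norm, so that \<open>x - W y\<close>
    has only tail coordinates. Hence \<open>R\<close> is dominated by the tail of \<open>A\<close> plus the sketched tail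
    (\<open>nystrom_error_bounds\<close>). Conversely, every matrix of rank at most \<open>r\<close> has nuclear and
    Frobenius error at least that of the tail (\<open>tail_sums_le_low_rank_error\<close>).

  \<^item> \<^emph>\<open>Moments.\<close> For an rMPS vector \<open>\<omega>\<close> and a fixed vector \<open>x\<close>, the inner product of \<open>\<omega>\<close> and \<open>x\<close>
    has second moment \<open>|x|\<^sup>2\<close> and fourth moment at most \<open>h |x|\<^sup>4\<close> with
    \<open>h = 3 (1 + 2 / \<chi>) ^ (n - 1)\<close>. The cores are contracted with \<open>x\<close> from left to right; a core
    with an open bond to its right multiplies the second moment of the squared norm by at most
    \<open>1 + 2 / \<chi>\<close>, because its slices for different bond values are independent, and the last core,
    with no open bond, contributes the Gaussian factor \<open>3\<close> (\<open>mps_moments\<close>).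

  \<^item> \<^emph>\<open>Injectivity.\<close> Two moments of the squares suffice for a lower tail bound that is exponential in
    \<open>k / h\<close>, hence for a union bound over a net with \<open>exp (O(r))\<close> points when \<open>k\<close> is a large
    multiple of \<open>h r\<close>. The net consists of grid points. To pass to arbitrary vectors, each coordinate
    is rounded in the direction in which the quadratic form does not increase to first order, so that
    the rounding error is governed by the trace of the form and not by its largest eigenvalue,
    and the trace is controlled by Markov's inequality. This gives embedding dimension \<open>O(h r)\<close>
    without a logarithmic factor (\<open>subspace_injection\<close>).

  The sketched tail is bounded in expectation by the same moments (\<open>tail_sketch_moments\<close>).
  The probability of an event that is not measurable would be \<open>0\<close>, so the event in the theorem
  has to be shown measurable; the pseudoinverse is discontinuous, but it is a pointwise limit of
  rational functions of the matrix entries.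

  The second part of the theorem follows from the first, because
  \<open>(1 + 2 / \<chi>) ^ (n - 1) \<le> exp 2\<close> whenever \<open>\<chi> \<ge> n\<close>.
\<close>

section \<open>The spectral theorem for real symmetric matrices\<close>

definition onb :: "nat \<Rightarrow> (nat \<Rightarrow> real vec) \<Rightarrow> bool" where
  "onb n v \<longleftrightarrow> (\<forall>i<n. v i \<in> carrier_vec n) \<and>
     (\<forall>i<n. \<forall>j<n. v i \<bullet> v j = (if i = j then 1 else 0))"

lemma onb_carrier: "onb n v \<Longrightarrow> i < n \<Longrightarrow> v i \<in> carrier_vec n"
  and onb_dot: "onb n v \<Longrightarrow> i < n \<Longrightarrow> j < n \<Longrightarrow> v i \<bullet> v j = (if i = j then 1 else 0)"
  by (auto simp: onb_def)

lemma scalar_prod_self_nonneg: "0 \<le> x \<bullet> (x :: real vec)"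
  unfolding scalar_prod_def by (intro sum_nonneg) auto

lemma scalar_prod_self_eq_0:
  assumes "x \<in> carrier_vec n" "x \<bullet> (x :: real vec) = 0"
  shows "x = 0\<^sub>v n"
proof (rule eq_vecI)
  show "dim_vec x = dim_vec (0\<^sub>v n)" using assms by simp
  fix i assume i: "i < dim_vec (0\<^sub>v n :: real vec)"
  have "\<forall>j\<in>{0..<n}. x $ j * x $ j = 0"
    using assms by (subst sum_nonneg_eq_0_iff[symmetric]) (auto simp: scalar_prod_def)
  then show "x $ i = 0\<^sub>v n $ i" using i by simp
qed

lemma symmetric_scalar_prod:
  assumes "A \<in> carrier_mat n n" "transpose_mat A = (A :: real mat)"
    and "x \<in> carrier_vec n" "y \<in> carrier_vec n"
  shows "x \<bullet> (A *\<^sub>v y) = (A *\<^sub>v x) \<bullet> y"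
  using transpose_vec_mult_scalar[of A n n y x] assms by simp

text \<open>
  A complex eigenvalue exists by the fundamental theorem of algebra; it is real because the form is
  symmetric, so it is already a root of the real characteristic polynomial.
\<close>

lemma symmetric_real_eigenvector:
  fixes A :: "real mat"
  assumes A: "A \<in> carrier_mat n n" and sym: "transpose_mat A = A" and n: "0 < n"
  obtains e u where "u \<in> carrier_vec n" "u \<bullet> u = 1" "A *\<^sub>v u = e \<cdot>\<^sub>v u"
proof -
  define C where "C = map_mat complex_of_real A"
  have C: "C \<in> carrier_mat n n" using A by (simp add: C_def)
  have "degree (char_poly C) = n" using degree_monic_char_poly[OF C] by simp
  then have "\<not> constant (poly (char_poly C))" using n by (simp add: constant_degree)
  then obtain z where z: "poly (char_poly C) z = 0"
    using fundamental_theorem_of_algebra by blast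
  then have "eigenvalue C z" using eigenvalue_root_char_poly[OF C] by simp
  then obtain w where w: "w \<in> carrier_vec n" "w \<noteq> 0\<^sub>v n" "C *\<^sub>v w = z \<cdot>\<^sub>v w"
    using C unfolding eigenvalue_def eigenvector_def by auto
  have sumw: "(\<Sum>j<n. of_real (A $$ (i, j)) * w $ j) = z * w $ i" if "i < n" for i
  proof -
    have "(C *\<^sub>v w) $ i = (\<Sum>j<n. of_real (A $$ (i, j)) * w $ j)"
      using that A w(1) by (auto simp: C_def scalar_prod_def atLeast0LessThan intro!: sum.cong)
    then show ?thesis using w that by simp
  qed
  \<comment> \<open>\<open>w\<^sup>* A w\<close> is its own complex conjugate, which forces the eigenvalue \<open>z\<close> to be real\<close>
  define t where "t = (\<Sum>i<n. cnj (w $ i) * w $ i)"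
  have "z * t = (\<Sum>i<n. cnj (w $ i) * (z * w $ i))"
    by (simp add: t_def sum_distrib_left mult_ac)
  also have "\<dots> = (\<Sum>i<n. cnj (w $ i) * (\<Sum>j<n. of_real (A $$ (i, j)) * w $ j))"
    by (intro sum.cong refl) (simp add: sumw)
  also have "\<dots> = (\<Sum>i<n. \<Sum>j<n. cnj (w $ i) * (of_real (A $$ (i, j)) * w $ j))"
    by (simp add: sum_distrib_left)
  also have "\<dots> = (\<Sum>j<n. \<Sum>i<n. cnj (w $ i) * (of_real (A $$ (i, j)) * w $ j))"
    by (rule sum.swap)
  also have "\<dots> = (\<Sum>j<n. cnj (\<Sum>i<n. of_real (A $$ (j, i)) * w $ i) * w $ j)"
  proof (rule sum.cong[OF refl])
    fix j assume j: "j \<in> {..<n}"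
    have "A $$ (i, j) = A $$ (j, i)" if "i < n" for i
      using sym A j that by (metis carrier_matD index_transpose_mat(1) lessThan_iff)
    then show "(\<Sum>i<n. cnj (w $ i) * (of_real (A $$ (i, j)) * w $ j)) =
      cnj (\<Sum>i<n. of_real (A $$ (j, i)) * w $ i) * w $ j"
      by (simp add: sum_distrib_right sum_distrib_left mult_ac)
  qed
  also have "\<dots> = cnj z * t"
  proof -
    have "(\<Sum>j<n. cnj (\<Sum>i<n. of_real (A $$ (j, i)) * w $ i) * w $ j) = (\<Sum>j<n. cnj (z * w $ j) * w $ j)"
      by (intro sum.cong refl) (simp add: sumw)
    then show ?thesis by (simp add: t_def sum_distrib_left mult_ac)
  qed
  finally have eq: "z * t = cnj z * t" .
  have t: "t = of_real (\<Sum>i<n. (cmod (w $ i))\<^sup>2)"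
    unfolding t_def of_real_sum complex_norm_square by (simp add: mult.commute)
  have "\<exists>i<n. w $ i \<noteq> 0"
  proof (rule ccontr)
    assume "\<not> ?thesis"
    then have "w = 0\<^sub>v n" using w by (intro eq_vecI) auto
    then show False using w by simp
  qed
  then have "(\<Sum>i<n. (cmod (w $ i))\<^sup>2) > 0"
    by (metis finite_lessThan lessThan_iff sum_pos2 zero_le_power2 zero_less_norm_iff zero_less_power)
  then have "t \<noteq> 0" unfolding t of_real_eq_0_iff by simp
  with eq have "z = cnj z" by simp
  then have "z = of_real (Re z)" by (simp add: complex_eq_iff)
  then have "poly (char_poly A) (Re z) = 0"
    using z of_real_hom.char_poly_hom[OF A]
    by (metis C_def of_real_eq_0_iff of_real_hom.poly_map_poly)
  then have "eigenvalue A (Re z)" using eigenvalue_root_char_poly[OF A] by simp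
  then obtain x where x: "x \<in> carrier_vec n" "x \<noteq> 0\<^sub>v n" "A *\<^sub>v x = Re z \<cdot>\<^sub>v x"
    using A unfolding eigenvalue_def eigenvector_def by auto
  define c where "c = 1 / sqrt (x \<bullet> x)"
  have "x \<bullet> x > 0"
    using scalar_prod_self_nonneg[of x] scalar_prod_self_eq_0[of x n] x by fastforce
  then have c: "c * c * (x \<bullet> x) = 1" by (simp add: c_def)
  show thesis
  proof (rule that[of "c \<cdot>\<^sub>v x" "Re z"])
    show "c \<cdot>\<^sub>v x \<in> carrier_vec n" using x by simp
    show "(c \<cdot>\<^sub>v x) \<bullet> (c \<cdot>\<^sub>v x) = 1" using x c by simp
    show "A *\<^sub>v (c \<cdot>\<^sub>v x) = Re z \<cdot>\<^sub>v (c \<cdot>\<^sub>v x)"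
      using x A by (simp add: mult_mat_vec[of A n n] smult_smult_assoc mult.commute)
  qed
qed

text \<open>
  The Householder reflection in the hyperplane orthogonal to \<open>w = e\<^sub>0 - u\<close>.
\<close>

lemma reflection_onto_first_axis:
  fixes u :: "real vec"
  assumes u: "u \<in> carrier_vec (Suc n)" "u \<bullet> u = 1"
  obtains H where "H \<in> carrier_mat (Suc n) (Suc n)" "transpose_mat H = H"
    "H * H = 1\<^sub>m (Suc n)" "H *\<^sub>v unit_vec (Suc n) 0 = u"
proof (cases "u = unit_vec (Suc n) 0")
  case True
  show ?thesis by (rule that[of "1\<^sub>m (Suc n)"]) (auto simp: True)
next
  case False
  let ?N = "Suc n"
  define w where "w = unit_vec ?N 0 - u"
  have w: "w \<in> carrier_vec ?N" using u by (simp add: w_def)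
  have wi: "w $ i = (if i = 0 then 1 else 0) - u $ i" if "i < ?N" for i
    using that u by (auto simp: w_def)
  define s where "s = (\<Sum>i<?N. w $ i * w $ i)"
  have s: "s = w \<bullet> w" using w by (simp add: s_def scalar_prod_def atLeast0LessThan)
  have "w \<noteq> 0\<^sub>v ?N"
  proof
    assume 0: "w = 0\<^sub>v ?N"
    have "u = unit_vec ?N 0"
    proof (rule eq_vecI)
      fix i assume "i < dim_vec (unit_vec ?N 0 :: real vec)"
      then show "u $ i = unit_vec ?N 0 $ i" using wi[of i] 0 by (auto)
    qed (use u in auto)
    with False show False ..
  qed
  then have s0: "s \<noteq> 0" using s scalar_prod_self_eq_0[OF w] by auto
  have u1: "(\<Sum>i<?N. u $ i * u $ i) = 1" using u by (simp add: scalar_prod_def atLeast0LessThan)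
  have s2: "s = 2 * w $ 0"
  proof -
    have "s = (\<Sum>i<?N. (if i = 0 then 1 - 2 * u $ 0 else 0) + u $ i * u $ i)"
      unfolding s_def by (rule sum.cong) (auto simp: wi algebra_simps)
    also have "\<dots> = (1 - 2 * u $ 0) + 1" by (simp only: sum.distrib u1) simp
    finally show ?thesis using wi[of 0] by simp
  qed
  define H where "H = mat ?N ?N (\<lambda>(i, j). (if i = j then 1 else 0) - 2 / s * (w $ i * w $ j))"
  have H: "H \<in> carrier_mat ?N ?N" by (simp add: H_def)
  have "transpose_mat H = H" by (rule eq_matI) (auto simp: H_def)
  moreover have "H * H = 1\<^sub>m ?N"
  proof (rule eq_matI)
    fix i j assume ij: "i < dim_row (1\<^sub>m ?N :: real mat)" "j < dim_col (1\<^sub>m ?N :: real mat)"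
    define c where "c = 2 / s"
    have "(H * H) $$ (i, j) = (\<Sum>l<?N. ((if i = l then 1 else 0) - c * (w $ i * w $ l)) *
        ((if l = j then 1 else 0) - c * (w $ l * w $ j)))"
      using ij by (auto simp: H_def c_def scalar_prod_def atLeast0LessThan intro!: sum.cong)
    also have "\<dots> = (\<Sum>l<?N. (if l = i then (if i = j then 1 else 0) - c * (w $ i * w $ j) else 0)
       - (if l = j then c * (w $ i * w $ j) else 0)
       + c * c * w $ i * w $ j * (w $ l * w $ l))"
      by (rule sum.cong) (auto simp: algebra_simps)
    also have "\<dots> = (if i = j then 1 else 0) - c * (w $ i * w $ j) - c * (w $ i * w $ j)
       + c * c * w $ i * w $ j * s"
      unfolding sum.distrib sum_subtractf s_def sum_distrib_left[symmetric]
      using ij by simp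
    also have "\<dots> = (if i = j then 1 else 0)"
    proof -
      have "c * s = 2" using s0 by (simp add: c_def)
      then have "c * c * w $ i * w $ j * s = c * (w $ i * w $ j) * 2"
        by (metis mult.assoc mult.commute)
      then show ?thesis by simp
    qed
    finally show "(H * H) $$ (i, j) = 1\<^sub>m ?N $$ (i, j)" using ij by simp
  qed (auto simp: H_def)
  moreover have "H *\<^sub>v unit_vec ?N 0 = u"
  proof (rule eq_vecI)
    fix i assume i: "i < dim_vec u"
    then have i: "i < ?N" using u by simp
    have "(H *\<^sub>v unit_vec ?N 0) $ i = (if i = 0 then 1 else 0) - 2 / s * (w $ i * w $ 0)"
      using i by (simp add: H_def)
    also have "\<dots> = (if i = 0 then 1 else 0) - w $ i" using s0 s2 by (simp add: field_simps)
    also have "\<dots> = u $ i" using wi[OF i] by simp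
    finally show "(H *\<^sub>v unit_vec ?N 0) $ i = u $ i" .
  qed (use u in \<open>auto simp: H_def\<close>)
  ultimately show ?thesis using that H by blast
qed

text \<open>
  Deflation: after a reflection that moves an eigenvector to the first axis, the first row and column
  of the symmetric matrix vanish off the diagonal, and the induction hypothesis applies to the
  remaining block.
\<close>

lemma symmetric_eigenbasis:
  fixes A :: "real mat"
  assumes "A \<in> carrier_mat n n" "transpose_mat A = A"
  shows "\<exists>v l. onb n v \<and> (\<forall>i<n. A *\<^sub>v v i = l i \<cdot>\<^sub>v v i)"
  using assms
proof (induction n arbitrary: A)
  case 0
  then show ?case by (auto simp: onb_def)
next
  case (Suc n)
  let ?N = "Suc n"
  note A = Suc.prems(1) and sym = Suc.prems(2)
  obtain e u where u: "u \<in> carrier_vec ?N" "u \<bullet> u = 1" "A *\<^sub>v u = e \<cdot>\<^sub>v u"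
    using symmetric_real_eigenvector[OF A sym] by blast
  obtain H where H: "H \<in> carrier_mat ?N ?N" "transpose_mat H = H" "H * H = 1\<^sub>m ?N"
    "H *\<^sub>v unit_vec ?N 0 = u"
    using reflection_onto_first_axis[OF u(1,2)] .
  define A' where "A' = H * (A * H)"
  have A': "A' \<in> carrier_mat ?N ?N" using A H by (simp add: A'_def)
  have symA': "transpose_mat A' = A'"
    using A H sym by (simp add: A'_def transpose_mult[of _ ?N ?N _ ?N] assoc_mult_mat[of _ ?N ?N _ ?N _ ?N])
  have HH: "H *\<^sub>v (H *\<^sub>v x) = x" if "x \<in> carrier_vec ?N" for x
    using that H by (simp flip: assoc_mult_mat_vec[of _ ?N ?N _ ?N])
  have A'v: "A' *\<^sub>v x = H *\<^sub>v (A *\<^sub>v (H *\<^sub>v x))" if "x \<in> carrier_vec ?N" for x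
    using that A H by (simp add: A'_def assoc_mult_mat_vec[of _ ?N ?N _ ?N])
  have Hu: "H *\<^sub>v u = unit_vec ?N 0" using HH[of "unit_vec ?N 0"] H by simp
  have A'0: "A' *\<^sub>v unit_vec ?N 0 = e \<cdot>\<^sub>v unit_vec ?N 0"
    using A'v[of "unit_vec ?N 0"] H u Hu by (simp add: mult_mat_vec[of _ ?N ?N])
  have col0: "A' $$ (i, 0) = (if i = 0 then e else 0)" if "i < ?N" for i
  proof -
    have "(A' *\<^sub>v unit_vec ?N 0) $ i = A' $$ (i, 0)" using that A' by simp
    then show ?thesis using A'0 that by auto
  qed
  have row0: "A' $$ (0, i) = (if i = 0 then e else 0)" if "i < ?N" for i
    using col0[OF that] symA' A' that by (metis carrier_matD index_transpose_mat(1) zero_less_Suc)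
  define A3 where "A3 = mat n n (\<lambda>(i, j). A' $$ (Suc i, Suc j))"
  have A3: "A3 \<in> carrier_mat n n" by (simp add: A3_def)
  have "transpose_mat A3 = A3"
  proof (rule eq_matI)
    fix i j assume "i < dim_row A3" "j < dim_col A3"
    then have ij: "i < n" "j < n" using A3 by auto
    then have "A' $$ (Suc j, Suc i) = A' $$ (Suc i, Suc j)"
      using symA' A' by (metis Suc_less_eq carrier_matD index_transpose_mat(1))
    then show "transpose_mat A3 $$ (i, j) = A3 $$ (i, j)" using ij by (simp add: A3_def)
  qed (auto simp: A3_def)
  then obtain v l where v: "onb n v" "\<And>i. i < n \<Longrightarrow> A3 *\<^sub>v v i = l i \<cdot>\<^sub>v v i"
    using Suc.IH[OF A3] by blast
  define w where "w i = (case i of 0 \<Rightarrow> unit_vec ?N 0 | Suc j \<Rightarrow> vCons 0 (v j))" for i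
  define l' where "l' i = (case i of 0 \<Rightarrow> e | Suc j \<Rightarrow> l j)" for i
  have w: "w i \<in> carrier_vec ?N" if "i < ?N" for i
    using that onb_carrier[OF v(1)] by (auto simp: w_def split: nat.splits)
  have w_dot: "w i \<bullet> w j = (if i = j then 1 else 0)" if "i < ?N" "j < ?N" for i j
  proof -
    have [simp]: "unit_vec ?N 0 \<bullet> vCons 0 (v k) = 0" "vCons 0 (v k) \<bullet> unit_vec ?N 0 = 0" if "k < n" for k
      using onb_carrier[OF v(1) that] by (simp_all)
    show ?thesis
      using that onb_dot[OF v(1)] by (cases i; cases j) (simp_all add: w_def)
  qed
  have w_ev: "A' *\<^sub>v w i = l' i \<cdot>\<^sub>v w i" if "i < ?N" for i
  proof (cases i)
    case 0
    then show ?thesis using A'0 by (simp add: w_def l'_def)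
  next
    case (Suc j)
    then have j: "j < n" using that by simp
    note vj = onb_carrier[OF v(1) j]
    show ?thesis
    proof (rule eq_vecI)
      fix a assume "a < dim_vec (l' i \<cdot>\<^sub>v w i)"
      then have a: "a < ?N" using w[OF that] by simp
      have "(A' *\<^sub>v w i) $ a = (\<Sum>b<?N. A' $$ (a, b) * w i $ b)"
        using a A' w[OF that] by (auto simp: scalar_prod_def atLeast0LessThan intro!: sum.cong)
      also have "\<dots> = (\<Sum>b<n. A' $$ (a, Suc b) * v j $ b)"
        unfolding sum.lessThan_Suc_shift using vj by (simp add: w_def Suc)
      also have "\<dots> = (l' i \<cdot>\<^sub>v w i) $ a"
      proof (cases a)
        case 0
        then show ?thesis using row0 vj by (simp add: w_def l'_def Suc)
      next
        case (Suc c)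
        then have "(\<Sum>b<n. A' $$ (a, Suc b) * v j $ b) = (A3 *\<^sub>v v j) $ c"
          using a vj by (auto simp: scalar_prod_def atLeast0LessThan A3_def intro!: sum.cong)
        then show ?thesis using v(2)[OF j] Suc a \<open>i = Suc j\<close> vj by (simp add: w_def l'_def)
      qed
      finally show "(A' *\<^sub>v w i) $ a = (l' i \<cdot>\<^sub>v w i) $ a" .
    qed (use A' w[OF that] in auto)
  qed
  have AH: "A *\<^sub>v (H *\<^sub>v x) = H *\<^sub>v (A' *\<^sub>v x)" if "x \<in> carrier_vec ?N" for x
    using that A H by (simp add: A'v HH)
  show ?case
  proof (intro exI conjI allI impI)
    show "onb ?N (\<lambda>i. H *\<^sub>v w i)"
      unfolding onb_def
    proof (intro conjI allI impI)
      fix i j assume ij: "i < ?N" "j < ?N"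
      have "(H *\<^sub>v w i) \<bullet> (H *\<^sub>v w j) = w i \<bullet> (H *\<^sub>v (H *\<^sub>v w j))"
        using symmetric_scalar_prod[OF H(1,2) w[OF ij(1)], of "H *\<^sub>v w j"] H w ij by simp
      then show "(H *\<^sub>v w i) \<bullet> (H *\<^sub>v w j) = (if i = j then 1 else 0)"
        using HH[OF w[OF ij(2)]] w_dot[OF ij] by simp
    qed (use H w in auto)
    fix i assume i: "i < ?N"
    show "A *\<^sub>v (H *\<^sub>v w i) = l' i \<cdot>\<^sub>v (H *\<^sub>v w i)"
      using AH[OF w[OF i]] w_ev[OF i] w[OF i] H by (simp add: mult_mat_vec[of _ ?N ?N])
  qed
qed

lemma symmetric_sorted_eigenbasis:
  fixes A :: "real mat"
  assumes "A \<in> carrier_mat n n" "transpose_mat A = A"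
  obtains v l where "onb n v" "\<And>i. i < n \<Longrightarrow> A *\<^sub>v v i = l i \<cdot>\<^sub>v v i"
    "\<And>i j. i \<le> j \<Longrightarrow> j < n \<Longrightarrow> l j \<le> l i"
proof -
  obtain v l where v: "onb n v" "\<And>i. i < n \<Longrightarrow> A *\<^sub>v v i = l i \<cdot>\<^sub>v v i"
    using symmetric_eigenbasis[OF assms] by blast
  define js where "js = sort_key (\<lambda>i. - l i) [0..<n]"
  have js: "length js = n" "set js = {0..<n}" "distinct js" "sorted (map (\<lambda>i. - l i) js)"
    by (auto simp: js_def)
  have jsn: "js ! i < n" if "i < n" for i
    using nth_mem[of i js] that js by auto
  show thesis
  proof (rule that[of "\<lambda>i. v (js ! i)" "\<lambda>i. l (js ! i)"])
    show "onb n (\<lambda>i. v (js ! i))"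
      using v(1) jsn js(1,3) by (auto simp: onb_def nth_eq_iff_index_eq)
    show "A *\<^sub>v v (js ! i) = l (js ! i) \<cdot>\<^sub>v v (js ! i)" if "i < n" for i
      using v(2) jsn that by blast
    show "l (js ! j) \<le> l (js ! i)" if "i \<le> j" "j < n" for i j
      using sorted_nth_mono[OF js(4), of i j] that js(1) by simp
  qed
qed

lemma onb_matrix:
  assumes "onb n v"
  defines "V \<equiv> mat_of_cols n (map v [0..<n])"
  shows "V \<in> carrier_mat n n" "transpose_mat V * V = 1\<^sub>m n" "V * transpose_mat V = 1\<^sub>m n"
    "\<And>i. i < n \<Longrightarrow> col V i = v i"
proof -
  show V: "V \<in> carrier_mat n n" by (simp add: V_def mat_of_cols_def)
  show col: "col V i = v i" if "i < n" for i
    using that onb_carrier[OF assms(1) that] by (simp add: V_def)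
  show VV: "transpose_mat V * V = 1\<^sub>m n"
    by (rule eq_matI) (use V onb_dot[OF assms(1)] in \<open>auto simp: col\<close>)
  show "V * transpose_mat V = 1\<^sub>m n"
    using mat_mult_left_right_inverse[OF _ V VV] V by simp
qed

lemma onb_parseval:
  assumes v: "onb n v" and x: "x \<in> carrier_vec n" and y: "y \<in> carrier_vec n"
  shows "x \<bullet> y = (\<Sum>i<n. (v i \<bullet> x) * (v i \<bullet> y))"
proof -
  define V where "V = mat_of_cols n (map v [0..<n])"
  note V = onb_matrix[OF v, folded V_def]
  have idx: "(transpose_mat V *\<^sub>v z) $ i = v i \<bullet> z" if "i < n" for z i
    using that V by simp
  have "(transpose_mat V *\<^sub>v x) \<bullet> (transpose_mat V *\<^sub>v y) = x \<bullet> (V *\<^sub>v (transpose_mat V *\<^sub>v y))"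
    using transpose_vec_mult_scalar[OF V(1), of "transpose_mat V *\<^sub>v y" x] V x y by simp
  also have "V *\<^sub>v (transpose_mat V *\<^sub>v y) = y"
    using V y by (simp flip: assoc_mult_mat_vec[of _ n n _ n])
  finally have "x \<bullet> y = (transpose_mat V *\<^sub>v x) \<bullet> (transpose_mat V *\<^sub>v y)" by simp
  also have "\<dots> = (\<Sum>i<n. (v i \<bullet> x) * (v i \<bullet> y))"
    unfolding scalar_prod_def[of "transpose_mat V *\<^sub>v x"]
    using V by (simp add: atLeast0LessThan)
  finally show ?thesis .
qed

lemma onb_bessel:
  assumes "onb n v" "x \<in> carrier_vec n" "I \<subseteq> {..<n}"
  shows "(\<Sum>i\<in>I. (v i \<bullet> x)\<^sup>2) \<le> x \<bullet> x"
proof -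
  have "(\<Sum>i\<in>I. (v i \<bullet> x)\<^sup>2) \<le> (\<Sum>i<n. (v i \<bullet> x)\<^sup>2)"
    using assms(3) by (intro sum_mono2) auto
  then show ?thesis using onb_parseval[OF assms(1,2,2)] by (simp add: power2_eq_square)
qed

lemma onb_unit_vecs: "onb n (unit_vec n)"
  by (auto simp: onb_def)

section \<open>Singular values and low-rank approximation\<close>

definition mat_tr :: "real mat \<Rightarrow> real" where
  "mat_tr A = (\<Sum>i<dim_row A. A $$ (i, i))"

text \<open>Parseval applied to each row.\<close>

lemma onb_frob:
  assumes v: "onb n v" and A: "A \<in> carrier_mat m n"
  shows "(\<Sum>i<n. (A *\<^sub>v v i) \<bullet> (A *\<^sub>v v i)) = (frob_norm A)\<^sup>2"
proof -
  have "(\<Sum>i<n. (A *\<^sub>v v i) \<bullet> (A *\<^sub>v v i)) = (\<Sum>i<n. \<Sum>a<m. (row A a \<bullet> v i) * (row A a \<bullet> v i))"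
    using A by (intro sum.cong) (auto simp: scalar_prod_def[of "A *\<^sub>v _" "A *\<^sub>v _"] atLeast0LessThan)
  also have "\<dots> = (\<Sum>a<m. \<Sum>i<n. (row A a \<bullet> v i) * (row A a \<bullet> v i))"
    by (rule sum.swap)
  also have "\<dots> = (\<Sum>a<m. row A a \<bullet> row A a)"
  proof (rule sum.cong[OF refl])
    fix a assume "a \<in> {..<m}"
    have r: "row A a \<in> carrier_vec n" using A by auto
    show "(\<Sum>i<n. (row A a \<bullet> v i) * (row A a \<bullet> v i)) = row A a \<bullet> row A a"
      unfolding onb_parseval[OF v r r]
      by (intro sum.cong) (auto simp: comm_scalar_prod[OF r onb_carrier[OF v]])
  qed
  also have "\<dots> = (\<Sum>a<m. \<Sum>j<n. (A $$ (a, j))\<^sup>2)"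
    using A by (intro sum.cong) (auto simp: scalar_prod_def atLeast0LessThan power2_eq_square)
  also have "\<dots> = (frob_norm A)\<^sup>2"
    using A by (simp add: frob_norm_def sum_nonneg)
  finally show ?thesis .
qed

lemma onb_trace:
  assumes v: "onb n v" and A: "A \<in> carrier_mat n n"
  shows "(\<Sum>i<n. v i \<bullet> (A *\<^sub>v v i)) = mat_tr A"
proof -
  have "(\<Sum>i<n. v i \<bullet> (A *\<^sub>v v i)) = (\<Sum>i<n. \<Sum>a<n. (v i \<bullet> unit_vec n a) * (v i \<bullet> row A a))"
  proof (intro sum.cong refl)
    fix i assume "i \<in> {..<n}"
    then have i: "v i \<in> carrier_vec n" using onb_carrier[OF v] by simp
    show "v i \<bullet> (A *\<^sub>v v i) = (\<Sum>a<n. (v i \<bullet> unit_vec n a) * (v i \<bullet> row A a))"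
      using i A comm_scalar_prod[OF i, of "row A _"]
      by (auto simp: scalar_prod_def[of "v i" "A *\<^sub>v v i"] atLeast0LessThan intro!: sum.cong)
  qed
  also have "\<dots> = (\<Sum>a<n. \<Sum>i<n. (v i \<bullet> unit_vec n a) * (v i \<bullet> row A a))"
    by (rule sum.swap)
  also have "\<dots> = (\<Sum>a<n. unit_vec n a \<bullet> row A a)"
    using A by (intro sum.cong refl onb_parseval[OF v, symmetric]) auto
  also have "\<dots> = mat_tr A" using A by (simp add: mat_tr_def)
  finally show ?thesis .
qed

lemma proots_prod_linear: "proots (\<Prod>a\<leftarrow>as. [:- a, 1:]) = mset (as :: real list)"
proof (induction as)
  case (Cons a as)
  have nz: "(\<Prod>a\<leftarrow>as. [:- a, 1:]) \<noteq> 0" by (auto simp: prod_list_zero_iff)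
  have "proots ([:- a, 1:] * (\<Prod>a\<leftarrow>as. [:- a, 1:])) = proots [:- a, 1:] + proots (\<Prod>a\<leftarrow>as. [:- a, 1:])"
    using nz by (intro proots_mult) auto
  then show ?case using Cons by (simp del: mult_pCons_left)
qed simp

lemma char_poly_roots_eigenbasis:
  assumes A: "A \<in> carrier_mat n n" and v: "onb n v"
    and ev: "\<And>i. i < n \<Longrightarrow> A *\<^sub>v v i = l i \<cdot>\<^sub>v v i"
  shows "proots (char_poly A) = mset (map l [0..<n])"
proof -
  define V where "V = mat_of_cols n (map v [0..<n])"
  note V = onb_matrix[OF v, folded V_def]
  have AV: "A * V = V * mat_diag n l"
  proof (rule eq_matI)
    fix i j assume "i < dim_row (V * mat_diag n l)" "j < dim_col (V * mat_diag n l)"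
    then have ij: "i < n" "j < n" using V by (auto simp: mat_diag_def)
    have "(A * V) $$ (i, j) = (A *\<^sub>v v j) $ i" using ij A V by simp
    also have "\<dots> = l j * v j $ i" using ev ij onb_carrier[OF v ij(2)] by simp
    also have "v j $ i = V $$ (i, j)" using V ij by (metis carrier_matD(1) carrier_matD(2) index_col)
    finally show "(A * V) $$ (i, j) = (V * mat_diag n l) $$ (i, j)"
      using ij V by (simp add: mat_diag_mult_right[OF V(1)])
  qed (use A V in \<open>auto simp: mat_diag_def\<close>)
  have "similar_mat_wit A (mat_diag n l) V (transpose_mat V)"
  proof (rule similar_mat_witI[of _ _ n])
    show "A = V * mat_diag n l * transpose_mat V"
      using AV A V by (metis assoc_mult_mat right_mult_one_mat transpose_carrier_mat)
  qed (use A V in \<open>auto simp: mat_diag_def\<close>)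
  then have "char_poly A = char_poly (mat_diag n l)"
    using char_poly_similar unfolding similar_mat_def by blast
  also have "\<dots> = (\<Prod>a\<leftarrow>diag_mat (mat_diag n l). [:- a, 1:])"
    by (rule char_poly_upper_triangular[of _ n]) (auto simp: mat_diag_def)
  also have "diag_mat (mat_diag n l) = map l [0..<n]"
    by (auto simp: diag_mat_def mat_diag_def)
  finally have cp: "char_poly A = (\<Prod>a\<leftarrow>map l [0..<n]. [:- a, 1:])" .
  show ?thesis unfolding cp proots_prod_linear ..
qed

lemma gram_scalar_prod:
  assumes "X \<in> carrier_mat m n" "x \<in> carrier_vec n" "y \<in> carrier_vec n"
  shows "x \<bullet> ((transpose_mat X * X) *\<^sub>v y) = (X *\<^sub>v x) \<bullet> (X *\<^sub>v (y :: real vec))"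
proof -
  have "(X *\<^sub>v x) \<bullet> (X *\<^sub>v y) = (X *\<^sub>v y) \<bullet> (X *\<^sub>v x)"
    using assms by (intro comm_scalar_prod[of _ m]) auto
  also have "\<dots> = (transpose_mat X *\<^sub>v (X *\<^sub>v y)) \<bullet> x"
    using assms transpose_vec_mult_scalar[of X m n x "X *\<^sub>v y"] by simp
  also have "\<dots> = x \<bullet> (transpose_mat X *\<^sub>v (X *\<^sub>v y))"
    using assms by (intro comm_scalar_prod[of _ n]) auto
  finally show ?thesis using assms by (simp add: assoc_mult_mat_vec[of _ n m _ n])
qed

text \<open>
  The eigenvalue of \<open>X\<^sup>T X\<close> at \<open>w i\<close> is the squared length of \<open>X w i\<close>.
\<close>

lemma nuclear_norm_singular_basis:
  assumes X: "X \<in> carrier_mat m n" and w: "onb n w"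
    and ev: "\<And>i. i < n \<Longrightarrow> (transpose_mat X * X) *\<^sub>v w i = e i \<cdot>\<^sub>v w i"
  shows "nuclear_norm X = (\<Sum>i<n. sqrt ((X *\<^sub>v w i) \<bullet> (X *\<^sub>v w i)))"
proof -
  have "nuclear_norm X = (\<Sum>i<n. sqrt (e i))"
    unfolding nuclear_norm_def singular_values_def
    using char_poly_roots_eigenbasis[OF _ w ev] X
    by (simp add: sum_mset_sum_list interv_sum_list_conv_sum_set_nat atLeast0LessThan del: mset_map mset_upt flip: mset_map)
  also have "\<dots> = (\<Sum>i<n. sqrt ((X *\<^sub>v w i) \<bullet> (X *\<^sub>v w i)))"
  proof (intro sum.cong refl)
    fix i assume "i \<in> {..<n}"
    then have i: "i < n" by simp
    note c = onb_carrier[OF w i]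
    have "e i = w i \<bullet> ((transpose_mat X * X) *\<^sub>v w i)"
      using ev[OF i] onb_dot[OF w i i] c by simp
    then show "sqrt (e i) = sqrt ((X *\<^sub>v w i) \<bullet> (X *\<^sub>v w i))"
      using gram_scalar_prod[OF X c c] by simp
  qed
  finally show ?thesis .
qed

lemma singular_basis_exists:
  assumes X: "X \<in> carrier_mat m n"
  obtains w e where "onb n w"
    "\<And>i. i < n \<Longrightarrow> (transpose_mat X * X) *\<^sub>v w i = e i \<cdot>\<^sub>v w i"
proof -
  have "transpose_mat (transpose_mat X * X) = transpose_mat X * X"
    using X by (simp add: transpose_mult[of _ n m _ n])
  then show ?thesis using symmetric_eigenbasis[of "transpose_mat X * X" n] X that by auto
qed

text \<open>
  The singular values of a psd matrix are its eigenvalues, so its nuclear norm is its trace;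
  this is also what makes the nuclear norm of the residual measurable.
\<close>

lemma nuclear_norm_psd:
  assumes S: "S \<in> carrier_mat n n" and psd: "psd S"
  shows "nuclear_norm S = mat_tr S"
proof -
  have sym: "transpose_mat S = S" using psd by (simp add: psd_def)
  obtain v l where v: "onb n v" and ev: "\<And>i. i < n \<Longrightarrow> S *\<^sub>v v i = l i \<cdot>\<^sub>v v i"
    using symmetric_eigenbasis[OF S sym] by blast
  have l: "v i \<bullet> (S *\<^sub>v v i) = l i" "0 \<le> l i" if "i < n" for i
  proof -
    show 1: "v i \<bullet> (S *\<^sub>v v i) = l i"
      using ev[OF that] onb_dot[OF v that that] onb_carrier[OF v that] by simp
    have "0 \<le> v i \<bullet> (S *\<^sub>v v i)" using psd S onb_carrier[OF v that] by (auto simp: psd_def)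
    with 1 show "0 \<le> l i" by simp
  qed
  have "nuclear_norm S = (\<Sum>i<n. sqrt ((S *\<^sub>v v i) \<bullet> (S *\<^sub>v v i)))"
  proof (rule nuclear_norm_singular_basis[OF S v])
    fix i assume i: "i < n"
    show "(transpose_mat S * S) *\<^sub>v v i = (l i * l i) \<cdot>\<^sub>v v i"
      using S ev[OF i] onb_carrier[OF v i]
      by (simp add: sym assoc_mult_mat_vec[of _ n n _ n] mult_mat_vec[of _ n n] smult_smult_assoc)
  qed
  also have "\<dots> = (\<Sum>i<n. v i \<bullet> (S *\<^sub>v v i))"
  proof (intro sum.cong refl)
    fix i assume "i \<in> {..<n}"
    then have i: "i < n" by simp
    show "sqrt ((S *\<^sub>v v i) \<bullet> (S *\<^sub>v v i)) = v i \<bullet> (S *\<^sub>v v i)"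
      using ev[OF i] onb_dot[OF v i i] onb_carrier[OF v i] l[OF i] by simp
  qed
  also have "\<dots> = mat_tr S" by (rule onb_trace[OF v S])
  finally show ?thesis .
qed

text \<open>
  One half of the duality between nuclear and operator norm: a partial isometry built from an
  orthonormal system is a contraction.
\<close>

lemma partial_trace_le_nuclear_norm:
  assumes X: "X \<in> carrier_mat n n" and u: "onb n u" and I: "I \<subseteq> {..<n}"
  shows "(\<Sum>i\<in>I. u i \<bullet> (X *\<^sub>v u i)) \<le> nuclear_norm X"
proof -
  obtain w e where w: "onb n w" and ev: "\<And>i. i < n \<Longrightarrow> (transpose_mat X * X) *\<^sub>v w i = e i \<cdot>\<^sub>v w i"
    using singular_basis_exists[OF X] by blast
  have fin: "finite I" using I finite_subset by blast
  have "(\<Sum>i\<in>I. u i \<bullet> (X *\<^sub>v u i)) = (\<Sum>i\<in>I. \<Sum>j<n. (u i \<bullet> (X *\<^sub>v w j)) * (u i \<bullet> w j))"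
  proof (intro sum.cong refl)
    fix i assume "i \<in> I"
    then have ui: "u i \<in> carrier_vec n" using I onb_carrier[OF u] by auto
    have "u i \<bullet> (X *\<^sub>v u i) = (transpose_mat X *\<^sub>v u i) \<bullet> u i"
      using transpose_vec_mult_scalar[OF X ui ui] by simp
    also have "\<dots> = (\<Sum>j<n. (w j \<bullet> (transpose_mat X *\<^sub>v u i)) * (w j \<bullet> u i))"
      using X ui by (intro onb_parseval[OF w]) auto
    also have "\<dots> = (\<Sum>j<n. (u i \<bullet> (X *\<^sub>v w j)) * (u i \<bullet> w j))"
    proof (intro sum.cong refl)
      fix j assume "j \<in> {..<n}"
      then have wj: "w j \<in> carrier_vec n" using onb_carrier[OF w] by simp
      have "w j \<bullet> (transpose_mat X *\<^sub>v u i) = (transpose_mat X *\<^sub>v u i) \<bullet> w j"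
        using X ui wj by (intro comm_scalar_prod[of _ n]) auto
      also have "\<dots> = u i \<bullet> (X *\<^sub>v w j)" using transpose_vec_mult_scalar[OF X wj ui] .
      finally show "(w j \<bullet> (transpose_mat X *\<^sub>v u i)) * (w j \<bullet> u i) = (u i \<bullet> (X *\<^sub>v w j)) * (u i \<bullet> w j)"
        using comm_scalar_prod[OF wj ui] by simp
    qed
    finally show "u i \<bullet> (X *\<^sub>v u i) = (\<Sum>j<n. (u i \<bullet> (X *\<^sub>v w j)) * (u i \<bullet> w j))" .
  qed
  also have "\<dots> = (\<Sum>j<n. \<Sum>i\<in>I. (u i \<bullet> (X *\<^sub>v w j)) * (u i \<bullet> w j))"
    by (rule sum.swap)
  also have "\<dots> \<le> (\<Sum>j<n. sqrt ((X *\<^sub>v w j) \<bullet> (X *\<^sub>v w j)))"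
  proof (rule sum_mono)
    fix j assume "j \<in> {..<n}"
    then have wj: "w j \<in> carrier_vec n" and wjj: "w j \<bullet> w j = 1"
      using onb_carrier[OF w] onb_dot[OF w] by auto
    have Xw: "X *\<^sub>v w j \<in> carrier_vec n" using X wj by auto
    have "(\<Sum>i\<in>I. (u i \<bullet> (X *\<^sub>v w j)) * (u i \<bullet> w j))\<^sup>2
        \<le> (\<Sum>i\<in>I. (u i \<bullet> (X *\<^sub>v w j))\<^sup>2) * (\<Sum>i\<in>I. (u i \<bullet> w j)\<^sup>2)"
      by (rule Cauchy_Schwarz_ineq_sum)
    also have "\<dots> \<le> ((X *\<^sub>v w j) \<bullet> (X *\<^sub>v w j)) * 1"
      using onb_bessel[OF u Xw I] onb_bessel[OF u wj I] wjj
      by (intro mult_mono) (auto intro: sum_nonneg scalar_prod_self_nonneg)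
    finally show "(\<Sum>i\<in>I. (u i \<bullet> (X *\<^sub>v w j)) * (u i \<bullet> w j)) \<le> sqrt ((X *\<^sub>v w j) \<bullet> (X *\<^sub>v w j))"
      by (intro real_le_rsqrt) simp
  qed
  also have "\<dots> = nuclear_norm X" using nuclear_norm_singular_basis[OF X w ev] by simp
  finally show ?thesis .
qed

lemma partial_frob_le:
  assumes X: "X \<in> carrier_mat n n" and u: "onb n u" and I: "I \<subseteq> {..<n}"
  shows "(\<Sum>i\<in>I. (X *\<^sub>v u i) \<bullet> (X *\<^sub>v u i)) \<le> (frob_norm X)\<^sup>2"
  unfolding onb_frob[OF u X, symmetric]
  using I by (intro sum_mono2) (auto intro: scalar_prod_self_nonneg)

text \<open>The images of the basis vectors are orthogonal, so the nonzero ones are linearly independent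
  vectors of the column space.\<close>

lemma singular_vectors_le_rank:
  fixes B :: "real mat"
  assumes B: "B \<in> carrier_mat n m" and w: "onb m w"
    and ev: "\<And>i. i < m \<Longrightarrow> (transpose_mat B * B) *\<^sub>v w i = e i \<cdot>\<^sub>v w i"
  shows "card {i. i < m \<and> B *\<^sub>v w i \<noteq> 0\<^sub>v n} \<le> mat_rank B"
proof -
  interpret vec_space "TYPE(real)" n .
  define J where "J = {i. i < m \<and> B *\<^sub>v w i \<noteq> 0\<^sub>v n}"
  define b where "b i = B *\<^sub>v w i" for i
  have bc: "b i \<in> carrier_vec n" if "i \<in> J" for i
    using that B onb_carrier[OF w] by (auto simp: J_def b_def)
  have orth: "b i \<bullet> b j = 0" if "i \<in> J" "j \<in> J" "i \<noteq> j" for i j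
  proof -
    have ij: "i < m" "j < m" using that by (auto simp: J_def)
    have "b i \<bullet> b j = w i \<bullet> ((transpose_mat B * B) *\<^sub>v w j)"
      using gram_scalar_prod[OF B onb_carrier[OF w ij(1)] onb_carrier[OF w ij(2)]] by (simp add: b_def)
    then show ?thesis
      using ev[OF ij(2)] onb_dot[OF w ij] onb_carrier[OF w ij(1)] onb_carrier[OF w ij(2)] ij that by simp
  qed
  have nz: "b i \<bullet> b i \<noteq> 0" if "i \<in> J" for i
    using scalar_prod_self_eq_0[OF bc[OF that]] that by (auto simp: J_def b_def)
  have inj: "inj_on b J"
  proof (rule inj_onI, rule ccontr)
    fix i j assume ij: "i \<in> J" "j \<in> J" "b i = b j" "i \<noteq> j"
    then show False using orth[of i j] nz[of j] by simp
  qed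
  have finJ: "finite J" by (simp add: J_def)
  have Sc: "b ` J \<subseteq> carrier_vec n" using bc by auto
  have "lin_indpt (b ` J)"
  proof
    assume "lin_dep (b ` J)"
    then obtain a u where a: "lincomb a (b ` J) = 0\<^sub>v n" and u: "u \<in> b ` J" "a u \<noteq> 0"
      using finite_lin_dep[OF _ _ Sc] finJ by auto
    have "0 = lincomb a (b ` J) \<bullet> u" using a u Sc by auto
    also have "\<dots> = (\<Sum>x\<in>b ` J. a x * (x \<bullet> u))"
    proof -
      have uc: "u \<in> carrier_vec n" using u Sc by auto
      have "(\<Oplus>\<^bsub>V\<^esub>x\<in>b ` J. a x \<cdot>\<^sub>v x) \<bullet> u = (\<Sum>x\<in>b ` J. (a x \<cdot>\<^sub>v x) \<bullet> u)"
        using Sc uc by (intro finsum_scalar_prod_sum) auto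
      also have "\<dots> = (\<Sum>x\<in>b ` J. a x * (x \<bullet> u))"
        using Sc uc by (intro sum.cong refl smult_scalar_prod_distrib) auto
      finally show ?thesis by (simp add: lincomb_def)
    qed
    also have "\<dots> = (\<Sum>x\<in>b ` J. if x = u then a u * (u \<bullet> u) else 0)"
      using u orth by (intro sum.cong) auto
    also have "\<dots> = a u * (u \<bullet> u)" using finJ u by simp
    finally show False using u nz by auto
  qed
  moreover have "b ` J \<subseteq> span (set (cols B))"
  proof
    fix x assume "x \<in> b ` J"
    then obtain i where i: "i \<in> J" "x = B *\<^sub>v w i" by (auto simp: b_def)
    have "x \<in> col_space B"
      unfolding col_space_eq[OF B] using i onb_carrier[OF w] B by (auto simp: J_def)
    then show "x \<in> span (set (cols B))" by (simp add: col_space_def)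
  qed
  ultimately have "card (b ` J) \<le> rank B"
  proof -
    assume li: "lin_indpt (b ` J)" and sub: "b ` J \<subseteq> span (set (cols B))"
    have C: "set (cols B) \<subseteq> carrier_vec n" using B cols_dim by blast
    have sm: "submodule class_ring (span (set (cols B))) V"
      using span_is_submodule C by simp
    have vs: "vectorspace class_ring (vs (span (set (cols B))))"
      using span_is_subspace[of "set (cols B)"] C subspace_is_vs by simp
    show ?thesis
      unfolding rank_def
      using vectorspace.li_le_dim(2)[OF vs fin_dim_span_cols[OF B], of "b ` J"] li sub
        span_li_not_depend(2)[OF sub sm] by simp
  qed
  moreover have "card (b ` J) = card J" using inj by (rule card_image)
  moreover have "dim_row B = n" using B by simp
  ultimately show ?thesis by (simp add: J_def)
qed

text \<open>
  Moving weight from an index below \<open>r\<close> to one beyond \<open>r\<close> can only lower a decreasing weighted sum.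
\<close>

lemma tail_sum_le_weighted_sum:
  fixes l q :: "nat \<Rightarrow> real"
  assumes r: "r \<le> n" and dec: "\<And>i j. i \<le> j \<Longrightarrow> j < n \<Longrightarrow> l j \<le> l i"
    and l0: "\<And>j. j < n \<Longrightarrow> 0 \<le> l j"
    and q: "\<And>j. j < n \<Longrightarrow> 0 \<le> q j" "\<And>j. j < n \<Longrightarrow> q j \<le> 1"
    and tot: "real (n - r) \<le> (\<Sum>j<n. q j)"
  shows "(\<Sum>j\<in>{r..<n}. l j) \<le> (\<Sum>j<n. l j * q j)"
proof (cases "r = n")
  case True
  then show ?thesis using l0 q(1) by (auto intro!: sum_nonneg)
next
  case False
  then have rn: "r < n" using r by simp
  have split: "(\<Sum>j<n. f j) = (\<Sum>j<r. f j) + (\<Sum>j\<in>{r..<n}. f j)" for f :: "nat \<Rightarrow> real"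
    using sum.atLeastLessThan_concat[of 0 r n f] r by (simp add: atLeast0LessThan)
  have "(\<Sum>j\<in>{r..<n}. l j * (1 - q j)) \<le> (\<Sum>j\<in>{r..<n}. l r * (1 - q j))"
    using dec q by (intro sum_mono mult_right_mono) auto
  also have "\<dots> = l r * (real (n - r) - (\<Sum>j\<in>{r..<n}. q j))"
    by (simp add: sum_distrib_left[symmetric] sum_subtractf)
  also have "\<dots> \<le> l r * (\<Sum>j<r. q j)"
    using tot split[of q] l0[OF rn] by (intro mult_left_mono) auto
  also have "\<dots> = (\<Sum>j<r. l r * q j)" by (simp add: sum_distrib_left)
  also have "\<dots> \<le> (\<Sum>j<r. l j * q j)"
    using dec q rn by (intro sum_mono mult_right_mono) auto
  finally show ?thesis
    using split[of "\<lambda>j. l j * q j"] by (simp add: algebra_simps sum_subtractf)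
qed

text \<open>
  Take a singular basis \<open>w\<close> of \<open>B\<close>. At least \<open>n - r\<close> of its vectors are annihilated by \<open>B\<close>, so on
  them \<open>A - B\<close> agrees with \<open>A\<close>, and both norms are bounded below by their contribution. In the
  eigenbasis of \<open>A\<close> that contribution is a weighted sum of the eigenvalues (or of their squares)
  with weights in \<open>[0, 1]\<close> of total mass at least \<open>n - r\<close>, hence at least the tail sum.
  This is the lower half of the Eckart-Young-Mirsky theorem.
\<close>

lemma tail_sums_le_low_rank_error:
  fixes A B :: "real mat"
  assumes A: "A \<in> carrier_mat n n" "transpose_mat A = A"
    and B: "B \<in> carrier_mat n n" and rank: "mat_rank B \<le> r" and r: "r \<le> n"
    and v: "onb n v" and ev: "\<And>i. i < n \<Longrightarrow> A *\<^sub>v v i = l i \<cdot>\<^sub>v v i"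
    and dec: "\<And>i j. i \<le> j \<Longrightarrow> j < n \<Longrightarrow> l j \<le> l i" and l0: "\<And>j. j < n \<Longrightarrow> 0 \<le> l j"
  shows "(\<Sum>j\<in>{r..<n}. l j) \<le> nuclear_norm (A - B)"
    and "(\<Sum>j\<in>{r..<n}. (l j)\<^sup>2) \<le> (frob_norm (A - B))\<^sup>2"
proof -
  obtain w e where w: "onb n w"
    and wev: "\<And>i. i < n \<Longrightarrow> (transpose_mat B * B) *\<^sub>v w i = e i \<cdot>\<^sub>v w i"
    using singular_basis_exists[OF B] by blast
  define J where "J = {i. i < n \<and> B *\<^sub>v w i \<noteq> 0\<^sub>v n}"
  define I where "I = {..<n} - J"
  have IJ: "finite J" "J \<subseteq> {..<n}" "I \<subseteq> {..<n}" by (auto simp: J_def I_def)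
  have cJ: "card J \<le> r"
    using singular_vectors_le_rank[OF B w wev] rank by (simp add: J_def)
  have cI: "n - r \<le> card I"
    using cJ card_Diff_subset[OF IJ(1,2)] by (simp add: I_def)
  have wc: "w i \<in> carrier_vec n" if "i \<in> I" for i using that IJ onb_carrier[OF w] by auto
  have vc: "v j \<in> carrier_vec n" if "j < n" for j using that onb_carrier[OF v] by auto
  have ABw: "(A - B) *\<^sub>v w i = A *\<^sub>v w i" if "i \<in> I" for i
  proof -
    have "B *\<^sub>v w i = 0\<^sub>v n" using that by (auto simp: I_def J_def)
    then show ?thesis using wc[OF that] A(1) B by (simp add: minus_mult_distrib_mat_vec[of _ n n])
  qed
  define q where "q j = (\<Sum>i\<in>I. (w i \<bullet> v j)\<^sup>2)" for j
  have q0: "0 \<le> q j" for j by (simp add: q_def sum_nonneg)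
  have q1: "q j \<le> 1" if "j < n" for j
    using onb_bessel[OF w vc[OF that] IJ(3)] onb_dot[OF v that that] by (simp add: q_def)
  have sq: "(\<Sum>j<n. (v j \<bullet> w i)\<^sup>2) = 1" if "i \<in> I" for i
    using onb_parseval[OF v wc[OF that] wc[OF that]] onb_dot[OF w, of i i] that IJ
    by (auto simp: power2_eq_square)
  have sym: "w i \<bullet> v j = v j \<bullet> w i" if "i \<in> I" "j < n" for i j
    using comm_scalar_prod[OF wc[OF that(1)] vc[OF that(2)]] .
  have "(\<Sum>j<n. q j) = (\<Sum>i\<in>I. \<Sum>j<n. (v j \<bullet> w i)\<^sup>2)"
    unfolding q_def by (subst sum.swap) (auto intro!: sum.cong simp: sym)
  also have "\<dots> = real (card I)" by (simp add: sq)
  finally have tot: "real (n - r) \<le> (\<Sum>j<n. q j)" using cI by simp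
  have AV: "v j \<bullet> (A *\<^sub>v w i) = l j * (v j \<bullet> w i)" if "i \<in> I" "j < n" for i j
  proof -
    have "v j \<bullet> (A *\<^sub>v w i) = (A *\<^sub>v v j) \<bullet> w i"
      using symmetric_scalar_prod[OF A vc[OF that(2)] wc[OF that(1)]] .
    then show ?thesis using ev[OF that(2)] vc[OF that(2)] wc[OF that(1)] by simp
  qed
  have "(\<Sum>j\<in>{r..<n}. l j) \<le> (\<Sum>j<n. l j * q j)"
    by (rule tail_sum_le_weighted_sum[OF r dec l0 q0 q1 tot])
  also have "\<dots> = (\<Sum>i\<in>I. \<Sum>j<n. l j * (v j \<bullet> w i)\<^sup>2)"
    unfolding q_def sum_distrib_left by (subst sum.swap) (auto intro!: sum.cong simp: sym)
  also have "\<dots> = (\<Sum>i\<in>I. w i \<bullet> ((A - B) *\<^sub>v w i))"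
  proof (intro sum.cong refl)
    fix i assume i: "i \<in> I"
    have "A *\<^sub>v w i \<in> carrier_vec n" using A(1) wc[OF i] by auto
    then show "(\<Sum>j<n. l j * (v j \<bullet> w i)\<^sup>2) = w i \<bullet> ((A - B) *\<^sub>v w i)"
      unfolding ABw[OF i] onb_parseval[OF v wc[OF i] \<open>A *\<^sub>v w i \<in> carrier_vec n\<close>]
      by (intro sum.cong refl) (simp add: AV[OF i] power2_eq_square)
  qed
  also have "\<dots> \<le> nuclear_norm (A - B)"
    using A(1) B by (intro partial_trace_le_nuclear_norm[OF _ w IJ(3)]) auto
  finally show "(\<Sum>j\<in>{r..<n}. l j) \<le> nuclear_norm (A - B)" .
  have "(\<Sum>j\<in>{r..<n}. (l j)\<^sup>2) \<le> (\<Sum>j<n. (l j)\<^sup>2 * q j)"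
    using dec l0 by (intro tail_sum_le_weighted_sum[OF r _ _ q0 q1 tot] power_mono) auto
  also have "\<dots> = (\<Sum>i\<in>I. \<Sum>j<n. (l j)\<^sup>2 * (v j \<bullet> w i)\<^sup>2)"
    unfolding q_def sum_distrib_left by (subst sum.swap) (auto intro!: sum.cong simp: sym)
  also have "\<dots> = (\<Sum>i\<in>I. ((A - B) *\<^sub>v w i) \<bullet> ((A - B) *\<^sub>v w i))"
  proof (intro sum.cong refl)
    fix i assume i: "i \<in> I"
    have c: "A *\<^sub>v w i \<in> carrier_vec n" using A(1) wc[OF i] by auto
    show "(\<Sum>j<n. (l j)\<^sup>2 * (v j \<bullet> w i)\<^sup>2) = ((A - B) *\<^sub>v w i) \<bullet> ((A - B) *\<^sub>v w i)"
      unfolding ABw[OF i] onb_parseval[OF v c c]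
      by (intro sum.cong refl) (simp add: AV[OF i] power2_eq_square)
  qed
  also have "\<dots> \<le> (frob_norm (A - B))\<^sup>2"
    using A(1) B by (intro partial_frob_le[OF _ w IJ(3)]) auto
  finally show "(\<Sum>j\<in>{r..<n}. (l j)\<^sup>2) \<le> (frob_norm (A - B))\<^sup>2" .
qed

section \<open>Pseudoinverses of psd matrices\<close>

lemma scalar_prod_Cauchy_Schwarz:
  assumes "x \<in> carrier_vec n" "y \<in> carrier_vec n"
  shows "(x \<bullet> y)\<^sup>2 \<le> (x \<bullet> x) * (y \<bullet> (y :: real vec))"
  using Cauchy_Schwarz_ineq_sum[of "\<lambda>i. x $ i" "\<lambda>i. y $ i" "{0..<n}"] assms
  by (simp add: scalar_prod_def power2_eq_square)

lemma psd_scalar_prod_nonneg: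
  "psd A \<Longrightarrow> A \<in> carrier_mat n n \<Longrightarrow> x \<in> carrier_vec n \<Longrightarrow> 0 \<le> x \<bullet> (A *\<^sub>v x)"
  by (auto simp: psd_def)

lemma congruence_quadratic_form:
  assumes A: "A \<in> carrier_mat n n" and W: "W \<in> carrier_mat n k" and x: "x \<in> carrier_vec k"
  shows "x \<bullet> ((transpose_mat W * A * W) *\<^sub>v x) = (W *\<^sub>v x) \<bullet> (A *\<^sub>v (W *\<^sub>v (x :: real vec)))"
proof -
  have "x \<bullet> ((transpose_mat W * A * W) *\<^sub>v x) = x \<bullet> (transpose_mat W *\<^sub>v (A *\<^sub>v (W *\<^sub>v x)))"
    using x A W by (simp add: assoc_mult_mat_vec[of _ k n _ k] assoc_mult_mat_vec[of _ k n _ n])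
  also have "\<dots> = (transpose_mat W *\<^sub>v (A *\<^sub>v (W *\<^sub>v x))) \<bullet> x"
    using x A W by (intro comm_scalar_prod[of _ k]) auto
  also have "\<dots> = (A *\<^sub>v (W *\<^sub>v x)) \<bullet> (W *\<^sub>v x)"
    using x A W by (intro transpose_vec_mult_scalar[of _ n k]) auto
  also have "\<dots> = (W *\<^sub>v x) \<bullet> (A *\<^sub>v (W *\<^sub>v x))"
    using x A W by (intro comm_scalar_prod[of _ n]) auto
  finally show ?thesis .
qed

lemma psd_congruence:
  assumes A: "psd A" "A \<in> carrier_mat n n" and W: "W \<in> carrier_mat n k"
  shows "psd (transpose_mat W * A * W)"
  unfolding psd_def
proof (intro conjI ballI)
  have sym: "transpose_mat A = A" using A by (simp add: psd_def)
  show "transpose_mat (transpose_mat W * A * W) = transpose_mat W * A * W"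
  proof -
    have "transpose_mat (transpose_mat W * A * W) = transpose_mat W * transpose_mat (transpose_mat W * A)"
      using A(2) W by (intro transpose_mult[of _ k n _ k]) auto
    also have "transpose_mat (transpose_mat W * A) = A * W"
      using A(2) W sym by (simp add: transpose_mult[of "transpose_mat W" k n A n])
    also have "transpose_mat W * (A * W) = transpose_mat W * A * W"
      using A(2) W by (intro assoc_mult_mat[symmetric, of _ k n _ n _ k]) auto
    finally show ?thesis .
  qed
  fix x :: "real vec" assume "x \<in> carrier_vec (dim_row (transpose_mat W * A * W))"
  then have x: "x \<in> carrier_vec k" using W by simp
  show "0 \<le> x \<bullet> ((transpose_mat W * A * W) *\<^sub>v x)"
    unfolding congruence_quadratic_form[OF A(2) W x]
    using x A W by (intro psd_scalar_prod_nonneg[of A n]) auto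
qed (use W in auto)

lemma psd_eigenvalue_nonneg:
  assumes "psd A" "A \<in> carrier_mat n n" "onb n v" "i < n" "A *\<^sub>v v i = e \<cdot>\<^sub>v v i"
  shows "0 \<le> e"
  using psd_scalar_prod_nonneg[OF assms(1,2) onb_carrier[OF assms(3,4)]]
    onb_carrier[OF assms(3,4)] onb_dot[OF assms(3,4,4)] assms(5) by simp

lemma eigenbasis_quadratic_form:
  assumes A: "A \<in> carrier_mat n n" "transpose_mat A = A" and v: "onb n v"
    and ev: "\<And>i. i < n \<Longrightarrow> A *\<^sub>v v i = l i \<cdot>\<^sub>v v i" and x: "x \<in> carrier_vec n"
  shows "x \<bullet> (A *\<^sub>v x) = (\<Sum>i<n. l i * (v i \<bullet> x)\<^sup>2)"
    and "(A *\<^sub>v x) \<bullet> (A *\<^sub>v x) = (\<Sum>i<n. (l i)\<^sup>2 * (v i \<bullet> x)\<^sup>2)"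
proof -
  have c: "A *\<^sub>v x \<in> carrier_vec n" using A x by auto
  have vA: "v i \<bullet> (A *\<^sub>v x) = l i * (v i \<bullet> x)" if "i < n" for i
    using symmetric_scalar_prod[OF A onb_carrier[OF v that] x] ev[OF that] onb_carrier[OF v that] x
    by simp
  show "x \<bullet> (A *\<^sub>v x) = (\<Sum>i<n. l i * (v i \<bullet> x)\<^sup>2)"
    unfolding onb_parseval[OF v x c] by (intro sum.cong refl) (simp add: vA power2_eq_square)
  show "(A *\<^sub>v x) \<bullet> (A *\<^sub>v x) = (\<Sum>i<n. (l i)\<^sup>2 * (v i \<bullet> x)\<^sup>2)"
    unfolding onb_parseval[OF v c c] by (intro sum.cong refl) (simp add: vA power2_eq_square)
qed

lemma psd_isotropic_vector_in_kernel:
  assumes A: "psd A" "A \<in> carrier_mat n n" and x: "x \<in> carrier_vec n" and 0: "x \<bullet> (A *\<^sub>v x) = 0"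
  shows "A *\<^sub>v x = 0\<^sub>v n"
proof -
  have sym: "transpose_mat A = A" using A by (simp add: psd_def)
  obtain v l where v: "onb n v" and ev: "\<And>i. i < n \<Longrightarrow> A *\<^sub>v v i = l i \<cdot>\<^sub>v v i"
    using symmetric_eigenbasis[OF A(2) sym] by blast
  note q = eigenbasis_quadratic_form[OF A(2) sym v ev x]
  have l0: "0 \<le> l i" if "i < n" for i
    using psd_eigenvalue_nonneg[OF A v that ev[OF that]] .
  have "\<forall>i\<in>{..<n}. l i * (v i \<bullet> x)\<^sup>2 = 0"
    using sum_nonneg_eq_0_iff[of "{..<n}" "\<lambda>i. l i * (v i \<bullet> x)\<^sup>2"] l0 0 q(1) by auto
  then have "(\<Sum>i<n. (l i)\<^sup>2 * (v i \<bullet> x)\<^sup>2) = 0" by (intro sum.neutral) auto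
  then show ?thesis using q(2) A x by (intro scalar_prod_self_eq_0) auto
qed

lemma is_pinv_unique:
  assumes X: "is_pinv A X" and Y: "is_pinv A Y"
  shows "X = Y"
proof -
  define m n where "m = dim_row A" and "n = dim_col A"
  have A: "A \<in> carrier_mat m n" by (simp add: m_def n_def)
  have XY: "X \<in> carrier_mat n m" "Y \<in> carrier_mat n m"
    using X Y by (auto simp: is_pinv_def m_def n_def)
  note c = A XY
  have AX: "A * X * A = A" "X * A * X = X" "transpose_mat (A * X) = A * X" "transpose_mat (X * A) = X * A"
    using X by (auto simp: is_pinv_def)
  have AY: "A * Y * A = A" "Y * A * Y = Y" "transpose_mat (A * Y) = A * Y" "transpose_mat (Y * A) = Y * A"
    using Y by (auto simp: is_pinv_def)
  have "(A * X) * (A * Y) = transpose_mat ((A * Y) * (A * X))"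
    using c AX AY by (simp add: transpose_mult[of "A * Y" m m "A * X" m])
  also have "(A * Y) * (A * X) = (A * Y * A) * X" using c assoc_mult_mat[of "A * Y" m m A n X m] by simp
  finally have 1: "(A * X) * (A * Y) = A * X" using AX AY by simp
  have "(A * X) * (A * Y) = (A * X * A) * Y" using c assoc_mult_mat[of "A * X" m m A n Y m] by simp
  then have L: "A * X = A * Y" using 1 AX by simp
  have "(X * A) * (Y * A) = X * (A * Y * A)"
    using c assoc_mult_mat[of X n m A n "Y * A" n] assoc_mult_mat[of A m n Y m A n] by simp
  then have 2: "(X * A) * (Y * A) = X * A" using AY by simp
  have "(X * A) * (Y * A) = transpose_mat ((Y * A) * (X * A))"
    using c AX AY by (simp add: transpose_mult[of "Y * A" n n "X * A" n])
  also have "(Y * A) * (X * A) = Y * (A * X * A)"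
    using c assoc_mult_mat[of Y n m A n "X * A" n] assoc_mult_mat[of A m n X m A n] by simp
  finally have R: "X * A = Y * A" using 2 AX AY by simp
  have "X = X * A * X" using AX by simp
  also have "\<dots> = Y * (A * X)" using c R by (simp add: assoc_mult_mat[of _ n m _ n _ m])
  also have "\<dots> = Y * A * Y" using c L by (simp add: assoc_mult_mat[of _ n m _ n _ m])
  finally show ?thesis using AY by simp
qed

lemma pinv_eqI: "is_pinv A X \<Longrightarrow> pinv A = X"
  unfolding pinv_def using is_pinv_unique by blast

text \<open>Functional calculus in a fixed orthonormal basis \<open>v\<close>.\<close>

definition spec_mat :: "nat \<Rightarrow> (nat \<Rightarrow> real vec) \<Rightarrow> (nat \<Rightarrow> real) \<Rightarrow> real mat" where
  "spec_mat n v f = mat n n (\<lambda>(a, b). \<Sum>i<n. f i * v i $ a * v i $ b)"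

lemma spec_mat_carrier[simp]: "spec_mat n v f \<in> carrier_mat n n"
  by (simp add: spec_mat_def)

lemma spec_mat_dim[simp]: "dim_row (spec_mat n v f) = n" "dim_col (spec_mat n v f) = n"
  by (simp_all add: spec_mat_def)

lemma spec_mat_mult:
  assumes v: "onb n v"
  shows "spec_mat n v f * spec_mat n v g = spec_mat n v (\<lambda>i. f i * g i)"
proof (rule eq_matI)
  fix a b assume "a < dim_row (spec_mat n v (\<lambda>i. f i * g i))" "b < dim_col (spec_mat n v (\<lambda>i. f i * g i))"
  then have ab: "a < n" "b < n" by auto
  have dot: "(\<Sum>c<n. v i $ c * v j $ c) = (if i = j then 1 else 0)" if "i < n" "j < n" for i j
    using onb_dot[OF v that] onb_carrier[OF v that(2)] by (simp add: scalar_prod_def atLeast0LessThan)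
  have "(spec_mat n v f * spec_mat n v g) $$ (a, b) =
      (\<Sum>c<n. (\<Sum>i<n. f i * v i $ a * v i $ c) * (\<Sum>j<n. g j * v j $ c * v j $ b))"
    using ab by (auto simp: spec_mat_def scalar_prod_def atLeast0LessThan intro!: sum.cong)
  also have "\<dots> = (\<Sum>c<n. \<Sum>i<n. \<Sum>j<n. f i * v i $ a * (g j * v j $ b) * (v i $ c * v j $ c))"
    by (simp add: sum_product mult_ac)
  also have "\<dots> = (\<Sum>i<n. \<Sum>c<n. \<Sum>j<n. f i * v i $ a * (g j * v j $ b) * (v i $ c * v j $ c))"
    by (rule sum.swap)
  also have "\<dots> = (\<Sum>i<n. \<Sum>j<n. \<Sum>c<n. f i * v i $ a * (g j * v j $ b) * (v i $ c * v j $ c))"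
    by (intro sum.cong refl sum.swap)
  also have "\<dots> = (\<Sum>i<n. \<Sum>j<n. f i * v i $ a * (g j * v j $ b) * (if i = j then 1 else 0))"
    by (intro sum.cong refl) (simp add: dot flip: sum_distrib_left)
  also have "\<dots> = (\<Sum>i<n. f i * v i $ a * (g i * v i $ b))"
    by (intro sum.cong refl) (simp add: if_distrib cong: if_cong)
  also have "\<dots> = spec_mat n v (\<lambda>i. f i * g i) $$ (a, b)"
    using ab by (simp add: spec_mat_def mult_ac)
  finally show "(spec_mat n v f * spec_mat n v g) $$ (a, b) = spec_mat n v (\<lambda>i. f i * g i) $$ (a, b)" .
qed auto

lemma spec_mat_cong: "(\<And>i. i < n \<Longrightarrow> f i = g i) \<Longrightarrow> spec_mat n v f = spec_mat n v g"
  unfolding spec_mat_def by (intro cong_mat refl) (simp cong: sum.cong_simp)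

lemma spec_mat_transpose: "transpose_mat (spec_mat n v f) = spec_mat n v f"
  by (rule eq_matI) (auto simp: spec_mat_def mult_ac)

lemma spec_mat_one: "onb n v \<Longrightarrow> spec_mat n v (\<lambda>_. 1) = 1\<^sub>m n"
proof (rule eq_matI)
  fix a b assume v: "onb n v" and "a < dim_row (1\<^sub>m n :: real mat)" "b < dim_col (1\<^sub>m n :: real mat)"
  then have ab: "a < n" "b < n" by auto
  have "spec_mat n v (\<lambda>_. 1) $$ (a, b) = (\<Sum>i<n. (v i \<bullet> unit_vec n a) * (v i \<bullet> unit_vec n b))"
    using ab onb_carrier[OF v] by (auto simp: spec_mat_def intro!: sum.cong)
  also have "\<dots> = unit_vec n a \<bullet> unit_vec n b"
    using ab by (intro onb_parseval[OF v, symmetric]) auto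
  finally show "spec_mat n v (\<lambda>_. 1) $$ (a, b) = 1\<^sub>m n $$ (a, b)" using ab by auto
qed auto

lemma spec_mat_eqI:
  assumes A: "A \<in> carrier_mat n n" "transpose_mat A = A" and v: "onb n v"
    and ev: "\<And>i. i < n \<Longrightarrow> A *\<^sub>v v i = l i \<cdot>\<^sub>v v i"
  shows "A = spec_mat n v l"
proof (rule eq_matI)
  fix a b assume "a < dim_row (spec_mat n v l)" "b < dim_col (spec_mat n v l)"
  then have ab: "a < n" "b < n" by auto
  have c: "A *\<^sub>v unit_vec n b \<in> carrier_vec n" using A by auto
  have "A $$ (a, b) = unit_vec n a \<bullet> (A *\<^sub>v unit_vec n b)"
    using ab A by simp
  also have "\<dots> = (\<Sum>i<n. (v i \<bullet> unit_vec n a) * (v i \<bullet> (A *\<^sub>v unit_vec n b)))"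
    using c by (intro onb_parseval[OF v]) auto
  also have "\<dots> = (\<Sum>i<n. l i * v i $ a * v i $ b)"
  proof (intro sum.cong refl)
    fix i assume "i \<in> {..<n}"
    then have i: "i < n" by simp
    note vc = onb_carrier[OF v i]
    have "v i \<bullet> (A *\<^sub>v unit_vec n b) = l i * (v i \<bullet> unit_vec n b)"
      using symmetric_scalar_prod[OF A vc, of "unit_vec n b"] ev[OF i] vc by simp
    then show "(v i \<bullet> unit_vec n a) * (v i \<bullet> (A *\<^sub>v unit_vec n b)) = l i * v i $ a * v i $ b"
      using ab vc by simp
  qed
  finally show "A $$ (a, b) = spec_mat n v l $$ (a, b)" using ab by (simp add: spec_mat_def)
qed (use A in auto)

lemma pinv_spec_mat:
  assumes v: "onb n v"
  shows "is_pinv (spec_mat n v l) (spec_mat n v (\<lambda>i. inverse (l i)))"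
    (is "is_pinv _ ?P")
proof -
  have "spec_mat n v l * ?P * spec_mat n v l = spec_mat n v l"
  proof -
    have "l i * inverse (l i) * l i = l i" for i by (cases "l i = 0") auto
    then show ?thesis unfolding spec_mat_mult[OF v] by (rule spec_mat_cong)
  qed
  moreover have "?P * spec_mat n v l * ?P = ?P"
  proof -
    have "inverse (l i) * l i * inverse (l i) = inverse (l i)" for i by (cases "l i = 0") auto
    then show ?thesis unfolding spec_mat_mult[OF v] by (rule spec_mat_cong)
  qed
  ultimately show ?thesis by (simp add: is_pinv_def spec_mat_mult[OF v] spec_mat_transpose)
qed

lemma symmetric_is_pinv_pinv:
  assumes "S \<in> carrier_mat n n" "transpose_mat S = S"
  shows "is_pinv S (pinv S)" "transpose_mat (pinv S) = pinv S"
proof -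
  obtain v l where v: "onb n v" and ev: "\<And>i. i < n \<Longrightarrow> S *\<^sub>v v i = l i \<cdot>\<^sub>v v i"
    using symmetric_eigenbasis[OF assms] by blast
  have S: "S = spec_mat n v l" by (rule spec_mat_eqI[OF assms v ev])
  note p = pinv_spec_mat[OF v, of l, folded S]
  show "is_pinv S (pinv S)" "transpose_mat (pinv S) = pinv S"
    using p pinv_eqI[OF p] by (simp_all add: spec_mat_transpose)
qed

text \<open>
  The pseudoinverse is discontinuous, but it is a pointwise limit of rational functions of the
  entries, which makes it a measurable function.
\<close>

definition reg_inv :: "real mat \<Rightarrow> nat \<Rightarrow> real mat" where
  "reg_inv S m = (let T = S + (1 / real (Suc m)) \<cdot>\<^sub>m 1\<^sub>m (dim_row S) in (1 / det T) \<cdot>\<^sub>m adj_mat T)"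

lemma reg_inv_spec_mat:
  assumes v: "onb n v" and l: "\<And>i. i < n \<Longrightarrow> 0 \<le> l i"
  shows "reg_inv (spec_mat n v l) m = spec_mat n v (\<lambda>i. 1 / (l i + 1 / real (Suc m)))"
proof -
  define e where "e = 1 / real (Suc m)"
  have e: "0 < e" by (simp add: e_def)
  define T where "T = spec_mat n v l + e \<cdot>\<^sub>m 1\<^sub>m n"
  have T: "T = spec_mat n v (\<lambda>i. l i + e)"
    unfolding T_def spec_mat_one[OF v, symmetric]
  proof (rule eq_matI)
    fix a b assume "a < dim_row (spec_mat n v (\<lambda>i. l i + e))" "b < dim_col (spec_mat n v (\<lambda>i. l i + e))"
    then show "(spec_mat n v l + e \<cdot>\<^sub>m spec_mat n v (\<lambda>_. 1)) $$ (a, b) = spec_mat n v (\<lambda>i. l i + e) $$ (a, b)"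
      by (simp add: spec_mat_def distrib_right sum.distrib sum_distrib_left mult.assoc)
  qed auto
  have Tc: "T \<in> carrier_mat n n" by (simp add: T)
  let ?I = "spec_mat n v (\<lambda>i. 1 / (l i + e))"
  have "spec_mat n v (\<lambda>i. (l i + e) * (1 / (l i + e))) = spec_mat n v (\<lambda>_. 1)"
  proof (rule spec_mat_cong)
    fix i assume "i < n"
    then have "l i + e > 0" using l[of i] e by linarith
    then show "(l i + e) * (1 / (l i + e)) = 1" by simp
  qed
  then have TI: "T * ?I = 1\<^sub>m n"
    by (simp add: T spec_mat_mult[OF v] spec_mat_one[OF v])
  then have IT: "?I * T = 1\<^sub>m n" using mat_mult_left_right_inverse[OF Tc _ TI] by simp
  have "det T * det ?I = 1" using TI det_mult[OF Tc, of ?I] by simp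
  then have d: "det T \<noteq> 0" by auto
  have "adj_mat T = (?I * T) * adj_mat T" using IT adj_mat(1)[OF Tc] by simp
  also have "\<dots> = ?I * (T * adj_mat T)" using Tc adj_mat(1)[OF Tc] by (simp add: assoc_mult_mat[of _ n n _ n _ n])
  also have "\<dots> = det T \<cdot>\<^sub>m ?I" using adj_mat(2)[OF Tc] by (simp add: mult_smult_distrib[of _ n n _ n])
  finally have "(1 / det T) \<cdot>\<^sub>m adj_mat T = ?I"
    using d by (simp, intro eq_matI) auto
  then show ?thesis by (simp add: reg_inv_def Let_def T_def e_def)
qed

text \<open>
  On an eigenvector with eigenvalue \<open>\<lambda>\<close> the approximation is \<open>\<lambda> / (\<lambda> + \<epsilon>)\<^sup>2\<close>, which tends to \<open>1 / \<lambda>\<close>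
  if \<open>\<lambda> > 0\<close> and is identically \<open>0\<close> otherwise.
\<close>

lemma pinv_limit:
  assumes S: "psd S" "S \<in> carrier_mat n n" and ab: "a < n" "b < n"
  shows "(\<lambda>m. (reg_inv S m * S * reg_inv S m) $$ (a, b)) \<longlonglongrightarrow> pinv S $$ (a, b)"
proof -
  have sym: "transpose_mat S = S" using S by (simp add: psd_def)
  obtain v l where v: "onb n v" and ev: "\<And>i. i < n \<Longrightarrow> S *\<^sub>v v i = l i \<cdot>\<^sub>v v i"
    using symmetric_eigenbasis[OF S(2) sym] by blast
  have Sv: "S = spec_mat n v l" by (rule spec_mat_eqI[OF S(2) sym v ev])
  have l0: "0 \<le> l i" if "i < n" for i
    using psd_eigenvalue_nonneg[OF S v that ev[OF that]] .
  have e: "(\<lambda>m. 1 / real (Suc m)) \<longlonglongrightarrow> 0" by (rule LIMSEQ_Suc[OF lim_const_over_n])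
  have lim: "(\<lambda>m. 1 / (l i + 1 / real (Suc m)) * l i * (1 / (l i + 1 / real (Suc m)))) \<longlonglongrightarrow> inverse (l i)"
    if "i < n" for i
  proof (cases "l i = 0")
    case False
    have "(\<lambda>m. 1 / (l i + 1 / real (Suc m)) * l i * (1 / (l i + 1 / real (Suc m))))
        \<longlonglongrightarrow> 1 / (l i + 0) * l i * (1 / (l i + 0))"
      using False by (intro tendsto_intros e) auto
    then show ?thesis using False by (simp add: field_simps)
  qed simp
  have "(reg_inv S m * S * reg_inv S m) $$ (a, b) =
      (\<Sum>i<n. 1 / (l i + 1 / real (Suc m)) * l i * (1 / (l i + 1 / real (Suc m))) * v i $ a * v i $ b)" for m
  proof -
    have R: "reg_inv S m = spec_mat n v (\<lambda>i. 1 / (l i + 1 / real (Suc m)))"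
      unfolding Sv by (rule reg_inv_spec_mat[OF v l0])
    have "reg_inv S m * S * reg_inv S m = spec_mat n v
        (\<lambda>i. 1 / (l i + 1 / real (Suc m)) * l i * (1 / (l i + 1 / real (Suc m))))"
      unfolding R by (subst (1) Sv) (simp only: spec_mat_mult[OF v])
    then show ?thesis using ab by (simp add: spec_mat_def)
  qed
  moreover have "pinv S $$ (a, b) = (\<Sum>i<n. inverse (l i) * v i $ a * v i $ b)"
    using pinv_eqI[OF pinv_spec_mat[OF v, of l]] ab by (simp add: Sv spec_mat_def)
  ultimately show ?thesis
    by (simp only:) (intro tendsto_sum tendsto_mult lim tendsto_const; simp)
qed

section \<open>The Nystrom residual\<close>

lemma minus_mult_vec_scalar_prod:
  assumes "A \<in> carrier_mat n n" "transpose_mat A = (A :: real mat)" "x \<in> carrier_vec n" "y \<in> carrier_vec n"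
  shows "(x - y) \<bullet> (A *\<^sub>v (x - y)) = x \<bullet> (A *\<^sub>v x) - 2 * (y \<bullet> (A *\<^sub>v x)) + y \<bullet> (A *\<^sub>v y)"
proof -
  have c: "A *\<^sub>v x \<in> carrier_vec n" "A *\<^sub>v y \<in> carrier_vec n" using assms by auto
  have "x \<bullet> (A *\<^sub>v y) = y \<bullet> (A *\<^sub>v x)"
    using symmetric_scalar_prod[OF assms(1,2) assms(3,4)] comm_scalar_prod[OF c(1) assms(4)] by simp
  then show ?thesis
    using assms c by (simp add: mult_minus_distrib_mat_vec[of _ n n] minus_scalar_prod_distrib[of _ n]
      scalar_prod_minus_distrib[of _ n])
qed

text \<open>
  Completing the square: with \<open>S = W\<^sup>T A W\<close> and \<open>K = A W\<close>, the difference of the two sides of the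
  inequality is \<open>z \<bullet> S z\<close> for \<open>z = y - S\<^sup>+ K\<^sup>T x\<close>. It vanishes for a suitable \<open>y\<close>, which shows that
  the residual is psd.
\<close>

lemma nystrom_residual:
  assumes A: "psd A" "A \<in> carrier_mat n n" and W: "W \<in> carrier_mat n k"
  defines "R \<equiv> A - nystrom A W"
  shows "R \<in> carrier_mat n n" "psd R"
    and "\<And>x y. x \<in> carrier_vec n \<Longrightarrow> y \<in> carrier_vec k \<Longrightarrow>
      x \<bullet> (R *\<^sub>v x) \<le> (x - W *\<^sub>v y) \<bullet> (A *\<^sub>v (x - W *\<^sub>v y))"
proof -
  define S where "S = transpose_mat W * A * W"
  define P where "P = pinv S"
  define K where "K = A * W"
  have symA: "transpose_mat A = A" using A by (simp add: psd_def)
  have S: "S \<in> carrier_mat k k" using W A by (simp add: S_def)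
  have psdS: "psd S" unfolding S_def by (rule psd_congruence[OF A W])
  have symS: "transpose_mat S = S" using psdS by (simp add: psd_def)
  note p = symmetric_is_pinv_pinv[OF S symS, folded P_def]
  have P: "P \<in> carrier_mat k k" using p(1) S by (auto simp: is_pinv_def)
  have K: "K \<in> carrier_mat n k" using A W by (simp add: K_def)
  have KT: "transpose_mat K = transpose_mat W * A"
    using A W symA by (simp add: K_def transpose_mult[of A n n W k])
  have nys: "nystrom A W = K * P * transpose_mat K"
    unfolding KT by (simp add: nystrom_def K_def P_def S_def)
  have KPK: "K * P * transpose_mat K \<in> carrier_mat n n"
    using K P by (intro mult_carrier_mat[of _ n k]) auto
  show R: "R \<in> carrier_mat n n" unfolding R_def nys by (rule minus_carrier_mat[OF KPK])
  have symR: "transpose_mat R = R"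
  proof -
    have "transpose_mat (K * P * transpose_mat K) = K * transpose_mat (K * P)"
      using transpose_mult[of "K * P" n k "transpose_mat K" n] K P by (simp del: assoc_mult_mat)
    also have "transpose_mat (K * P) = P * transpose_mat K"
      using K P p(2) by (simp add: transpose_mult[of K n k P k])
    also have "K * (P * transpose_mat K) = K * P * transpose_mat K"
      using K P by (intro assoc_mult_mat[symmetric, of _ n k _ k _ n]) auto
    finally show ?thesis unfolding R_def nys using A K P symA
      by (simp add: transpose_minus[of _ n n])
  qed
  \<comment> \<open>the kernel of \<open>S\<close> is contained in that of \<open>A W\<close>\<close>
  have KPS: "K *\<^sub>v (P *\<^sub>v (S *\<^sub>v y)) = K *\<^sub>v y" if y: "y \<in> carrier_vec k" for y
  proof -
    define z where "z = y - P *\<^sub>v (S *\<^sub>v y)"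
    have z: "z \<in> carrier_vec k" using y P S by (auto simp: z_def)
    have "S *\<^sub>v (P *\<^sub>v (S *\<^sub>v y)) = (S * P * S) *\<^sub>v y"
      using y S P by (simp add: assoc_mult_mat_vec[of _ k k _ k])
    also have "\<dots> = S *\<^sub>v y" using p(1) by (simp add: is_pinv_def)
    finally have "S *\<^sub>v z = 0\<^sub>v k"
      using y S P by (simp add: z_def mult_minus_distrib_mat_vec[of _ k k])
    then have "z \<bullet> (S *\<^sub>v z) = 0" using z by simp
    also have "z \<bullet> (S *\<^sub>v z) = (W *\<^sub>v z) \<bullet> (A *\<^sub>v (W *\<^sub>v z))"
      unfolding S_def by (rule congruence_quadratic_form[OF A(2) W z])
    finally have "A *\<^sub>v (W *\<^sub>v z) = 0\<^sub>v n"
      using z A W by (intro psd_isotropic_vector_in_kernel[OF A]) auto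
    then have "K *\<^sub>v z = 0\<^sub>v n"
      using z A W by (simp add: K_def assoc_mult_mat_vec[of _ n n _ k])
    then have "K *\<^sub>v y - K *\<^sub>v (P *\<^sub>v (S *\<^sub>v y)) = 0\<^sub>v n"
      using y K P S by (simp add: z_def mult_minus_distrib_mat_vec[of _ n k])
    then have e: "(K *\<^sub>v y - K *\<^sub>v (P *\<^sub>v (S *\<^sub>v y))) $ i = 0" if "i < n" for i
      using that by simp
    show ?thesis
    proof (rule eq_vecI)
      fix i assume "i < dim_vec (K *\<^sub>v y)"
      then have "i < n" using K by simp
      then show "(K *\<^sub>v (P *\<^sub>v (S *\<^sub>v y))) $ i = (K *\<^sub>v y) $ i"
        using e[of i] K by simp
    qed (use K in auto)
  qed
  have quad: "(x - W *\<^sub>v y) \<bullet> (A *\<^sub>v (x - W *\<^sub>v y)) =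
      x \<bullet> (R *\<^sub>v x) + (y - P *\<^sub>v (transpose_mat K *\<^sub>v x)) \<bullet> (S *\<^sub>v (y - P *\<^sub>v (transpose_mat K *\<^sub>v x)))"
    if x: "x \<in> carrier_vec n" and y: "y \<in> carrier_vec k" for x y
  proof -
    define c where "c = transpose_mat K *\<^sub>v x"
    have c: "c \<in> carrier_vec k" using K x by (auto simp: c_def)
    have Pc: "P *\<^sub>v c \<in> carrier_vec k" using P c by auto
    have Kc: "y' \<bullet> c = (K *\<^sub>v y') \<bullet> x" if "y' \<in> carrier_vec k" for y'
    proof -
      have "y' \<bullet> c = c \<bullet> y'" using comm_scalar_prod[OF that c] .
      also have "\<dots> = x \<bullet> (K *\<^sub>v y')"
        unfolding c_def using transpose_vec_mult_scalar[OF K that x] .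
      also have "\<dots> = (K *\<^sub>v y') \<bullet> x" using K that x by (intro comm_scalar_prod[of _ n]) auto
      finally show ?thesis .
    qed
    have wy: "(W *\<^sub>v y) \<bullet> (A *\<^sub>v x) = y \<bullet> c"
    proof -
      have "(W *\<^sub>v y) \<bullet> (A *\<^sub>v x) = (A *\<^sub>v (W *\<^sub>v y)) \<bullet> x"
        using W y x by (intro symmetric_scalar_prod[OF A(2) symA]) auto
      then show ?thesis using Kc[OF y] A W y by (simp add: K_def assoc_mult_mat_vec[of _ n n _ k])
    qed
    have wwy: "(W *\<^sub>v y) \<bullet> (A *\<^sub>v (W *\<^sub>v y)) = y \<bullet> (S *\<^sub>v y)"
      unfolding S_def by (rule congruence_quadratic_form[OF A(2) W y, symmetric])
    have PP: "P *\<^sub>v (S *\<^sub>v (P *\<^sub>v c)) = P *\<^sub>v c"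
    proof -
      have "P *\<^sub>v (S *\<^sub>v (P *\<^sub>v c)) = (P * S * P) *\<^sub>v c"
        using c S P by (simp add: assoc_mult_mat_vec[of _ k k _ k])
      then show ?thesis using p(1) by (simp add: is_pinv_def)
    qed
    have ySPc: "(P *\<^sub>v c) \<bullet> (S *\<^sub>v y) = y \<bullet> c"
    proof -
      have "(P *\<^sub>v c) \<bullet> (S *\<^sub>v y) = c \<bullet> (P *\<^sub>v (S *\<^sub>v y))"
        using symmetric_scalar_prod[OF P p(2) c, of "S *\<^sub>v y"] S y by simp
      also have "\<dots> = (P *\<^sub>v (S *\<^sub>v y)) \<bullet> c"
        using P S y c by (intro comm_scalar_prod[of _ k]) auto
      also have "\<dots> = (K *\<^sub>v (P *\<^sub>v (S *\<^sub>v y))) \<bullet> x" using P S y by (intro Kc) auto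
      also have "\<dots> = y \<bullet> c" unfolding KPS[OF y] using Kc[OF y] by simp
      finally show ?thesis .
    qed
    have PSP: "(P *\<^sub>v c) \<bullet> (S *\<^sub>v (P *\<^sub>v c)) = c \<bullet> (P *\<^sub>v c)"
      using symmetric_scalar_prod[OF P p(2) c, of "S *\<^sub>v (P *\<^sub>v c)"] S Pc PP by simp
    have xR: "x \<bullet> (R *\<^sub>v x) = x \<bullet> (A *\<^sub>v x) - c \<bullet> (P *\<^sub>v c)"
    proof -
      have "(K * P * transpose_mat K) *\<^sub>v x = K *\<^sub>v (P *\<^sub>v c)"
        using x K P by (simp add: c_def assoc_mult_mat_vec[of _ n k _ n] assoc_mult_mat_vec[of _ n k _ k])
      moreover have "x \<bullet> (K *\<^sub>v (P *\<^sub>v c)) = c \<bullet> (P *\<^sub>v c)"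
        using transpose_vec_mult_scalar[OF K Pc x] by (simp add: c_def)
      moreover have "K *\<^sub>v (P *\<^sub>v c) \<in> carrier_vec n" by (rule mult_mat_vec_carrier[OF K Pc])
      ultimately show ?thesis
        unfolding R_def nys using x A K P
        by (simp add: minus_mult_distrib_mat_vec[of _ n n] scalar_prod_minus_distrib[of _ n])
    qed
    show ?thesis
      unfolding c_def[symmetric]
      using minus_mult_vec_scalar_prod[OF A(2) symA x, of "W *\<^sub>v y"] W y
        minus_mult_vec_scalar_prod[OF S symS y Pc] wy wwy ySPc PSP xR
        symmetric_scalar_prod[OF S symS y Pc]
      by simp
  qed
  show "x \<bullet> (R *\<^sub>v x) \<le> (x - W *\<^sub>v y) \<bullet> (A *\<^sub>v (x - W *\<^sub>v y))"
    if "x \<in> carrier_vec n" "y \<in> carrier_vec k" for x y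
  proof -
    have "0 \<le> (y - P *\<^sub>v (transpose_mat K *\<^sub>v x)) \<bullet> (S *\<^sub>v (y - P *\<^sub>v (transpose_mat K *\<^sub>v x)))"
      using that P K by (intro psd_scalar_prod_nonneg[OF psdS S]) auto
    then show ?thesis using quad[OF that] by simp
  qed
  show "psd R"
    unfolding psd_def
  proof (intro conjI ballI)
    fix x :: "real vec" assume "x \<in> carrier_vec (dim_row R)"
    then have x: "x \<in> carrier_vec n" using R by simp
    define y where "y = P *\<^sub>v (transpose_mat K *\<^sub>v x)"
    have y: "y \<in> carrier_vec k" using P K x by (auto simp: y_def)
    have z: "y - y = 0\<^sub>v k" using y by auto
    have "S *\<^sub>v 0\<^sub>v k = 0\<^sub>v k" using S by auto
    then have "x \<bullet> (R *\<^sub>v x) = (x - W *\<^sub>v y) \<bullet> (A *\<^sub>v (x - W *\<^sub>v y))"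
      using quad[OF x y, folded y_def] z by simp
    moreover have "0 \<le> (x - W *\<^sub>v y) \<bullet> (A *\<^sub>v (x - W *\<^sub>v y))"
      using x W y by (intro psd_scalar_prod_nonneg[OF A]) auto
    ultimately show "0 \<le> x \<bullet> (R *\<^sub>v x)" by simp
  qed (use R symR in auto)
qed

lemma frob_norm_transpose: "frob_norm (transpose_mat X) = frob_norm X"
  unfolding frob_norm_def by (simp, subst sum.swap) (auto intro!: sum.cong)

lemma frob_norm_nonneg: "0 \<le> frob_norm X"
  by (simp add: frob_norm_def sum_nonneg)

lemma frob_norm_mult_le:
  assumes Z: "Z \<in> carrier_mat m n" and M: "M \<in> carrier_mat n p"
    and le: "\<And>u. u \<in> carrier_vec n \<Longrightarrow> (Z *\<^sub>v u) \<bullet> (Z *\<^sub>v u) \<le> c * (u \<bullet> u)"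
  shows "(frob_norm (Z * M))\<^sup>2 \<le> c * (frob_norm M)\<^sup>2"
proof -
  let ?e = "unit_vec p :: nat \<Rightarrow> real vec"
  have ZM: "Z * M \<in> carrier_mat m p" using Z M by simp
  have "(frob_norm (Z * M))\<^sup>2 = (\<Sum>i<p. (Z *\<^sub>v (M *\<^sub>v ?e i)) \<bullet> (Z *\<^sub>v (M *\<^sub>v ?e i)))"
    unfolding onb_frob[OF onb_unit_vecs ZM, symmetric]
    using Z M by (intro sum.cong refl) (simp add: assoc_mult_mat_vec[of _ m n _ p])
  also have "\<dots> \<le> (\<Sum>i<p. c * ((M *\<^sub>v ?e i) \<bullet> (M *\<^sub>v ?e i)))"
    using M by (intro sum_mono le) auto
  also have "\<dots> = c * (frob_norm M)\<^sup>2"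
    unfolding onb_frob[OF onb_unit_vecs M, symmetric] by (simp add: sum_distrib_left)
  finally show ?thesis .
qed

text \<open>With \<open>v = X\<^sup>T u\<close> one has \<open>v \<bullet> v = u \<bullet> X v\<close>, and the Cauchy-Schwarz inequality applies.\<close>

lemma transpose_contraction:
  assumes X: "X \<in> carrier_mat k n" and c: "0 \<le> c"
    and le: "\<And>x. x \<in> carrier_vec n \<Longrightarrow> (X *\<^sub>v x) \<bullet> (X *\<^sub>v x) \<le> c * (x \<bullet> (x :: real vec))"
    and u: "u \<in> carrier_vec k"
  shows "(transpose_mat X *\<^sub>v u) \<bullet> (transpose_mat X *\<^sub>v u) \<le> c * (u \<bullet> u)"
proof -
  define t where "t = transpose_mat X *\<^sub>v u"
  have t: "t \<in> carrier_vec n" using X u by (auto simp: t_def)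
  have "t \<bullet> t = u \<bullet> (X *\<^sub>v t)"
    using transpose_vec_mult_scalar[OF X t u] by (simp add: t_def)
  then have "(t \<bullet> t)\<^sup>2 \<le> (u \<bullet> u) * ((X *\<^sub>v t) \<bullet> (X *\<^sub>v t))"
    using scalar_prod_Cauchy_Schwarz[of u k "X *\<^sub>v t"] X t u by simp
  also have "\<dots> \<le> (u \<bullet> u) * (c * (t \<bullet> t))"
    using le[OF t] by (intro mult_left_mono scalar_prod_self_nonneg)
  finally have "(t \<bullet> t) * (t \<bullet> t) \<le> (c * (u \<bullet> u)) * (t \<bullet> t)"
    by (simp add: power2_eq_square mult_ac)
  then have "t \<bullet> t \<le> c * (u \<bullet> u)"
    using scalar_prod_self_nonneg[of t] scalar_prod_self_nonneg[of u] c
    by (cases "t \<bullet> t = 0") (auto dest: mult_right_le_imp_le)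
  then show ?thesis by (simp add: t_def)
qed

text \<open>
  Domination of quadratic forms controls the trace, and, through the eigenbasis \<open>q\<close> of \<open>R\<close> and
  Cauchy-Schwarz, the Frobenius norm.
\<close>

lemma dominated_psd_norms:
  assumes R: "R \<in> carrier_mat n n" "psd R" and L: "L \<in> carrier_mat m n" and C: "C \<in> carrier_mat p n"
    and dom: "\<And>x. x \<in> carrier_vec n \<Longrightarrow>
       x \<bullet> (R *\<^sub>v x) \<le> 2 * ((L *\<^sub>v x) \<bullet> (L *\<^sub>v x)) + 2 * ((C *\<^sub>v x) \<bullet> (C *\<^sub>v x))"
  shows "mat_tr R \<le> 2 * (frob_norm L)\<^sup>2 + 2 * (frob_norm C)\<^sup>2"
    and "frob_norm R \<le> 2 * frob_norm (transpose_mat L * L) + 2 * frob_norm (transpose_mat C * C)"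
proof -
  have symR: "transpose_mat R = R" using R by (simp add: psd_def)
  obtain q l where q: "onb n q" and ev: "\<And>i. i < n \<Longrightarrow> R *\<^sub>v q i = l i \<cdot>\<^sub>v q i"
    using symmetric_eigenbasis[OF R(1) symR] by blast
  have l0: "0 \<le> l i" if "i < n" for i using psd_eigenvalue_nonneg[OF R(2,1) q that ev[OF that]] .
  have qc: "q i \<in> carrier_vec n" if "i < n" for i using onb_carrier[OF q that] .
  have lq: "l i = q i \<bullet> (R *\<^sub>v q i)" if "i < n" for i
    using ev[OF that] qc[OF that] onb_dot[OF q that that] by simp
  have "mat_tr R = (\<Sum>i<n. q i \<bullet> (R *\<^sub>v q i))" using onb_trace[OF q R(1)] by simp
  also have "\<dots> \<le> (\<Sum>i<n. 2 * ((L *\<^sub>v q i) \<bullet> (L *\<^sub>v q i)) + 2 * ((C *\<^sub>v q i) \<bullet> (C *\<^sub>v q i)))"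
    using qc by (intro sum_mono dom) auto
  also have "\<dots> = 2 * (frob_norm L)\<^sup>2 + 2 * (frob_norm C)\<^sup>2"
    unfolding onb_frob[OF q L, symmetric] onb_frob[OF q C, symmetric]
    by (simp add: sum.distrib sum_distrib_left)
  finally show "mat_tr R \<le> 2 * (frob_norm L)\<^sup>2 + 2 * (frob_norm C)\<^sup>2" .
  have fR: "(frob_norm R)\<^sup>2 = (\<Sum>i<n. (l i)\<^sup>2)"
    unfolding onb_frob[OF q R(1), symmetric]
    by (intro sum.cong refl) (use ev qc onb_dot[OF q] in \<open>simp add: power2_eq_square\<close>)
  have cross: "(\<Sum>i<n. l i * ((M *\<^sub>v q i) \<bullet> (M *\<^sub>v q i))) \<le> frob_norm R * frob_norm (transpose_mat M * M)"
    if M: "M \<in> carrier_mat p' n" for M p'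
  proof -
    have MM: "transpose_mat M * M \<in> carrier_mat n n" using M by simp
    have "(\<Sum>i<n. l i * ((M *\<^sub>v q i) \<bullet> (M *\<^sub>v q i)))\<^sup>2
        \<le> (\<Sum>i<n. (l i)\<^sup>2) * (\<Sum>i<n. ((M *\<^sub>v q i) \<bullet> (M *\<^sub>v q i))\<^sup>2)"
      by (rule Cauchy_Schwarz_ineq_sum)
    also have "(\<Sum>i<n. ((M *\<^sub>v q i) \<bullet> (M *\<^sub>v q i))\<^sup>2) \<le>
        (\<Sum>i<n. ((transpose_mat M * M) *\<^sub>v q i) \<bullet> ((transpose_mat M * M) *\<^sub>v q i))"
    proof (rule sum_mono)
      fix i assume "i \<in> {..<n}"
      then have i: "i < n" by simp
      have "((M *\<^sub>v q i) \<bullet> (M *\<^sub>v q i))\<^sup>2 = (q i \<bullet> ((transpose_mat M * M) *\<^sub>v q i))\<^sup>2"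
        using gram_scalar_prod[OF M qc[OF i] qc[OF i]] by simp
      also have "\<dots> \<le> (q i \<bullet> q i) * (((transpose_mat M * M) *\<^sub>v q i) \<bullet> ((transpose_mat M * M) *\<^sub>v q i))"
        using qc[OF i] MM by (intro scalar_prod_Cauchy_Schwarz[of _ n]) auto
      finally show "((M *\<^sub>v q i) \<bullet> (M *\<^sub>v q i))\<^sup>2 \<le>
          ((transpose_mat M * M) *\<^sub>v q i) \<bullet> ((transpose_mat M * M) *\<^sub>v q i)"
        using onb_dot[OF q i i] by simp
    qed
    also have "(\<Sum>i<n. ((transpose_mat M * M) *\<^sub>v q i) \<bullet> ((transpose_mat M * M) *\<^sub>v q i)) =
        (frob_norm (transpose_mat M * M))\<^sup>2"
      by (rule onb_frob[OF q MM])
    finally have "(\<Sum>i<n. l i * ((M *\<^sub>v q i) \<bullet> (M *\<^sub>v q i)))\<^sup>2 \<le> (frob_norm R * frob_norm (transpose_mat M * M))\<^sup>2"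
      unfolding fR[symmetric] power_mult_distrib
      by (simp add: mult_left_mono sum_nonneg)
    then show ?thesis by (rule power2_le_imp_le) (simp add: frob_norm_nonneg)
  qed
  have "(frob_norm R)\<^sup>2 = (\<Sum>i<n. l i * (q i \<bullet> (R *\<^sub>v q i)))"
    unfolding fR by (intro sum.cong refl) (simp add: lq power2_eq_square)
  also have "\<dots> \<le> (\<Sum>i<n. l i * (2 * ((L *\<^sub>v q i) \<bullet> (L *\<^sub>v q i)) + 2 * ((C *\<^sub>v q i) \<bullet> (C *\<^sub>v q i))))"
    using qc l0 by (intro sum_mono mult_left_mono dom) auto
  also have "\<dots> = 2 * (\<Sum>i<n. l i * ((L *\<^sub>v q i) \<bullet> (L *\<^sub>v q i))) + 2 * (\<Sum>i<n. l i * ((C *\<^sub>v q i) \<bullet> (C *\<^sub>v q i)))"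
    by (simp add: algebra_simps sum.distrib sum_distrib_left)
  also have "\<dots> \<le> 2 * (frob_norm R * frob_norm (transpose_mat L * L)) + 2 * (frob_norm R * frob_norm (transpose_mat C * C))"
    using cross[OF L] cross[OF C] by simp
  finally have "frob_norm R * frob_norm R \<le>
      (2 * frob_norm (transpose_mat L * L) + 2 * frob_norm (transpose_mat C * C)) * frob_norm R"
    by (simp add: power2_eq_square algebra_simps)
  then show "frob_norm R \<le> 2 * frob_norm (transpose_mat L * L) + 2 * frob_norm (transpose_mat C * C)"
    using frob_norm_nonneg[of R] frob_norm_nonneg[of "transpose_mat L * L"] frob_norm_nonneg[of "transpose_mat C * C"]
    by (cases "frob_norm R = 0") (auto dest: mult_right_le_imp_le)
qed

section \<open>Error bounds for an injective sketch\<close>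

lemma sum_if_ge:
  fixes f :: "nat \<Rightarrow> real"
  assumes "r \<le> n"
  shows "(\<Sum>i<n. if i < r then 0 else f i) = (\<Sum>i\<in>{r..<n}. f i)"
proof -
  have "(\<Sum>i<n. if i < r then 0 else f i) = (\<Sum>i\<in>{r..<n}. if i < r then 0 else f i)"
    by (rule sum.mono_neutral_right) auto
  also have "\<dots> = (\<Sum>i\<in>{r..<n}. f i)" by (intro sum.cong) auto
  finally show ?thesis .
qed

lemma onb_rows_mult_vec:
  assumes v: "onb n v" and r: "r \<le> n" and i: "i < r"
  shows "(transpose_mat (mat_of_cols n (map v [0..<r])) *\<^sub>v x) $ i = v i \<bullet> x"
  using assms onb_carrier[OF v, of i] by simp

text \<open>
  If the sketch is injective on the leading eigenvectors, it has a right inverse \<open>X\<close> there,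
  namely the pseudoinverse of the sketched leading block, whose norm is controlled by \<open>\<alpha>\<close>.
\<close>

lemma leading_block_right_inverse:
  assumes v: "onb n v" and r: "r \<le> n" and W: "W \<in> carrier_mat n k" and \<alpha>: "0 < \<alpha>"
    and inj: "\<And>x. x \<in> carrier_vec r \<Longrightarrow> \<alpha> * (x \<bullet> x) \<le> (\<Sum>j<k. (\<Sum>i<r. x $ i * (v i \<bullet> col W j))\<^sup>2)"
  obtains X where "X \<in> carrier_mat k n"
    "\<And>x i. x \<in> carrier_vec n \<Longrightarrow> i < r \<Longrightarrow> v i \<bullet> (W *\<^sub>v (X *\<^sub>v x)) = v i \<bullet> x"
    "\<And>x. x \<in> carrier_vec n \<Longrightarrow> (X *\<^sub>v x) \<bullet> (X *\<^sub>v x) \<le> (1 / \<alpha>) * (x \<bullet> x)"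
proof -
  define U where "U = mat_of_cols n (map v [0..<r])"
  have U: "U \<in> carrier_mat n r" by (simp add: U_def mat_of_cols_def)
  have Ux: "(transpose_mat U *\<^sub>v x) $ i = v i \<bullet> x" if "i < r" for x i
    unfolding U_def by (rule onb_rows_mult_vec[OF v r that])
  define Y where "Y = transpose_mat U * W"
  have Y: "Y \<in> carrier_mat r k" using U W by (simp add: Y_def)
  have Yij: "Y $$ (i, j) = v i \<bullet> col W j" if "i < r" "j < k" for i j
    using Ux[of i "col W j"] that U W by (simp add: Y_def)
  have sq: "(\<Sum>j<k. (\<Sum>i<r. x $ i * (v i \<bullet> col W j))\<^sup>2) = (transpose_mat Y *\<^sub>v x) \<bullet> (transpose_mat Y *\<^sub>v x)"
    if x: "x \<in> carrier_vec r" for x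
  proof -
    have "(transpose_mat Y *\<^sub>v x) $ j = (\<Sum>i<r. x $ i * (v i \<bullet> col W j))" if "j < k" for j
      using that x Y by (auto simp: scalar_prod_def[of _ x] atLeast0LessThan Yij intro!: sum.cong)
    then show ?thesis
      using Y by (auto simp: scalar_prod_def[of "transpose_mat Y *\<^sub>v x"] atLeast0LessThan power2_eq_square intro!: sum.cong)
  qed
  define H where "H = Y * transpose_mat Y"
  have H: "H \<in> carrier_mat r r" using Y by (simp add: H_def)
  have Hx: "x \<bullet> (H *\<^sub>v x) = (transpose_mat Y *\<^sub>v x) \<bullet> (transpose_mat Y *\<^sub>v x)" if "x \<in> carrier_vec r" for x
    using gram_scalar_prod[of "transpose_mat Y" k r x x] Y that by (simp add: H_def)
  have Hge: "\<alpha> * (x \<bullet> x) \<le> x \<bullet> (H *\<^sub>v x)" if "x \<in> carrier_vec r" for x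
    using inj[OF that] sq[OF that] Hx[OF that] by simp
  have "det H \<noteq> 0"
  proof
    assume "det H = 0"
    then obtain x where x: "x \<in> carrier_vec r" "x \<noteq> 0\<^sub>v r" "H *\<^sub>v x = 0\<^sub>v r"
      using det_0_iff_vec_prod_zero[OF H] by auto
    then have "\<alpha> * (x \<bullet> x) \<le> 0" using Hge[OF x(1)] by simp
    then have "x \<bullet> x = 0" using \<alpha> scalar_prod_self_nonneg[of x] by (simp add: mult_le_0_iff)
    then show False using scalar_prod_self_eq_0[OF x(1)] x(2) by simp
  qed
  define Hi where "Hi = (1 / det H) \<cdot>\<^sub>m adj_mat H"
  have Hi: "Hi \<in> carrier_mat r r" using adj_mat(1)[OF H] by (simp add: Hi_def)
  have HHi: "H * Hi = 1\<^sub>m r"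
    using adj_mat(1,2)[OF H] H \<open>det H \<noteq> 0\<close>
    by (simp add: Hi_def mult_smult_distrib[of _ r r _ r]) (intro eq_matI, auto)
  define X where "X = transpose_mat Y * (Hi * transpose_mat U)"
  have X: "X \<in> carrier_mat k n" using Y Hi U by (simp add: X_def)
  have main: "Y *\<^sub>v (X *\<^sub>v x) = transpose_mat U *\<^sub>v x"
    "(X *\<^sub>v x) \<bullet> (X *\<^sub>v x) \<le> (1 / \<alpha>) * (x \<bullet> x)" if x: "x \<in> carrier_vec n" for x
  proof -
    define z where "z = transpose_mat U *\<^sub>v x"
    define h where "h = Hi *\<^sub>v z"
    have z: "z \<in> carrier_vec r" using U x by (auto simp: z_def)
    have h: "h \<in> carrier_vec r" using Hi z by (auto simp: h_def)
    have Hh: "H *\<^sub>v h = z"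
      using HHi H Hi z by (simp add: h_def flip: assoc_mult_mat_vec[of _ r r _ r])
    have Xx: "X *\<^sub>v x = transpose_mat Y *\<^sub>v h"
    proof -
      have "X *\<^sub>v x = transpose_mat Y *\<^sub>v ((Hi * transpose_mat U) *\<^sub>v x)"
        unfolding X_def using Y Hi U x by (intro assoc_mult_mat_vec[of _ k r _ n]) auto
      also have "(Hi * transpose_mat U) *\<^sub>v x = h"
        unfolding h_def z_def using Hi U x by (intro assoc_mult_mat_vec[of _ r r _ n]) auto
      finally show ?thesis .
    qed
    have "Y *\<^sub>v (transpose_mat Y *\<^sub>v h) = H *\<^sub>v h"
      unfolding H_def using Y h by (intro assoc_mult_mat_vec[symmetric, of _ r k _ r]) auto
    then show "Y *\<^sub>v (X *\<^sub>v x) = transpose_mat U *\<^sub>v x" using Hh Xx by (simp add: z_def)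
    define t where "t = (X *\<^sub>v x) \<bullet> (X *\<^sub>v x)"
    have t: "t = h \<bullet> z" using Hx[OF h] Hh Xx by (simp add: t_def)
    have t0: "0 \<le> t" by (simp add: t_def scalar_prod_self_nonneg)
    have "t\<^sup>2 \<le> (h \<bullet> h) * (z \<bullet> z)" unfolding t by (rule scalar_prod_Cauchy_Schwarz[OF h z])
    also have "\<dots> \<le> (t / \<alpha>) * (z \<bullet> z)"
    proof (rule mult_right_mono)
      have "\<alpha> * (h \<bullet> h) \<le> t" using Hge[OF h] Hh t by simp
      then show "h \<bullet> h \<le> t / \<alpha>" using \<alpha> by (simp add: field_simps)
    qed (rule scalar_prod_self_nonneg)
    finally have "t * t \<le> ((z \<bullet> z) / \<alpha>) * t" by (simp add: power2_eq_square field_simps)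
    then have "t \<le> (z \<bullet> z) / \<alpha>"
      using t0 \<alpha> scalar_prod_self_nonneg[of z] mult_right_le_imp_le[of t t "(z \<bullet> z) / \<alpha>"]
      by (cases "t = 0") (auto simp del: times_divide_eq_left)
    also have "z \<bullet> z \<le> x \<bullet> x"
    proof -
      have "z \<bullet> z = (\<Sum>i<r. (v i \<bullet> x)\<^sup>2)"
      proof -
        have "z $ i = v i \<bullet> x" if "i < r" for i unfolding z_def by (rule Ux[OF that])
        then show ?thesis
          using z by (simp add: scalar_prod_def[of z z] atLeast0LessThan power2_eq_square)
      qed
      also have "\<dots> \<le> x \<bullet> x" using r by (intro onb_bessel[OF v x]) auto
      finally show ?thesis .
    qed
    finally show "(X *\<^sub>v x) \<bullet> (X *\<^sub>v x) \<le> (1 / \<alpha>) * (x \<bullet> x)"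
      using \<alpha> by (simp add: t_def divide_right_mono)
  qed
  show thesis
  proof (rule that[OF X])
    fix x :: "real vec" and i assume x: "x \<in> carrier_vec n" and i: "i < r"
    have c: "X *\<^sub>v x \<in> carrier_vec k" using X x by auto
    have "Y *\<^sub>v (X *\<^sub>v x) = transpose_mat U *\<^sub>v (W *\<^sub>v (X *\<^sub>v x))"
      unfolding Y_def using U W c by (intro assoc_mult_mat_vec[of _ r n _ k]) auto
    then show "v i \<bullet> (W *\<^sub>v (X *\<^sub>v x)) = v i \<bullet> x"
      using main(1)[OF x] Ux[OF i, of "W *\<^sub>v (X *\<^sub>v x)"] Ux[OF i, of x] by simp
  qed (use main(2) in blast)
qed

text \<open>
  The tail factor \<open>L\<close> has rows \<open>sqrt (l i) v i\<close> for \<open>i \<ge> r\<close>, so that \<open>L\<^sup>T L\<close> is the tail of \<open>A\<close>.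
  The residual is compared with its value at \<open>x - W X x\<close>, whose leading coordinates vanish.
\<close>

theorem nystrom_error_bounds:
  assumes A: "psd A" "A \<in> carrier_mat n n" and W: "W \<in> carrier_mat n k" and r: "r \<le> n"
    and v: "onb n v" and ev: "\<And>i. i < n \<Longrightarrow> A *\<^sub>v v i = l i \<cdot>\<^sub>v v i" and \<alpha>: "0 < \<alpha>"
    and inj: "\<And>x. x \<in> carrier_vec r \<Longrightarrow> \<alpha> * (x \<bullet> x) \<le> (\<Sum>j<k. (\<Sum>i<r. x $ i * (v i \<bullet> col W j))\<^sup>2)"
  shows "mat_tr (A - nystrom A W) \<le> 2 * (\<Sum>i\<in>{r..<n}. l i) +
      (2 / \<alpha>) * (\<Sum>j<k. \<Sum>i\<in>{r..<n}. l i * (v i \<bullet> col W j)\<^sup>2)"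
    and "(frob_norm (A - nystrom A W))\<^sup>2 \<le> 8 * (\<Sum>i\<in>{r..<n}. (l i)\<^sup>2) +
      (8 / \<alpha>\<^sup>2) * (\<Sum>j<k. \<Sum>j'<k. (\<Sum>i\<in>{r..<n}. l i * (v i \<bullet> col W j) * (v i \<bullet> col W j'))\<^sup>2)"
proof -
  define R where "R = A - nystrom A W"
  note res = nystrom_residual[OF A W, folded R_def]
  have symA: "transpose_mat A = A" using A by (simp add: psd_def)
  obtain X where X: "X \<in> carrier_mat k n"
    and lead: "\<And>x i. x \<in> carrier_vec n \<Longrightarrow> i < r \<Longrightarrow> v i \<bullet> (W *\<^sub>v (X *\<^sub>v x)) = v i \<bullet> x"
    and contr: "\<And>x. x \<in> carrier_vec n \<Longrightarrow> (X *\<^sub>v x) \<bullet> (X *\<^sub>v x) \<le> (1 / \<alpha>) * (x \<bullet> x)"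
    using leading_block_right_inverse[OF v r W \<alpha> inj] by blast
  have l0: "0 \<le> l i" if "i < n" for i using psd_eigenvalue_nonneg[OF A v that ev[OF that]] .
  have vc: "v i \<in> carrier_vec n" if "i < n" for i using onb_carrier[OF v that] .
  define L where "L = mat n n (\<lambda>(i, a). if i < r then 0 else sqrt (l i) * v i $ a)"
  have L: "L \<in> carrier_mat n n" by (simp add: L_def)
  have Li: "(L *\<^sub>v y) $ i = (if i < r then 0 else sqrt (l i) * (v i \<bullet> y))"
    if "i < n" "y \<in> carrier_vec n" for y i
    using that by (auto simp: L_def scalar_prod_def sum_distrib_left mult.assoc)
  have Lsq: "(L *\<^sub>v y) \<bullet> (L *\<^sub>v y) = (\<Sum>i\<in>{r..<n}. l i * (v i \<bullet> y)\<^sup>2)" if y: "y \<in> carrier_vec n" for y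
  proof -
    have "(L *\<^sub>v y) \<bullet> (L *\<^sub>v y) = (\<Sum>i<n. if i < r then 0 else l i * (v i \<bullet> y)\<^sup>2)"
    proof -
      have "(L *\<^sub>v y) $ i * (L *\<^sub>v y) $ i = (if i < r then 0 else l i * (v i \<bullet> y)\<^sup>2)" if "i < n" for i
        unfolding Li[OF that y] using l0[OF that]
        by (simp add: power2_eq_square mult_ac flip: mult.assoc[of "sqrt _" "sqrt _"])
      then show ?thesis
        unfolding scalar_prod_def[of "L *\<^sub>v y"] using L
        by (intro sum.cong) (auto simp del: index_mult_mat_vec)
    qed
    then show ?thesis using sum_if_ge[OF r] by simp
  qed
  define G where "G = L * W"
  have G: "G \<in> carrier_mat n k" using L W by (simp add: G_def)
  have Gij: "G $$ (i, j) = (if i < r then 0 else sqrt (l i) * (v i \<bullet> col W j))" if "i < n" "j < k" for i j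
    using Li[of i "col W j"] that L W by (simp add: G_def)
  define C where "C = G * X"
  have C: "C \<in> carrier_mat n n" using G X by (simp add: C_def)
  have dom: "x \<bullet> (R *\<^sub>v x) \<le> 2 * ((L *\<^sub>v x) \<bullet> (L *\<^sub>v x)) + 2 * ((C *\<^sub>v x) \<bullet> (C *\<^sub>v x))"
    if x: "x \<in> carrier_vec n" for x
  proof -
    define y where "y = W *\<^sub>v (X *\<^sub>v x)"
    have Xx: "X *\<^sub>v x \<in> carrier_vec k" using X x by auto
    have y: "y \<in> carrier_vec n" using W Xx by (auto simp: y_def)
    have Cx: "C *\<^sub>v x = L *\<^sub>v y"
    proof -
      have "C *\<^sub>v x = G *\<^sub>v (X *\<^sub>v x)"
        unfolding C_def by (rule assoc_mult_mat_vec[OF G X x])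
      also have "\<dots> = L *\<^sub>v y" unfolding G_def y_def by (rule assoc_mult_mat_vec[OF L W Xx])
      finally show ?thesis .
    qed
    have d: "v i \<bullet> (x - y) = v i \<bullet> x - v i \<bullet> y" if "i < n" for i
      using scalar_prod_minus_distrib[OF vc[OF that] x y] .
    have "x \<bullet> (R *\<^sub>v x) \<le> (x - y) \<bullet> (A *\<^sub>v (x - y))"
      using res(3)[OF x Xx] by (simp add: y_def)
    also have "\<dots> = (\<Sum>i<n. l i * (v i \<bullet> (x - y))\<^sup>2)"
      using x y by (intro eigenbasis_quadratic_form(1)[OF A(2) symA v ev]) auto
    also have "\<dots> = (\<Sum>i<n. if i < r then 0 else l i * (v i \<bullet> (x - y))\<^sup>2)"
    proof -
      have "v i \<bullet> (x - y) = 0" if "i < r" for i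
        using d[of i] lead[OF x that] r that by (simp add: y_def)
      then show ?thesis by (intro sum.cong refl) auto
    qed
    also have "\<dots> = (\<Sum>i\<in>{r..<n}. l i * (v i \<bullet> (x - y))\<^sup>2)" by (rule sum_if_ge[OF r])
    also have "\<dots> \<le> (\<Sum>i\<in>{r..<n}. 2 * (l i * (v i \<bullet> x)\<^sup>2) + 2 * (l i * (v i \<bullet> y)\<^sup>2))"
    proof (rule sum_mono)
      fix i assume "i \<in> {r..<n}"
      then have i: "i < n" by simp
      have "(v i \<bullet> (x - y))\<^sup>2 \<le> 2 * (v i \<bullet> x)\<^sup>2 + 2 * (v i \<bullet> y)\<^sup>2"
        unfolding d[OF i] using zero_le_power2[of "v i \<bullet> x + v i \<bullet> y"]
        by (simp add: power2_diff power2_sum)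
      then have "l i * (v i \<bullet> (x - y))\<^sup>2 \<le> l i * (2 * (v i \<bullet> x)\<^sup>2 + 2 * (v i \<bullet> y)\<^sup>2)"
        using l0[OF i] by (rule mult_left_mono)
      then show "l i * (v i \<bullet> (x - y))\<^sup>2 \<le> 2 * (l i * (v i \<bullet> x)\<^sup>2) + 2 * (l i * (v i \<bullet> y)\<^sup>2)"
        by (simp add: algebra_simps)
    qed
    also have "\<dots> = 2 * ((L *\<^sub>v x) \<bullet> (L *\<^sub>v x)) + 2 * ((C *\<^sub>v x) \<bullet> (C *\<^sub>v x))"
      unfolding Cx Lsq[OF x] Lsq[OF y] by (simp add: sum.distrib sum_distrib_left)
    finally show ?thesis .
  qed
  note bounds = dominated_psd_norms[OF res(1,2) L C dom]
  have XT: "(transpose_mat X *\<^sub>v u) \<bullet> (transpose_mat X *\<^sub>v u) \<le> (1 / \<alpha>) * (u \<bullet> u)" if "u \<in> carrier_vec k" for u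
    using \<alpha> by (intro transpose_contraction[OF X _ contr that]) auto
  have XTc: "transpose_mat X \<in> carrier_mat n k" using X by simp
  have fL: "(frob_norm L)\<^sup>2 = (\<Sum>i\<in>{r..<n}. l i)"
  proof -
    have "(frob_norm L)\<^sup>2 = (\<Sum>j<n. \<Sum>i\<in>{r..<n}. l i * (v i \<bullet> v j)\<^sup>2)"
      unfolding onb_frob[OF v L, symmetric] by (intro sum.cong refl Lsq vc) auto
    also have "\<dots> = (\<Sum>i\<in>{r..<n}. \<Sum>j<n. l i * (v i \<bullet> v j)\<^sup>2)" by (rule sum.swap)
    also have "\<dots> = (\<Sum>i\<in>{r..<n}. \<Sum>j<n. if j = i then l i else 0)"
      by (intro sum.cong refl) (auto simp: onb_dot[OF v])
    also have "\<dots> = (\<Sum>i\<in>{r..<n}. l i)" by (intro sum.cong refl) auto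
    finally show ?thesis .
  qed
  have fLL: "(frob_norm (transpose_mat L * L))\<^sup>2 = (\<Sum>i\<in>{r..<n}. (l i)\<^sup>2)"
  proof -
    have LL: "transpose_mat L * L \<in> carrier_mat n n" using L by simp
    have ev': "(transpose_mat L * L) *\<^sub>v v j = (if j < r then 0 else l j) \<cdot>\<^sub>v v j" if j: "j < n" for j
    proof (rule eq_vecI)
      fix a assume "a < dim_vec ((if j < r then 0 else l j) \<cdot>\<^sub>v v j)"
      then have a: "a < n" using vc[OF j] by simp
      have "(transpose_mat L * L) *\<^sub>v v j = transpose_mat L *\<^sub>v (L *\<^sub>v v j)"
        using L vc[OF j] by (intro assoc_mult_mat_vec[of _ n n _ n]) auto
      then have "((transpose_mat L * L) *\<^sub>v v j) $ a = (\<Sum>i<n. L $$ (i, a) * (L *\<^sub>v v j) $ i)"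
        using L a by (auto simp: scalar_prod_def[of "col L a"] atLeast0LessThan intro!: sum.cong)
      also have "\<dots> = (\<Sum>i<n. if i = j then (if j < r then 0 else l j) * v j $ a else 0)"
      proof (intro sum.cong refl)
        fix i assume "i \<in> {..<n}"
        then have i: "i < n" by simp
        have Lia: "L $$ (i, a) = (if i < r then 0 else sqrt (l i) * v i $ a)"
          using i a by (simp add: L_def)
        have "sqrt (l i) * sqrt (l i) = l i" using l0[OF i] by simp
        then show "L $$ (i, a) * (L *\<^sub>v v j) $ i = (if i = j then (if j < r then 0 else l j) * v j $ a else 0)"
          unfolding Lia Li[OF i vc[OF j]] onb_dot[OF v i j] by auto
      qed
      also have "\<dots> = ((if j < r then 0 else l j) \<cdot>\<^sub>v v j) $ a" using j a vc[OF j] by simp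
      finally show "((transpose_mat L * L) *\<^sub>v v j) $ a = ((if j < r then 0 else l j) \<cdot>\<^sub>v v j) $ a" .
    qed (use L vc[OF j] in auto)
    have "(frob_norm (transpose_mat L * L))\<^sup>2 = (\<Sum>j<n. if j < r then 0 else (l j)\<^sup>2)"
      unfolding onb_frob[OF v LL, symmetric]
      by (intro sum.cong refl) (use vc onb_dot[OF v] in \<open>auto simp: ev' power2_eq_square simp del: assoc_mult_mat_vec\<close>)
    then show ?thesis using sum_if_ge[OF r] by simp
  qed
  have fG: "(frob_norm G)\<^sup>2 = (\<Sum>j<k. \<Sum>i\<in>{r..<n}. l i * (v i \<bullet> col W j)\<^sup>2)"
  proof -
    have "(frob_norm G)\<^sup>2 = (\<Sum>i<n. \<Sum>j<k. (G $$ (i, j))\<^sup>2)"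
      using G by (simp add: frob_norm_def sum_nonneg)
    also have "\<dots> = (\<Sum>j<k. \<Sum>i<n. (G $$ (i, j))\<^sup>2)" by (rule sum.swap)
    also have "\<dots> = (\<Sum>j<k. \<Sum>i<n. if i < r then 0 else l i * (v i \<bullet> col W j)\<^sup>2)"
      by (intro sum.cong refl) (auto simp: Gij l0 power_mult_distrib)
    finally show ?thesis using sum_if_ge[OF r] by simp
  qed
  define M where "M = transpose_mat G * G"
  have M: "M \<in> carrier_mat k k" using G by (simp add: M_def)
  have symM: "transpose_mat M = M"
    using G by (simp add: M_def transpose_mult[of "transpose_mat G" k n G k])
  have fM: "(frob_norm M)\<^sup>2 = (\<Sum>j<k. \<Sum>j'<k. (\<Sum>i\<in>{r..<n}. l i * (v i \<bullet> col W j) * (v i \<bullet> col W j'))\<^sup>2)"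
  proof -
    have "M $$ (j, j') = (\<Sum>i\<in>{r..<n}. l i * (v i \<bullet> col W j) * (v i \<bullet> col W j'))" if jj: "j < k" "j' < k" for j j'
    proof -
      have "M $$ (j, j') = (\<Sum>i<n. G $$ (i, j) * G $$ (i, j'))"
        using G jj by (auto simp: M_def scalar_prod_def atLeast0LessThan intro!: sum.cong)
      also have "\<dots> = (\<Sum>i<n. if i < r then 0 else l i * (v i \<bullet> col W j) * (v i \<bullet> col W j'))"
      proof (intro sum.cong refl)
        fix i assume "i \<in> {..<n}"
        then have i: "i < n" by simp
        have "sqrt (l i) * p * (sqrt (l i) * q) = l i * p * q" for p q
          using l0[OF i] by (metis (no_types, opaque_lifting) mult.assoc mult.left_commute real_sqrt_mult_self abs_of_nonneg)
        then show "G $$ (i, j) * G $$ (i, j') =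
            (if i < r then 0 else l i * (v i \<bullet> col W j) * (v i \<bullet> col W j'))"
          using Gij[OF i jj(1)] Gij[OF i jj(2)] by auto
      qed
      finally show ?thesis using sum_if_ge[OF r] by simp
    qed
    then show ?thesis using M by (simp add: frob_norm_def sum_nonneg)
  qed
  have fC: "(frob_norm C)\<^sup>2 \<le> (1 / \<alpha>) * (frob_norm G)\<^sup>2"
  proof -
    have "frob_norm C = frob_norm (transpose_mat X * transpose_mat G)"
      unfolding C_def using transpose_mult[OF G X] frob_norm_transpose[of "G * X"] by simp
    then show ?thesis
      using frob_norm_mult_le[OF XTc _ XT, of "transpose_mat G" n] G by (simp add: frob_norm_transpose)
  qed
  have fCC: "(frob_norm (transpose_mat C * C))\<^sup>2 \<le> (1 / \<alpha>)\<^sup>2 * (frob_norm M)\<^sup>2"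
  proof -
    have "transpose_mat C * C = (transpose_mat X * transpose_mat G) * (G * X)"
      unfolding C_def using transpose_mult[OF G X] by simp
    also have "\<dots> = transpose_mat X * (transpose_mat G * (G * X))"
      using X G by (intro assoc_mult_mat[of _ n k _ n _ n]) auto
    also have "transpose_mat G * (G * X) = M * X"
      unfolding M_def using X G by (intro assoc_mult_mat[symmetric, of _ k n _ k _ n]) auto
    finally have e: "transpose_mat C * C = transpose_mat X * (M * X)" .
    have "(frob_norm (transpose_mat C * C))\<^sup>2 \<le> (1 / \<alpha>) * (frob_norm (M * X))\<^sup>2"
      unfolding e using M X by (intro frob_norm_mult_le[OF XTc _ XT, of _ n]) auto
    also have "frob_norm (M * X) = frob_norm (transpose_mat X * M)"
      using transpose_mult[OF M X] frob_norm_transpose[of "M * X"] symM by simp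
    also have "(1 / \<alpha>) * (frob_norm (transpose_mat X * M))\<^sup>2 \<le> (1 / \<alpha>) * ((1 / \<alpha>) * (frob_norm M)\<^sup>2)"
      using \<alpha> by (intro mult_left_mono frob_norm_mult_le[OF XTc M XT]) auto
    finally show ?thesis by (simp add: power2_eq_square)
  qed
  show "mat_tr (A - nystrom A W) \<le> 2 * (\<Sum>i\<in>{r..<n}. l i) +
      (2 / \<alpha>) * (\<Sum>j<k. \<Sum>i\<in>{r..<n}. l i * (v i \<bullet> col W j)\<^sup>2)"
    using bounds(1) fC unfolding fL fG R_def by simp
  have "(frob_norm R)\<^sup>2 \<le> (2 * frob_norm (transpose_mat L * L) + 2 * frob_norm (transpose_mat C * C))\<^sup>2"
    using bounds(2) by (intro power_mono frob_norm_nonneg)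
  also have "\<dots> \<le> 8 * (frob_norm (transpose_mat L * L))\<^sup>2 + 8 * (frob_norm (transpose_mat C * C))\<^sup>2"
    using zero_le_power2[of "frob_norm (transpose_mat L * L) - frob_norm (transpose_mat C * C)"]
    by (simp add: power2_eq_square algebra_simps)
  also have "\<dots> \<le> 8 * (\<Sum>i\<in>{r..<n}. (l i)\<^sup>2) + 8 * ((1 / \<alpha>)\<^sup>2 * (frob_norm M)\<^sup>2)"
    using fCC unfolding fLL by simp
  finally show "(frob_norm (A - nystrom A W))\<^sup>2 \<le> 8 * (\<Sum>i\<in>{r..<n}. (l i)\<^sup>2) +
      (8 / \<alpha>\<^sup>2) * (\<Sum>j<k. \<Sum>j'<k. (\<Sum>i\<in>{r..<n}. l i * (v i \<bullet> col W j) * (v i \<bullet> col W j'))\<^sup>2)"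
    unfolding fM R_def by (simp add: power_divide)
qed

section \<open>Moments of Gaussian linear forms\<close>

abbreviation gauss :: "real \<Rightarrow> real measure" where
  "gauss s \<equiv> density lborel (\<lambda>x. ennreal (normal_density 0 s x))"

lemma prob_space_gauss: "0 < s \<Longrightarrow> prob_space (gauss s)"
  by (rule prob_space_normal_density)

text \<open>
  A linear combination of independent centered normal variables is normal; terms with coefficient
  \<open>0\<close> are discarded first, since they have no density.
\<close>

lemma gaussian_linear_form_moments:
  fixes c :: "'e \<Rightarrow> real"
  assumes fin: "finite E" and s: "0 < s"
  defines "P \<equiv> Pi\<^sub>M E (\<lambda>_. gauss s)"
  defines "Y \<equiv> \<lambda>g. \<Sum>e\<in>E. c e * g e"
  shows "has_bochner_integral P (\<lambda>g. (Y g)^2) (s^2 * (\<Sum>e\<in>E. (c e)\<^sup>2))"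
    and "has_bochner_integral P (\<lambda>g. (Y g)^4) (3 * s^4 * (\<Sum>e\<in>E. (c e)\<^sup>2)\<^sup>2)"
proof -
  interpret G: prob_space "gauss s" by (rule prob_space_gauss[OF s])
  interpret P: prob_space P unfolding P_def by (intro prob_space_PiM prob_space_gauss s)
  define S where "S = {e \<in> E. c e \<noteq> 0}"
  have S: "finite S" "S \<subseteq> E" using fin by (auto simp: S_def)
  have YS: "Y = (\<lambda>g. \<Sum>e\<in>S. c e * g e)"
    unfolding Y_def S_def using fin by (intro ext sum.mono_neutral_right) auto
  have cS: "(\<Sum>e\<in>E. (c e)\<^sup>2) = (\<Sum>e\<in>S. (c e)\<^sup>2)"
    unfolding S_def using fin by (intro sum.mono_neutral_right) auto
  have meas: "(\<lambda>g. g e) \<in> borel_measurable P" if "e \<in> E" for e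
    unfolding P_def using measurable_component_singleton[OF that, of "\<lambda>_. gauss s"]
    by (simp add: measurable_cong_sets[OF refl sets_density])
  have comp: "distr P (gauss s) (\<lambda>g. g e) = gauss s" if "e \<in> E" for e
    unfolding P_def using that fin by (intro distr_PiM_component prob_space_gauss s)
  have comp': "distr P borel (\<lambda>g. g e) = gauss s" if "e \<in> E" for e
    using comp[OF that] by (metis distr_cong sets_density sets_lborel)
  have ind: "P.indep_vars (\<lambda>_. borel) (\<lambda>e g. g e) E"
  proof (cases "E = {}")
    case False
    show ?thesis
    proof (subst P.indep_vars_iff_distr_eq_PiM'[OF False])
      show "(\<lambda>g. g e) \<in> borel_measurable P" if "e \<in> E" for e using meas[OF that] .
      have "distr P (Pi\<^sub>M E (\<lambda>_. borel)) (\<lambda>x. \<lambda>e\<in>E. x e) = distr P P (\<lambda>x. x)"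
        unfolding P_def by (intro distr_cong sets_PiM_cong) (auto simp: space_PiM PiE_restrict)
      also have "\<dots> = P" by simp
      also have "\<dots> = Pi\<^sub>M E (\<lambda>e. distr P borel (\<lambda>g. g e))"
        unfolding P_def[of] by (intro PiM_cong refl) (simp add: comp'[unfolded P_def])
      finally show "distr P (Pi\<^sub>M E (\<lambda>_. borel)) (\<lambda>x. \<lambda>e\<in>E. x e) = Pi\<^sub>M E (\<lambda>e. distr P borel (\<lambda>g. g e))" .
    qed
  qed (simp add: P.indep_vars_def P.indep_sets_def)
  have main: "has_bochner_integral P (\<lambda>g. (Y g)^2) (s^2 * (\<Sum>e\<in>E. (c e)\<^sup>2)) \<and>
     has_bochner_integral P (\<lambda>g. (Y g)^4) (3 * s^4 * (\<Sum>e\<in>E. (c e)\<^sup>2)\<^sup>2)"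
  proof (cases "S = {}")
    case True
    then have "Y = (\<lambda>_. 0)" "(\<Sum>e\<in>E. (c e)\<^sup>2) = 0" by (simp_all add: YS cS)
    then show ?thesis by (simp add: has_bochner_integral_zero)
  next
    case False
    have D1: "distributed P lborel (\<lambda>g. c e * g e) (normal_density 0 (\<bar>c e\<bar> * s))" if "e \<in> S" for e
    proof -
      have e: "e \<in> E" "c e \<noteq> 0" using that by (auto simp: S_def)
      have "distributed P lborel (\<lambda>g. g e) (normal_density 0 s)"
        unfolding distributed_def
      proof (intro conjI)
        show "distr P lborel (\<lambda>g. g e) = gauss s" using comp'[OF e(1)] by (metis distr_cong sets_lborel)
      qed (use meas[OF e(1)] in auto)
      from P.normal_density_affine[OF this s e(2), of 0] show ?thesis by simp
    qed
    define t where "t = sqrt (\<Sum>e\<in>S. (\<bar>c e\<bar> * s)\<^sup>2)"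
    have t2: "t\<^sup>2 = s\<^sup>2 * (\<Sum>e\<in>E. (c e)\<^sup>2)"
      unfolding t_def cS by (simp add: sum_nonneg power_mult_distrib sum_distrib_left mult.commute)
    have "0 < (\<Sum>e\<in>S. (\<bar>c e\<bar> * s)\<^sup>2)"
      using S False s by (intro sum_pos) (auto simp: S_def)
    then have t0: "0 < t" by (simp add: t_def)
    have indS: "P.indep_vars (\<lambda>_. borel) (\<lambda>e g. c e * g e) S"
      by (rule P.indep_vars_compose2[OF P.indep_vars_subset[OF ind S(2)]]) auto
    have "distributed P lborel (\<lambda>g. \<Sum>e\<in>S. c e * g e) (normal_density (\<Sum>e\<in>S. 0) t)"
      unfolding t_def using s by (intro P.sum_indep_normal[OF S(1) False indS _ D1]) (auto simp: S_def)
    then have D: "distributed P lborel Y (normal_density 0 t)" by (simp add: YS)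
    have mom: "has_bochner_integral P (\<lambda>g. (Y g)^(2*k)) (fact (2 * k) / ((2 / t\<^sup>2)^k * fact k))" for k
    proof -
      have h: "has_bochner_integral lborel (\<lambda>x. normal_density 0 t x * x^(2*k)) (fact (2 * k) / ((2 / t\<^sup>2)^k * fact k))"
        using normal_moment_even[OF t0, of 0 k] by simp
      have "integrable P (\<lambda>g. (Y g)^(2*k))"
        using distributed_integrable[OF D, of "\<lambda>x. x^(2*k)"] h by (auto simp: has_bochner_integral_iff)
      moreover have "(\<integral>g. (Y g)^(2*k) \<partial>P) = fact (2 * k) / ((2 / t\<^sup>2)^k * fact k)"
        using distributed_integral[OF D, of "\<lambda>x. x^(2*k)"] h by (auto simp: has_bochner_integral_iff)
      ultimately show ?thesis by (simp add: has_bochner_integral_iff)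
    qed
    have "has_bochner_integral P (\<lambda>g. (Y g)^2) (t\<^sup>2)"
      using mom[of 1] t0 by simp
    moreover have "has_bochner_integral P (\<lambda>g. (Y g)^4) (3 * t\<^sup>2 * t\<^sup>2)"
    proof -
      have "fact (2 * 2) / ((2 / t\<^sup>2)^2 * fact 2) = 3 * t\<^sup>2 * t\<^sup>2"
        using t0 by (simp add: fact_numeral power2_eq_square field_simps)
      then show ?thesis using mom[of 2] by simp
    qed
    ultimately show ?thesis
      unfolding t2 by (simp add: power2_eq_square power4_eq_xxxx mult_ac)
  qed
  then show "has_bochner_integral P (\<lambda>g. (Y g)^2) (s^2 * (\<Sum>e\<in>E. (c e)\<^sup>2))"
    "has_bochner_integral P (\<lambda>g. (Y g)^4) (3 * s^4 * (\<Sum>e\<in>E. (c e)\<^sup>2)\<^sup>2)" by auto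
qed

text \<open>Polarization: \<open>(Y + Y')\<^sup>4 + (Y - Y')\<^sup>4 = 2 Y\<^sup>4 + 12 Y\<^sup>2 Y'\<^sup>2 + 2 Y'\<^sup>4\<close>.\<close>

lemma gaussian_square_product_moment:
  fixes c c' :: "'e \<Rightarrow> real"
  assumes fin: "finite E" and s: "0 < s"
  shows "has_bochner_integral (Pi\<^sub>M E (\<lambda>_. gauss s))
     (\<lambda>g. (\<Sum>e\<in>E. c e * g e)\<^sup>2 * (\<Sum>e\<in>E. c' e * g e)\<^sup>2)
     (s^4 * ((\<Sum>e\<in>E. (c e)\<^sup>2) * (\<Sum>e\<in>E. (c' e)\<^sup>2) + 2 * (\<Sum>e\<in>E. c e * c' e)\<^sup>2))"
proof -
  let ?P = "Pi\<^sub>M E (\<lambda>_. gauss s)"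
  define Y Y' where "Y g = (\<Sum>e\<in>E. c e * g e)" and "Y' g = (\<Sum>e\<in>E. c' e * g e)" for g :: "'e \<Rightarrow> real"
  define a b d where "a = (\<Sum>e\<in>E. (c e)\<^sup>2)" and "b = (\<Sum>e\<in>E. (c' e)\<^sup>2)" and "d = (\<Sum>e\<in>E. c e * c' e)"
  note m = gaussian_linear_form_moments(2)[OF fin s]
  have plus: "has_bochner_integral ?P (\<lambda>g. (Y g + Y' g)^4) (3 * s^4 * (a + b + 2 * d)\<^sup>2)"
  proof -
    have "(\<Sum>e\<in>E. (c e + c' e) * g e) = Y g + Y' g" for g
      by (simp add: Y_def Y'_def distrib_right sum.distrib)
    moreover have "(\<Sum>e\<in>E. (c e + c' e)\<^sup>2) = a + b + 2 * d"
      by (simp add: a_def b_def d_def power2_sum sum.distrib sum_distrib_left mult.assoc)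
    ultimately show ?thesis using m[of "\<lambda>e. c e + c' e"] by simp
  qed
  have minus: "has_bochner_integral ?P (\<lambda>g. (Y g - Y' g)^4) (3 * s^4 * (a + b - 2 * d)\<^sup>2)"
  proof -
    have "(\<Sum>e\<in>E. (c e - c' e) * g e) = Y g - Y' g" for g
      by (simp add: Y_def Y'_def left_diff_distrib sum_subtractf)
    moreover have "(\<Sum>e\<in>E. (c e - c' e)\<^sup>2) = a + b - 2 * d"
      by (simp add: a_def b_def d_def power2_diff sum.distrib sum_subtractf sum_distrib_left mult.assoc)
    ultimately show ?thesis using m[of "\<lambda>e. c e - c' e"] by simp
  qed
  have 1: "has_bochner_integral ?P (\<lambda>g. (Y g)^4) (3 * s^4 * a\<^sup>2)"
    and 2: "has_bochner_integral ?P (\<lambda>g. (Y' g)^4) (3 * s^4 * b\<^sup>2)"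
    using m[of c] m[of c'] by (simp_all add: Y_def Y'_def a_def b_def)
  have "has_bochner_integral ?P
    (\<lambda>g. (1/12) * (((Y g + Y' g)^4 + (Y g - Y' g)^4) - (2 * (Y g)^4 + 2 * (Y' g)^4)))
    ((1/12) * ((3 * s^4 * (a + b + 2 * d)\<^sup>2 + 3 * s^4 * (a + b - 2 * d)\<^sup>2) - (2 * (3 * s^4 * a\<^sup>2) + 2 * (3 * s^4 * b\<^sup>2))))"
    by (intro has_bochner_integral_mult_right has_bochner_integral_diff has_bochner_integral_add plus minus 1 2)
  moreover have "(1/12) * (((y + z)^4 + (y - z)^4) - (2 * y^4 + 2 * z^4)) = y\<^sup>2 * z\<^sup>2" for y z :: real
    by (simp add: power2_eq_square power4_eq_xxxx algebra_simps)
  moreover have "(1/12) * ((3 * s^4 * (a + b + 2 * d)\<^sup>2 + 3 * s^4 * (a + b - 2 * d)\<^sup>2) - (2 * (3 * s^4 * a\<^sup>2) + 2 * (3 * s^4 * b\<^sup>2)))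
      = s^4 * (a * b + 2 * d\<^sup>2)"
    by (simp add: power2_eq_square algebra_simps)
  ultimately show ?thesis by (simp add: Y_def Y'_def a_def b_def d_def)
qed

lemma double_sum_square:
  fixes f :: "'a \<Rightarrow> 'b \<Rightarrow> real"
  shows "(\<Sum>a\<in>A. \<Sum>b\<in>B. f a b)\<^sup>2 = (\<Sum>a\<in>A. \<Sum>b\<in>B. \<Sum>a'\<in>A. \<Sum>b'\<in>B. f a b * f a' b')"
proof -
  have "(\<Sum>a\<in>A. \<Sum>b\<in>B. f a b) * r = (\<Sum>a\<in>A. \<Sum>b\<in>B. f a b * r)" for r
    by (simp add: sum_distrib_right)
  then have "(\<Sum>a\<in>A. \<Sum>b\<in>B. f a b)\<^sup>2 = (\<Sum>a\<in>A. \<Sum>b\<in>B. f a b * (\<Sum>a\<in>A. \<Sum>b\<in>B. f a b))"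
    unfolding power2_eq_square .
  then show ?thesis by (simp add: sum_distrib_left)
qed

text \<open>
  The contraction step. A matrix \<open>T\<close> is contracted with a Gaussian matrix with entries indexed by
  \<open>J \<times> B\<close>; \<open>ent\<close> names the entries. The rows for different bond values \<open>b\<close> are independent, so
  only the \<open>card B\<close> diagonal pairs contribute the extra Gaussian factor \<open>2\<close>.
\<close>

lemma gaussian_contraction_moments:
  fixes T :: "'j \<Rightarrow> 'k \<Rightarrow> real" and ent :: "'j \<Rightarrow> 'b \<Rightarrow> 'e"
  assumes fin: "finite J" "finite B" "finite K" and s: "0 < s"
    and inj: "inj_on (\<lambda>(j, b). ent j b) (J \<times> B)" and E: "E = (\<lambda>(j, b). ent j b) ` (J \<times> B)"
  defines "Q \<equiv> \<lambda>g. \<Sum>b\<in>B. \<Sum>k\<in>K. (\<Sum>j\<in>J. T j k * g (ent j b))\<^sup>2"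
  defines "t \<equiv> \<Sum>j\<in>J. \<Sum>k\<in>K. (T j k)\<^sup>2"
  shows "has_bochner_integral (Pi\<^sub>M E (\<lambda>_. gauss s)) Q (s\<^sup>2 * real (card B) * t)"
    and "integrable (Pi\<^sub>M E (\<lambda>_. gauss s)) (\<lambda>g. (Q g)\<^sup>2)"
    and "(\<integral>g. (Q g)\<^sup>2 \<partial>Pi\<^sub>M E (\<lambda>_. gauss s)) \<le> s^4 * ((real (card B))\<^sup>2 + 2 * real (card B)) * t\<^sup>2"
proof -
  let ?P = "Pi\<^sub>M E (\<lambda>_. gauss s)"
  have finE: "finite E" using fin by (simp add: E)
  define c where "c b k e = (\<Sum>j\<in>J. if ent j b = e then T j k else 0)" for b k e
  have c_ent: "c b k (ent j b') = (if b = b' then T j k else 0)" if "b \<in> B" "b' \<in> B" "j \<in> J" for b k j b'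
  proof -
    have "ent j' b = ent j b' \<longleftrightarrow> j' = j \<and> b = b'" if "j' \<in> J" for j'
      using inj_onD[OF inj, of "(j', b)" "(j, b')"] that \<open>b \<in> B\<close> \<open>b' \<in> B\<close> \<open>j \<in> J\<close> by auto
    then have "c b k (ent j b') = (\<Sum>j'\<in>J. if j' = j then (if b = b' then T j k else 0) else 0)"
      unfolding c_def by (intro sum.cong) auto
    then show ?thesis using fin that by simp
  qed
  have sumE: "(\<Sum>e\<in>E. f e) = (\<Sum>j\<in>J. \<Sum>b\<in>B. f (ent j b))" for f :: "'e \<Rightarrow> real"
    unfolding E sum.reindex[OF inj] sum.cartesian_product by (intro sum.cong refl) auto
  have lin: "(\<Sum>e\<in>E. c b k e * g e) = (\<Sum>j\<in>J. T j k * g (ent j b))" if "b \<in> B" for b k g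
  proof -
    have "(\<Sum>e\<in>E. c b k e * g e) = (\<Sum>j\<in>J. \<Sum>b'\<in>B. if b' = b then T j k * g (ent j b) else 0)"
      unfolding sumE using that by (intro sum.cong refl) (auto simp: c_ent)
    then show ?thesis using fin that by simp
  qed
  have dot: "(\<Sum>e\<in>E. c b k e * c b' k' e) = (if b = b' then \<Sum>j\<in>J. T j k * T j k' else 0)"
    if "b \<in> B" "b' \<in> B" for b k b' k'
    unfolding lin[OF that(1)] using that by (auto simp: c_ent)
  have sq: "(\<Sum>e\<in>E. (c b k e)\<^sup>2) = (\<Sum>j\<in>J. (T j k)\<^sup>2)" if "b \<in> B" for b k
    using dot[OF that that, of k k] by (simp add: power2_eq_square)
  define n where "n k = (\<Sum>j\<in>J. (T j k)\<^sup>2)" for k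
  have t: "t = (\<Sum>k\<in>K. n k)" unfolding t_def n_def by (rule sum.swap)
  have "has_bochner_integral ?P (\<lambda>g. \<Sum>b\<in>B. \<Sum>k\<in>K. (\<Sum>e\<in>E. c b k e * g e)\<^sup>2) (\<Sum>b\<in>B. \<Sum>k\<in>K. s\<^sup>2 * (\<Sum>e\<in>E. (c b k e)\<^sup>2))"
    by (intro has_bochner_integral_sum gaussian_linear_form_moments(1)[OF finE s])
  moreover have "(\<lambda>g. \<Sum>b\<in>B. \<Sum>k\<in>K. (\<Sum>e\<in>E. c b k e * g e)\<^sup>2) = Q"
    unfolding Q_def by (intro ext sum.cong refl) (simp add: lin)
  moreover have "(\<Sum>b\<in>B. \<Sum>k\<in>K. s\<^sup>2 * (\<Sum>e\<in>E. (c b k e)\<^sup>2)) = s\<^sup>2 * real (card B) * t"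
    by (simp add: sq t n_def flip: sum_distrib_left)
  ultimately show "has_bochner_integral ?P Q (s\<^sup>2 * real (card B) * t)" by simp
  let ?v = "\<Sum>b\<in>B. \<Sum>k\<in>K. \<Sum>b'\<in>B. \<Sum>k'\<in>K.
     s^4 * ((\<Sum>e\<in>E. (c b k e)\<^sup>2) * (\<Sum>e\<in>E. (c b' k' e)\<^sup>2) + 2 * (\<Sum>e\<in>E. c b k e * c b' k' e)\<^sup>2)"
  have "has_bochner_integral ?P (\<lambda>g. \<Sum>b\<in>B. \<Sum>k\<in>K. \<Sum>b'\<in>B. \<Sum>k'\<in>K.
     (\<Sum>e\<in>E. c b k e * g e)\<^sup>2 * (\<Sum>e\<in>E. c b' k' e * g e)\<^sup>2) ?v"
    by (intro has_bochner_integral_sum gaussian_square_product_moment[OF finE s])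
  moreover have "(\<Sum>b\<in>B. \<Sum>k\<in>K. \<Sum>b'\<in>B. \<Sum>k'\<in>K.
     (\<Sum>e\<in>E. c b k e * g e)\<^sup>2 * (\<Sum>e\<in>E. c b' k' e * g e)\<^sup>2) = (Q g)\<^sup>2" for g
  proof -
    have "Q g = (\<Sum>b\<in>B. \<Sum>k\<in>K. (\<Sum>e\<in>E. c b k e * g e)\<^sup>2)"
      unfolding Q_def by (intro sum.cong refl) (simp add: lin)
    then show ?thesis by (simp only: double_sum_square)
  qed
  ultimately have Q2: "has_bochner_integral ?P (\<lambda>g. (Q g)\<^sup>2) ?v" by simp
  then show "integrable ?P (\<lambda>g. (Q g)\<^sup>2)" by (simp add: has_bochner_integral_iff)
  have "(\<integral>g. (Q g)\<^sup>2 \<partial>?P) = ?v" using Q2 by (simp add: has_bochner_integral_iff)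
  also have "\<dots> \<le> (\<Sum>b\<in>B. \<Sum>k\<in>K. \<Sum>b'\<in>B. \<Sum>k'\<in>K. s^4 * (n k * n k' + (if b' = b then 2 * (n k * n k') else 0)))"
  proof (intro sum_mono mult_left_mono)
    fix b k b' k' assume b: "b \<in> B" "b' \<in> B"
    have "(\<Sum>j\<in>J. T j k * T j k')\<^sup>2 \<le> n k * n k'" unfolding n_def by (rule Cauchy_Schwarz_ineq_sum)
    then show "(\<Sum>e\<in>E. (c b k e)\<^sup>2) * (\<Sum>e\<in>E. (c b' k' e)\<^sup>2) + 2 * (\<Sum>e\<in>E. c b k e * c b' k' e)\<^sup>2
        \<le> n k * n k' + (if b' = b then 2 * (n k * n k') else 0)"
      unfolding dot[OF b] sq[OF b(1)] sq[OF b(2)] by (auto simp: n_def)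
  qed (use s in auto)
  also have "\<dots> = (\<Sum>b\<in>B. \<Sum>k\<in>K. \<Sum>b'\<in>B. s^4 * (n k * t + (if b' = b then 2 * (n k * t) else 0)))"
    by (intro sum.cong refl) (auto simp: t sum_distrib_left sum.distrib algebra_simps)
  also have "\<dots> = (\<Sum>b\<in>B. \<Sum>k\<in>K. s^4 * (real (card B) * (n k * t) + 2 * (n k * t)))"
    by (intro sum.cong refl) (simp add: fin sum.distrib flip: sum_distrib_left)
  also have "\<dots> = (\<Sum>b\<in>B. s^4 * (real (card B) * (t * t) + 2 * (t * t)))"
    by (intro sum.cong refl) (simp add: t sum.distrib flip: sum_distrib_left sum_distrib_right)
  also have "\<dots> = s^4 * ((real (card B))\<^sup>2 + 2 * real (card B)) * t\<^sup>2"
    by (simp add: power2_eq_square algebra_simps)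
  finally show "(\<integral>g. (Q g)\<^sup>2 \<partial>?P) \<le> s^4 * ((real (card B))\<^sup>2 + 2 * real (card B)) * t\<^sup>2" .
qed

section \<open>Moments of random matrix product states\<close>

abbreviation entry_law :: "nat \<Rightarrow> core_entry \<Rightarrow> real measure" where
  "entry_law \<chi> e \<equiv> gauss (sqrt (entry_variance \<chi> e))"

lemma entry_variance_pos: "1 \<le> \<chi> \<Longrightarrow> 0 < entry_variance \<chi> e"
  by (cases e) auto

lemma prob_space_entry_law: "1 \<le> \<chi> \<Longrightarrow> prob_space (entry_law \<chi> e)"
  by (intro prob_space_gauss) (simp add: entry_variance_pos)

lemma measurable_entry: "e \<in> E \<Longrightarrow> (\<lambda>G. G e) \<in> borel_measurable (Pi\<^sub>M E (entry_law \<chi>))"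
  using measurable_component_singleton[of e E "entry_law \<chi>"]
  by (simp add: measurable_cong_sets[OF refl sets_density])

text \<open>
  Fubini: conditionally on the entries in \<open>C\<close>, which determine the tensor \<open>T\<close>, contracting with the
  block \<open>E\<close> of fresh Gaussian entries is the step treated before.
\<close>

lemma integrate_out_gaussian_block:
  fixes T :: "(core_entry \<Rightarrow> real) \<Rightarrow> 'j \<Rightarrow> 'k \<Rightarrow> real" and ent :: "'j \<Rightarrow> 'b \<Rightarrow> core_entry"
  assumes \<chi>: "1 \<le> \<chi>" and fin: "finite J" "finite B" "finite K" and s: "0 < s"
    and inj: "inj_on (\<lambda>(j, b). ent j b) (J \<times> B)" and E: "E = (\<lambda>(j, b). ent j b) ` (J \<times> B)"
    and C: "finite C" "C \<inter> E = {}" and law: "\<And>e. e \<in> E \<Longrightarrow> sqrt (entry_variance \<chi> e) = s"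
    and dep: "\<And>G G' j k. (\<And>e. e \<in> C \<Longrightarrow> G e = G' e) \<Longrightarrow> j \<in> J \<Longrightarrow> k \<in> K \<Longrightarrow> T G j k = T G' j k"
    and meas: "\<And>j k. j \<in> J \<Longrightarrow> k \<in> K \<Longrightarrow> (\<lambda>G. T G j k) \<in> borel_measurable (Pi\<^sub>M C (entry_law \<chi>))"
  defines "Q \<equiv> \<lambda>G. \<Sum>b\<in>B. \<Sum>k\<in>K. (\<Sum>j\<in>J. T G j k * G (ent j b))\<^sup>2"
  defines "t \<equiv> \<lambda>G. \<Sum>j\<in>J. \<Sum>k\<in>K. (T G j k)\<^sup>2"
  shows "(\<integral>\<^sup>+G. ennreal (Q G) \<partial>Pi\<^sub>M (C \<union> E) (entry_law \<chi>)) =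
           (\<integral>\<^sup>+G. ennreal (s\<^sup>2 * real (card B) * t G) \<partial>Pi\<^sub>M C (entry_law \<chi>))"
    and "(\<integral>\<^sup>+G. ennreal ((Q G)\<^sup>2) \<partial>Pi\<^sub>M (C \<union> E) (entry_law \<chi>)) \<le>
           (\<integral>\<^sup>+G. ennreal (s^4 * ((real (card B))\<^sup>2 + 2 * real (card B)) * (t G)\<^sup>2) \<partial>Pi\<^sub>M C (entry_law \<chi>))"
proof -
  interpret product_sigma_finite "entry_law \<chi>"
    by (intro product_sigma_finite.intro prob_space_imp_sigma_finite prob_space_entry_law \<chi>)
  have finE: "finite E" using fin by (simp add: E)
  have entE: "ent j b \<in> E" if "j \<in> J" "b \<in> B" for j b using that by (auto simp: E)
  have T_union: "(\<lambda>G. T G j k) \<in> borel_measurable (Pi\<^sub>M (C \<union> E) (entry_law \<chi>))" if "j \<in> J" "k \<in> K" for j k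
  proof -
    have "(\<lambda>G. T (restrict G C) j k) \<in> borel_measurable (Pi\<^sub>M (C \<union> E) (entry_law \<chi>))"
      using measurable_compose[OF measurable_restrict_subset[of C "C \<union> E" "entry_law \<chi>"] meas[OF that]] by simp
    moreover have "T (restrict G C) j k = T G j k" for G by (rule dep) (use that in auto)
    ultimately show ?thesis by simp
  qed
  have Q_meas: "Q \<in> borel_measurable (Pi\<^sub>M (C \<union> E) (entry_law \<chi>))"
    unfolding Q_def
    by (intro borel_measurable_sum borel_measurable_power borel_measurable_times T_union measurable_entry)
       (auto simp: entE)
  have PE: "Pi\<^sub>M E (entry_law \<chi>) = Pi\<^sub>M E (\<lambda>_. gauss s)"
    by (intro PiM_cong refl) (simp add: law)
  define QQ where "QQ x y = (\<Sum>b\<in>B. \<Sum>k\<in>K. (\<Sum>j\<in>J. T x j k * y (ent j b))\<^sup>2)" for x y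
  have merge: "Q (merge C E (x, y)) = QQ x y" for x y
  proof -
    have "merge C E (x, y) e = x e" if "e \<in> C" for e using that by (simp add: merge_def)
    then have 1: "T (merge C E (x, y)) j k = T x j k" if "j \<in> J" "k \<in> K" for j k
      using that by (intro dep) auto
    have "merge C E (x, y) (ent j b) = y (ent j b)" if "j \<in> J" "b \<in> B" for j b
      using entE[OF that] C(2) by (auto simp: merge_def)
    then show ?thesis unfolding Q_def QQ_def by (intro sum.cong refl) (simp add: 1)
  qed
  have QQ0: "0 \<le> QQ x y" for x y unfolding QQ_def by (intro sum_nonneg) auto
  note step = gaussian_contraction_moments[OF fin s inj E]
  have "(\<integral>\<^sup>+G. ennreal (Q G) \<partial>Pi\<^sub>M (C \<union> E) (entry_law \<chi>)) =
      (\<integral>\<^sup>+x. \<integral>\<^sup>+y. ennreal (QQ x y) \<partial>Pi\<^sub>M E (\<lambda>_. gauss s) \<partial>Pi\<^sub>M C (entry_law \<chi>))"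
    using Q_meas by (subst product_nn_integral_fold[OF C(2,1) finE]) (auto simp: merge PE)
  also have "\<dots> = (\<integral>\<^sup>+G. ennreal (s\<^sup>2 * real (card B) * t G) \<partial>Pi\<^sub>M C (entry_law \<chi>))"
  proof (intro nn_integral_cong)
    fix x
    show "(\<integral>\<^sup>+y. ennreal (QQ x y) \<partial>Pi\<^sub>M E (\<lambda>_. gauss s)) = ennreal (s\<^sup>2 * real (card B) * t x)"
      using step(1)[of "T x"] QQ0[of x] unfolding QQ_def t_def
      by (subst nn_integral_eq_integral) (auto simp: has_bochner_integral_iff)
  qed
  finally show "(\<integral>\<^sup>+G. ennreal (Q G) \<partial>Pi\<^sub>M (C \<union> E) (entry_law \<chi>)) =
           (\<integral>\<^sup>+G. ennreal (s\<^sup>2 * real (card B) * t G) \<partial>Pi\<^sub>M C (entry_law \<chi>))" .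
  have "(\<integral>\<^sup>+G. ennreal ((Q G)\<^sup>2) \<partial>Pi\<^sub>M (C \<union> E) (entry_law \<chi>)) =
      (\<integral>\<^sup>+x. \<integral>\<^sup>+y. ennreal ((QQ x y)\<^sup>2) \<partial>Pi\<^sub>M E (\<lambda>_. gauss s) \<partial>Pi\<^sub>M C (entry_law \<chi>))"
    using Q_meas by (subst product_nn_integral_fold[OF C(2,1) finE]) (auto simp: merge PE)
  also have "\<dots> \<le> (\<integral>\<^sup>+G. ennreal (s^4 * ((real (card B))\<^sup>2 + 2 * real (card B)) * (t G)\<^sup>2) \<partial>Pi\<^sub>M C (entry_law \<chi>))"
  proof (intro nn_integral_mono)
    fix x
    have "(\<integral>\<^sup>+y. ennreal ((QQ x y)\<^sup>2) \<partial>Pi\<^sub>M E (\<lambda>_. gauss s)) = ennreal (\<integral>y. (QQ x y)\<^sup>2 \<partial>Pi\<^sub>M E (\<lambda>_. gauss s))"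
      using step(2)[of "T x"] unfolding QQ_def by (intro nn_integral_eq_integral) auto
    also have "\<dots> \<le> ennreal (s^4 * ((real (card B))\<^sup>2 + 2 * real (card B)) * (t x)\<^sup>2)"
      using step(3)[of "T x"] unfolding QQ_def t_def by (intro ennreal_leI)
    finally show "(\<integral>\<^sup>+y. ennreal ((QQ x y)\<^sup>2) \<partial>Pi\<^sub>M E (\<lambda>_. gauss s)) \<le>
        ennreal (s^4 * ((real (card B))\<^sup>2 + 2 * real (card B)) * (t x)\<^sup>2)" .
  qed
  finally show "(\<integral>\<^sup>+G. ennreal ((Q G)\<^sup>2) \<partial>Pi\<^sub>M (C \<union> E) (entry_law \<chi>)) \<le>
           (\<integral>\<^sup>+G. ennreal (s^4 * ((real (card B))\<^sup>2 + 2 * real (card B)) * (t G)\<^sup>2) \<partial>Pi\<^sub>M C (entry_law \<chi>))" .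
qed

text \<open>
  The product of the first \<open>p + 1\<close> cores: \<open>h\<close> encodes the first \<open>p + 1\<close> physical indices and
  \<open>\<beta>\<close> is the open bond to the right.
\<close>

primrec mps_left :: "nat \<Rightarrow> nat \<Rightarrow> (core_entry \<Rightarrow> real) \<Rightarrow> nat \<Rightarrow> nat \<Rightarrow> nat \<Rightarrow> real" where
  "mps_left d \<chi> G 0 h \<beta> = G (First h \<beta>)"
| "mps_left d \<chi> G (Suc p) h \<beta> = (\<Sum>\<alpha><\<chi>. mps_left d \<chi> G p (h div d) \<alpha> * G (Inner (p + 2) \<alpha> (h mod d) \<beta>))"

lemma sum_PiE_atLeastAtMost_Suc:
  fixes f :: "(nat \<Rightarrow> nat) \<Rightarrow> real"
  shows "(\<Sum>\<alpha> \<in> {1..Suc p} \<rightarrow>\<^sub>E S. f \<alpha>) = (\<Sum>a\<in>S. \<Sum>\<alpha> \<in> {1..p} \<rightarrow>\<^sub>E S. f (\<alpha>(Suc p := a)))"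
proof -
  have I: "{1..Suc p} = insert (Suc p) {1..p}" by auto
  have inj: "inj_on (\<lambda>(y, g). g(Suc p := y)) (S \<times> ({1..p} \<rightarrow>\<^sub>E S))"
    by (rule inj_combinator) simp
  show ?thesis
    unfolding I PiE_insert_eq sum.reindex[OF inj] sum.cartesian_product
    by (intro sum.cong refl) auto
qed

text \<open>
  The product of the entries of the first \<open>p + 1\<close> cores along one assignment \<open>\<alpha>\<close> of values to the bonds.
  Summing over the closed bonds gives \<open>mps_left\<close>, the distributive law relating the paths of the
  definition of \<open>mps_vec\<close> to iterated matrix products.
\<close>

definition mps_path :: "nat \<Rightarrow> (core_entry \<Rightarrow> real) \<Rightarrow> nat \<Rightarrow> nat \<Rightarrow> (nat \<Rightarrow> nat) \<Rightarrow> real" where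
  "mps_path d G p h \<alpha> = G (First ((h div d ^ p) mod d) (\<alpha> 1)) *
     (\<Prod>q = 2..Suc p. G (Inner q (\<alpha> (q - 1)) ((h div d ^ (Suc p - q)) mod d) (\<alpha> q)))"

lemma mps_path_Suc:
  "mps_path d G (Suc p) h (\<alpha>(Suc (Suc p) := \<beta>)) =
    mps_path d G p (h div d) \<alpha> * G (Inner (p + 2) (\<alpha> (Suc p)) (h mod d) \<beta>)"
proof -
  define \<gamma> where "\<gamma> = \<alpha>(Suc (Suc p) := \<beta>)"
  have \<gamma>: "\<gamma> q = \<alpha> q" if "q \<le> Suc p" for q using that by (simp add: \<gamma>_def)
  have dd: "h div d div d ^ q = h div d ^ Suc q" for q by (simp add: div_mult2_eq)
  have "(\<Prod>q = 2..Suc (Suc p). G (Inner q (\<gamma> (q - 1)) ((h div d ^ (Suc (Suc p) - q)) mod d) (\<gamma> q))) =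
      (\<Prod>q = 2..Suc p. G (Inner q (\<gamma> (q - 1)) ((h div d ^ (Suc (Suc p) - q)) mod d) (\<gamma> q))) *
      G (Inner (p + 2) (\<alpha> (Suc p)) (h mod d) \<beta>)"
    by (subst prod.cl_ivl_Suc) (simp add: \<gamma>_def)
  also have "(\<Prod>q = 2..Suc p. G (Inner q (\<gamma> (q - 1)) ((h div d ^ (Suc (Suc p) - q)) mod d) (\<gamma> q))) =
      (\<Prod>q = 2..Suc p. G (Inner q (\<alpha> (q - 1)) ((h div d div d ^ (Suc p - q)) mod d) (\<alpha> q)))"
    by (intro prod.cong refl) (auto simp: dd \<gamma> Suc_diff_le simp del: power_Suc)
  finally show ?thesis
    unfolding mps_path_def \<gamma>_def[symmetric] dd by (simp only: mult.assoc \<gamma>)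
qed

lemma mps_left_eq_path_sum:
  assumes "h < d ^ (p + 1)"
  shows "mps_left d \<chi> G p h \<beta> = (\<Sum>\<alpha> \<in> {1..p} \<rightarrow>\<^sub>E {..<\<chi>}. mps_path d G p h (\<alpha>(Suc p := \<beta>)))"
  using assms
proof (induction p arbitrary: h \<beta>)
  case 0
  then show ?case by (simp add: mps_path_def)
next
  case (Suc p)
  have hd: "h div d < d ^ (p + 1)"
    using Suc.prems by (simp add: less_mult_imp_div_less mult.commute)
  have "mps_left d \<chi> G (Suc p) h \<beta> = (\<Sum>a<\<chi>. \<Sum>\<alpha> \<in> {1..p} \<rightarrow>\<^sub>E {..<\<chi>}.
      mps_path d G (Suc p) h (\<alpha>(Suc p := a, Suc (Suc p) := \<beta>)))"
    unfolding mps_path_Suc by (simp only: mps_left.simps Suc.IH[OF hd] sum_distrib_right fun_upd_same)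
  also have "\<dots> = (\<Sum>\<alpha> \<in> {1..Suc p} \<rightarrow>\<^sub>E {..<\<chi>}. mps_path d G (Suc p) h (\<alpha>(Suc (Suc p) := \<beta>)))"
    by (rule sum_PiE_atLeastAtMost_Suc[symmetric])
  finally show ?case .
qed

lemma mps_vec_eq_mps_left:
  assumes n: "n = p + 2" and I: "I < d ^ n"
  shows "mps_vec d n \<chi> G $ I = (\<Sum>\<alpha><\<chi>. mps_left d \<chi> G p (I div d) \<alpha> * G (Last \<alpha> (I mod d)))"
proof -
  have hd: "I div d < d ^ (p + 1)"
    using I n by (simp add: less_mult_imp_div_less mult.commute)
  have dd: "I div d div d ^ q = I div d ^ Suc q" for q by (simp add: div_mult2_eq)
  have path: "G (First (phys_index d n I 1) (\<alpha> 1)) *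
      (\<Prod>q = 2..Suc p. G (Inner q (\<alpha> (q - 1)) (phys_index d n I q) (\<alpha> q))) = mps_path d G p (I div d) \<alpha>" for \<alpha>
  proof -
    have "(\<Prod>q = 2..Suc p. G (Inner q (\<alpha> (q - 1)) (phys_index d n I q) (\<alpha> q))) =
      (\<Prod>q = 2..Suc p. G (Inner q (\<alpha> (q - 1)) ((I div d div d ^ (Suc p - q)) mod d) (\<alpha> q)))"
      unfolding dd phys_index_def n by (intro prod.cong refl) (auto simp: Suc_diff_le simp del: power_Suc)
    moreover have "phys_index d n I 1 = (I div d div d ^ p) mod d" by (simp add: phys_index_def n div_mult2_eq)
    ultimately show ?thesis by (simp only: mps_path_def)
  qed
  have "mps_vec d n \<chi> G $ I = (\<Sum>\<alpha> \<in> {1..Suc p} \<rightarrow>\<^sub>E {..<\<chi>}.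
      G (First (phys_index d n I 1) (\<alpha> 1)) *
      (\<Prod>q = 2..Suc p. G (Inner q (\<alpha> (q - 1)) (phys_index d n I q) (\<alpha> q))) *
      G (Last (\<alpha> (Suc p)) (phys_index d n I n)))"
    using I by (simp add: mps_vec_def n del: prod.cl_ivl_Suc)
  also have "\<dots> = (\<Sum>a<\<chi>. \<Sum>\<alpha> \<in> {1..p} \<rightarrow>\<^sub>E {..<\<chi>}. mps_path d G p (I div d) (\<alpha>(Suc p := a)) * G (Last a (I mod d)))"
    unfolding path sum_PiE_atLeastAtMost_Suc by (simp add: phys_index_def)
  also have "\<dots> = (\<Sum>\<alpha><\<chi>. mps_left d \<chi> G p (I div d) \<alpha> * G (Last \<alpha> (I mod d)))"
    by (simp add: mps_left_eq_path_sum[OF hd] sum_distrib_right)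
  finally show ?thesis .
qed

definition left_entries :: "nat \<Rightarrow> nat \<Rightarrow> nat \<Rightarrow> core_entry set" where
  "left_entries d \<chi> p = {First i \<alpha> | i \<alpha>. i < d \<and> \<alpha> < \<chi>} \<union>
     {Inner q \<alpha> i \<beta> | q \<alpha> i \<beta>. 1 < q \<and> q < p + 2 \<and> \<alpha> < \<chi> \<and> i < d \<and> \<beta> < \<chi>}"

definition inner_block :: "nat \<Rightarrow> nat \<Rightarrow> nat \<Rightarrow> core_entry set" where
  "inner_block d \<chi> q = {Inner q \<alpha> i \<beta> | \<alpha> i \<beta>. \<alpha> < \<chi> \<and> i < d \<and> \<beta> < \<chi>}"

abbreviation left_law :: "nat \<Rightarrow> nat \<Rightarrow> nat \<Rightarrow> (core_entry \<Rightarrow> real) measure" where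
  "left_law d \<chi> p \<equiv> Pi\<^sub>M (left_entries d \<chi> p) (entry_law \<chi>)"

lemma left_entries_Suc: "left_entries d \<chi> (Suc p) = left_entries d \<chi> p \<union> inner_block d \<chi> (p + 2)"
  by (auto simp: left_entries_def inner_block_def less_Suc_eq)

lemma inner_block_eq_image:
  "inner_block d \<chi> q = (\<lambda>(j, \<beta>). (\<lambda>(\<alpha>, i) \<beta>. Inner q \<alpha> i \<beta>) j \<beta>) ` (({..<\<chi>} \<times> {..<d}) \<times> {..<\<chi>})"
  by (auto simp: inner_block_def image_iff split_beta)

lemma first_block_eq_image: "left_entries d \<chi> 0 = (\<lambda>(i, \<alpha>). First i \<alpha>) ` ({..<d} \<times> {..<\<chi>})"
  by (auto simp: left_entries_def image_iff)

lemma finite_left_entries: "finite (left_entries d \<chi> p)"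
proof (induction p)
  case 0
  then show ?case by (simp add: first_block_eq_image)
next
  case (Suc p)
  then show ?case by (simp add: left_entries_Suc inner_block_eq_image)
qed

lemma core_entries_eq:
  "core_entries d (p + 2) \<chi> = left_entries d \<chi> p \<union> (\<lambda>(j, b). (\<lambda>(\<alpha>, i) (b :: nat). Last \<alpha> i) j b) ` (({..<\<chi>} \<times> {..<d}) \<times> {0})"
  by (auto simp: core_entries_def left_entries_def image_iff split_beta)

lemma mps_left_cong:
  assumes "\<And>e. e \<in> left_entries d \<chi> p \<Longrightarrow> G e = G' e" "h < d ^ (p + 1)" "\<beta> < \<chi>" "0 < d"
  shows "mps_left d \<chi> G p h \<beta> = mps_left d \<chi> G' p h \<beta>"
  using assms
proof (induction p arbitrary: h \<beta>)
  case 0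
  then show ?case by (auto simp: left_entries_def)
next
  case (Suc p)
  have hd: "h div d < d ^ (p + 1)"
    using Suc.prems by (simp add: less_mult_imp_div_less mult.commute)
  have "mps_left d \<chi> G p (h div d) \<alpha> = mps_left d \<chi> G' p (h div d) \<alpha>" if "\<alpha> < \<chi>" for \<alpha>
    using Suc.prems that by (intro Suc.IH hd) (auto simp: left_entries_Suc)
  moreover have "G (Inner (p + 2) \<alpha> (h mod d) \<beta>) = G' (Inner (p + 2) \<alpha> (h mod d) \<beta>)" if "\<alpha> < \<chi>" for \<alpha>
    using Suc.prems that by (intro Suc.prems(1)) (auto simp: left_entries_def)
  ultimately show ?case by simp
qed

lemma measurable_mps_left:
  assumes "left_entries d \<chi> p \<subseteq> E" "h < d ^ (p + 1)" "\<beta> < \<chi>" "0 < d"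
  shows "(\<lambda>G. mps_left d \<chi> G p h \<beta>) \<in> borel_measurable (Pi\<^sub>M E (entry_law \<chi>))"
  using assms
proof (induction p arbitrary: h \<beta>)
  case 0
  then show ?case by (auto simp: left_entries_def intro!: measurable_entry)
next
  case (Suc p)
  have hd: "h div d < d ^ (p + 1)"
    using Suc.prems by (simp add: less_mult_imp_div_less mult.commute)
  have "(\<lambda>G. mps_left d \<chi> G p (h div d) \<alpha>) \<in> borel_measurable (Pi\<^sub>M E (entry_law \<chi>))" if "\<alpha> < \<chi>" for \<alpha>
    using Suc.prems that by (intro Suc.IH hd) (auto simp: left_entries_Suc)
  moreover have "Inner (p + 2) \<alpha> (h mod d) \<beta> \<in> E" if "\<alpha> < \<chi>" for \<alpha>
    using Suc.prems that by (intro subsetD[OF Suc.prems(1)]) (auto simp: left_entries_def)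
  ultimately show ?case by (auto intro!: borel_measurable_sum borel_measurable_times measurable_entry)
qed

text \<open>
  The product of the first \<open>p + 1\<close> cores contracted with the vector \<open>x\<close> along their physical indices:
  \<open>\<beta>\<close> is the open bond, and \<open>lo < m\<close> encodes the physical indices that are still open.
\<close>

definition mps_contr :: "nat \<Rightarrow> nat \<Rightarrow> (core_entry \<Rightarrow> real) \<Rightarrow> (nat \<Rightarrow> real) \<Rightarrow> nat \<Rightarrow> nat \<Rightarrow> nat \<Rightarrow> nat \<Rightarrow> real" where
  "mps_contr d \<chi> G x p m \<beta> lo = (\<Sum>h<d ^ (p + 1). x (h * m + lo) * mps_left d \<chi> G p h \<beta>)"

lemma sum_lessThan_mult:
  fixes f :: "nat \<Rightarrow> 'a :: comm_monoid_add"
  shows "(\<Sum>I<a * b. f I) = (\<Sum>i<a. \<Sum>j<b. f (i * b + j))"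
proof -
  have "(\<Sum>j\<in>{i * b..<i * b + b}. f j) = (\<Sum>j<b. f (i * b + j))" for i
    using sum.shift_bounds_nat_ivl[of f 0 "i * b" b] by (simp add: add.commute atLeast0LessThan)
  then show ?thesis using sum.nat_group[of f b a] by simp
qed

lemma mps_contr_Suc:
  assumes "0 < d"
  shows "mps_contr d \<chi> G x (Suc p) m \<beta> lo =
    (\<Sum>(\<alpha>, i)\<in>{..<\<chi>} \<times> {..<d}. mps_contr d \<chi> G x p (d * m) \<alpha> (i * m + lo) * G (Inner (p + 2) \<alpha> i \<beta>))"
proof -
  have "mps_contr d \<chi> G x (Suc p) m \<beta> lo =
      (\<Sum>h<d ^ (p + 1). \<Sum>i<d. x ((h * d + i) * m + lo) * mps_left d \<chi> G (Suc p) (h * d + i) \<beta>)"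
  proof -
    have e: "d ^ (Suc p + 1) = d ^ (p + 1) * d" by simp
    show ?thesis unfolding mps_contr_def e by (rule sum_lessThan_mult)
  qed
  also have "\<dots> = (\<Sum>h<d ^ (p + 1). \<Sum>i<d. \<Sum>\<alpha><\<chi>.
      x (h * (d * m) + (i * m + lo)) * mps_left d \<chi> G p h \<alpha> * G (Inner (p + 2) \<alpha> i \<beta>))"
    using assms by (intro sum.cong refl) (simp add: sum_distrib_left algebra_simps)
  also have "\<dots> = (\<Sum>h<d ^ (p + 1). \<Sum>(\<alpha>, i)\<in>{..<\<chi>} \<times> {..<d}.
      x (h * (d * m) + (i * m + lo)) * mps_left d \<chi> G p h \<alpha> * G (Inner (p + 2) \<alpha> i \<beta>))"
    unfolding sum.cartesian_product[symmetric] by (intro sum.cong refl sum.swap)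
  also have "\<dots> = (\<Sum>(\<alpha>, i)\<in>{..<\<chi>} \<times> {..<d}. mps_contr d \<chi> G x p (d * m) \<alpha> (i * m + lo) * G (Inner (p + 2) \<alpha> i \<beta>))"
    unfolding mps_contr_def by (subst sum.swap) (auto intro!: sum.cong simp: sum_distrib_right)
  finally show ?thesis .
qed

lemma mps_vec_scalar_prod:
  assumes "0 < d" "n = p + 2"
  shows "(\<Sum>I<d ^ n. x I * mps_vec d n \<chi> G $ I) =
    (\<Sum>(\<alpha>, i)\<in>{..<\<chi>} \<times> {..<d}. mps_contr d \<chi> G x p d \<alpha> i * G (Last \<alpha> i))"
proof -
  have "(\<Sum>I<d ^ n. x I * mps_vec d n \<chi> G $ I) =
      (\<Sum>I<d ^ (p + 1) * d. x I * (\<Sum>\<alpha><\<chi>. mps_left d \<chi> G p (I div d) \<alpha> * G (Last \<alpha> (I mod d))))"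
    using assms by (intro sum.cong) (auto simp: mps_vec_eq_mps_left mult.commute)
  also have "\<dots> = (\<Sum>h<d ^ (p + 1). \<Sum>i<d. \<Sum>\<alpha><\<chi>. x (h * d + i) * mps_left d \<chi> G p h \<alpha> * G (Last \<alpha> i))"
    unfolding sum_lessThan_mult using assms by (intro sum.cong refl) (simp add: sum_distrib_left mult.assoc)
  also have "\<dots> = (\<Sum>h<d ^ (p + 1). \<Sum>(\<alpha>, i)\<in>{..<\<chi>} \<times> {..<d}. x (h * d + i) * mps_left d \<chi> G p h \<alpha> * G (Last \<alpha> i))"
    unfolding sum.cartesian_product[symmetric] by (intro sum.cong refl sum.swap)
  also have "\<dots> = (\<Sum>(\<alpha>, i)\<in>{..<\<chi>} \<times> {..<d}. mps_contr d \<chi> G x p d \<alpha> i * G (Last \<alpha> i))"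
    unfolding mps_contr_def by (subst sum.swap) (auto intro!: sum.cong simp: sum_distrib_right)
  finally show ?thesis .
qed

text \<open>
  Contracting the cores from left to right preserves the expected squared norm up to the
  normalization of the first core, and each contraction with an open bond of dimension \<open>\<chi>\<close>
  increases the second moment of the squared norm by a factor of at most \<open>1 + 2 / \<chi>\<close>.
\<close>

lemma mps_contr_moments:
  fixes x :: "nat \<Rightarrow> real"
  assumes \<chi>: "1 \<le> \<chi>" and d: "1 \<le> d"
  defines "F \<equiv> \<lambda>p m G. \<Sum>\<beta><\<chi>. \<Sum>lo<m. (mps_contr d \<chi> G x p m \<beta> lo)\<^sup>2"
  shows "(\<integral>\<^sup>+G. ennreal (F p m G) \<partial>left_law d \<chi> p) =
      ennreal (sqrt \<chi> * (\<Sum>I<d ^ (p + 1) * m. (x I)\<^sup>2))"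
    and "(\<integral>\<^sup>+G. ennreal ((F p m G)\<^sup>2) \<partial>left_law d \<chi> p) \<le>
      ennreal (\<chi> * (1 + 2 / \<chi>) ^ (p + 1) * (\<Sum>I<d ^ (p + 1) * m. (x I)\<^sup>2)\<^sup>2)"
proof -
  have "(\<integral>\<^sup>+G. ennreal (F p m G) \<partial>left_law d \<chi> p) =
      ennreal (sqrt \<chi> * (\<Sum>I<d ^ (p + 1) * m. (x I)\<^sup>2)) \<and>
    (\<integral>\<^sup>+G. ennreal ((F p m G)\<^sup>2) \<partial>left_law d \<chi> p) \<le>
      ennreal (\<chi> * (1 + 2 / \<chi>) ^ (p + 1) * (\<Sum>I<d ^ (p + 1) * m. (x I)\<^sup>2)\<^sup>2)"
  proof (induction p arbitrary: m)
    case 0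
    define s where "s = sqrt (1 / sqrt (real \<chi>))"
    have s: "0 < s" "s\<^sup>2 = 1 / sqrt \<chi>" using \<chi> by (auto simp: s_def)
    have s4: "s^4 = 1 / \<chi>"
    proof -
      have "s^4 = (s\<^sup>2)\<^sup>2" by (simp flip: power_mult)
      then show ?thesis using \<chi> by (simp add: s(2) power_divide)
    qed
    let ?P = "Pi\<^sub>M (left_entries d \<chi> 0) (\<lambda>_. gauss s)"
    have P: "left_law d \<chi> 0 = ?P"
      by (intro PiM_cong refl) (auto simp: first_block_eq_image s_def)
    have t: "(\<Sum>j<d. \<Sum>k<m. (x (j * m + k))\<^sup>2) = (\<Sum>I<d ^ (0 + 1) * m. (x I)\<^sup>2)"
      using sum_lessThan_mult[of "\<lambda>I. (x I)\<^sup>2" d m] by simp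
    have inj: "inj_on (\<lambda>(i, \<alpha>). First i \<alpha>) ({..<d} \<times> {..<\<chi>})" by (auto intro: inj_onI)
    note step = gaussian_contraction_moments[OF finite_lessThan finite_lessThan finite_lessThan s(1) inj
        first_block_eq_image, of "\<lambda>j k. x (j * m + k)" m, unfolded t]
    have F: "F 0 m G = (\<Sum>b<\<chi>. \<Sum>k<m. (\<Sum>j<d. x (j * m + k) * G (First j b))\<^sup>2)" for G
      by (simp add: F_def mps_contr_def)
    have F0: "0 \<le> F 0 m G" for G unfolding F_def by (intro sum_nonneg) auto
    have "(\<integral>\<^sup>+G. ennreal (F 0 m G) \<partial>?P) = ennreal (s\<^sup>2 * real (card {..<\<chi>}) * (\<Sum>I<d ^ (0 + 1) * m. (x I)\<^sup>2))"
      using step(1) F0 unfolding F by (subst nn_integral_eq_integral) (auto simp: has_bochner_integral_iff)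
    also have "s\<^sup>2 * real (card {..<\<chi>}) = sqrt \<chi>" using \<chi> by (simp add: s(2) real_div_sqrt)
    finally have 1: "(\<integral>\<^sup>+G. ennreal (F 0 m G) \<partial>?P) = ennreal (sqrt \<chi> * (\<Sum>I<d ^ (0 + 1) * m. (x I)\<^sup>2))" .
    have "(\<integral>\<^sup>+G. ennreal ((F 0 m G)\<^sup>2) \<partial>?P) = ennreal (\<integral>G. (F 0 m G)\<^sup>2 \<partial>?P)"
      using step(2) unfolding F by (intro nn_integral_eq_integral) auto
    also have "\<dots> \<le> ennreal (s^4 * ((real (card {..<\<chi>}))\<^sup>2 + 2 * real (card {..<\<chi>})) * (\<Sum>I<d ^ (0 + 1) * m. (x I)\<^sup>2)\<^sup>2)"
      using step(3) unfolding F by (intro ennreal_leI)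
    also have "s^4 * ((real (card {..<\<chi>}))\<^sup>2 + 2 * real (card {..<\<chi>})) = \<chi> * (1 + 2 / \<chi>) ^ (0 + 1)"
      using \<chi> by (simp add: s4 power2_eq_square field_simps)
    finally show ?case using 1 unfolding P by simp
  next
    case (Suc p)
    define s where "s = sqrt (1 / real \<chi>)"
    have s: "0 < s" "s\<^sup>2 = 1 / \<chi>" using \<chi> by (auto simp: s_def)
    have s4: "s^4 = 1 / \<chi>\<^sup>2"
    proof -
      have "s^4 = (s\<^sup>2)\<^sup>2" by (simp flip: power_mult)
      then show ?thesis by (simp add: s(2) power_divide)
    qed
    let ?J = "{..<\<chi>} \<times> {..<d}" and ?ent = "\<lambda>(\<alpha>, i) \<beta>. Inner (p + 2) \<alpha> i \<beta>"
    define T where "T G j lo = mps_contr d \<chi> G x p (d * m) (fst j) (snd j * m + lo)" for G j lo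
    have finJ: "finite ?J" by simp
    have inj: "inj_on (\<lambda>(j, \<beta>). ?ent j \<beta>) (?J \<times> {..<\<chi>})" by (auto intro!: inj_onI)
    have law: "sqrt (entry_variance \<chi> e) = s" if "e \<in> inner_block d \<chi> (p + 2)" for e
      using that by (auto simp: inner_block_def s_def)
    have disj: "left_entries d \<chi> p \<inter> inner_block d \<chi> (p + 2) = {}"
      by (auto simp: left_entries_def inner_block_def)
    have dep: "T G j k = T G' j k" if "\<And>e. e \<in> left_entries d \<chi> p \<Longrightarrow> G e = G' e" "j \<in> ?J" "k \<in> {..<m}" for G G' j k
    proof -
      have "mps_left d \<chi> G p h (fst j) = mps_left d \<chi> G' p h (fst j)" if "h < d ^ (p + 1)" for h
        using \<open>j \<in> ?J\<close> d that by (intro mps_left_cong \<open>\<And>e. e \<in> left_entries d \<chi> p \<Longrightarrow> G e = G' e\<close>) auto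
      then show ?thesis by (auto simp: T_def mps_contr_def intro!: sum.cong)
    qed
    have meas: "(\<lambda>G. T G j k) \<in> borel_measurable (left_law d \<chi> p)" if "j \<in> ?J" "k \<in> {..<m}" for j k
      using that d unfolding T_def mps_contr_def
      by (auto intro!: borel_measurable_sum borel_measurable_times measurable_mps_left)
    note step = integrate_out_gaussian_block[where T = T and K = "{..<m}", OF \<chi> finJ finite_lessThan finite_lessThan s(1) inj
        inner_block_eq_image finite_left_entries disj law dep meas, folded left_entries_Suc]
    have t: "(\<Sum>j\<in>?J. \<Sum>k<m. (T G j k)\<^sup>2) = F p (d * m) G" for G
      unfolding F_def sum_lessThan_mult
      using sum.cartesian_product[of "\<lambda>\<alpha> i. \<Sum>k<m. (mps_contr d \<chi> G x p (d * m) \<alpha> (i * m + k))\<^sup>2" "{..<d}" "{..<\<chi>}"]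
      by (simp add: T_def split_beta)
    have F: "(\<Sum>\<beta><\<chi>. \<Sum>k<m. (\<Sum>j\<in>?J. T G j k * G (?ent j \<beta>))\<^sup>2) = F (Suc p) m G" for G
      unfolding F_def using d by (simp add: T_def mps_contr_Suc split_beta)
    note step' = step[unfolded t F]
    have dm: "d ^ (p + 1) * (d * m) = d ^ (Suc p + 1) * m" by (simp add: mult_ac)
    note IH = Suc.IH[of "d * m", unfolded dm]
    have "s\<^sup>2 * real (card {..<\<chi>}) = 1" using \<chi> by (simp add: s(2))
    moreover have "s^4 * ((real (card {..<\<chi>}))\<^sup>2 + 2 * real (card {..<\<chi>})) = 1 + 2 / \<chi>"
      using \<chi> by (simp add: s4 power2_eq_square field_simps)
    ultimately have step1: "(\<integral>\<^sup>+G. ennreal (F (Suc p) m G) \<partial>left_law d \<chi> (Suc p)) =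
        (\<integral>\<^sup>+G. ennreal (F p (d * m) G) \<partial>left_law d \<chi> p)"
      and step2: "(\<integral>\<^sup>+G. ennreal ((F (Suc p) m G)\<^sup>2) \<partial>left_law d \<chi> (Suc p)) \<le>
        (\<integral>\<^sup>+G. ennreal ((1 + 2 / \<chi>) * (F p (d * m) G)\<^sup>2) \<partial>left_law d \<chi> p)"
      using step' by simp_all
    have Fm: "(\<lambda>G. F p (d * m) G) \<in> borel_measurable (left_law d \<chi> p)"
      unfolding t[symmetric] by (intro borel_measurable_sum borel_measurable_power meas)
    note step2
    also have "(\<integral>\<^sup>+G. ennreal ((1 + 2 / \<chi>) * (F p (d * m) G)\<^sup>2) \<partial>left_law d \<chi> p) =
        ennreal (1 + 2 / \<chi>) * (\<integral>\<^sup>+G. ennreal ((F p (d * m) G)\<^sup>2) \<partial>left_law d \<chi> p)"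
      using Fm by (simp add: ennreal_mult nn_integral_cmult)
    also have "\<dots> \<le> ennreal (1 + 2 / \<chi>) * ennreal (\<chi> * (1 + 2 / \<chi>) ^ (p + 1) * (\<Sum>I<d ^ (Suc p + 1) * m. (x I)\<^sup>2)\<^sup>2)"
      using IH by (intro mult_left_mono) auto
    also have "\<dots> = ennreal (\<chi> * (1 + 2 / \<chi>) ^ (Suc p + 1) * (\<Sum>I<d ^ (Suc p + 1) * m. (x I)\<^sup>2)\<^sup>2)"
      by (subst ennreal_mult[symmetric]) (auto simp: mult_ac)
    finally show ?case using step1 IH by simp
  qed
  then show "(\<integral>\<^sup>+G. ennreal (F p m G) \<partial>left_law d \<chi> p) =
      ennreal (sqrt \<chi> * (\<Sum>I<d ^ (p + 1) * m. (x I)\<^sup>2))"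
    "(\<integral>\<^sup>+G. ennreal ((F p m G)\<^sup>2) \<partial>left_law d \<chi> p) \<le>
      ennreal (\<chi> * (1 + 2 / \<chi>) ^ (p + 1) * (\<Sum>I<d ^ (p + 1) * m. (x I)\<^sup>2)\<^sup>2)"
    by blast+
qed

text \<open>
  The last core has no bond to its right, so it is a contraction with an open bond of dimension \<open>1\<close>,
  which accounts for the factor \<open>3 = 1 + 2 / 1\<close>; the variances \<open>1 / sqrt \<chi>\<close> of the first and the last
  core cancel the normalization.
\<close>

theorem mps_moments:
  fixes x :: "nat \<Rightarrow> real"
  assumes \<chi>: "1 \<le> \<chi>" and d: "1 \<le> d" and n: "2 \<le> n"
  shows "(\<integral>\<^sup>+G. ennreal ((\<Sum>I<d ^ n. x I * mps_vec d n \<chi> G $ I)\<^sup>2) \<partial>core_law d n \<chi>) = ennreal (\<Sum>I<d ^ n. (x I)\<^sup>2)"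
    and "(\<integral>\<^sup>+G. ennreal ((\<Sum>I<d ^ n. x I * mps_vec d n \<chi> G $ I)^4) \<partial>core_law d n \<chi>) \<le>
      ennreal (3 * (1 + 2 / \<chi>) ^ (n - 1) * (\<Sum>I<d ^ n. (x I)\<^sup>2)\<^sup>2)"
proof -
  obtain p where p: "n = p + 2" using n by (metis add.commute le_Suc_ex)
  define s where "s = sqrt (1 / sqrt (real \<chi>))"
  have s: "0 < s" "s\<^sup>2 = 1 / sqrt \<chi>" using \<chi> by (auto simp: s_def)
  have s4: "s^4 = 1 / \<chi>"
  proof -
    have "s^4 = (s\<^sup>2)\<^sup>2" by (simp flip: power_mult)
    then show ?thesis using \<chi> by (simp add: s(2) power_divide)
  qed
  let ?J = "{..<\<chi>} \<times> {..<d}" and ?ent = "\<lambda>(\<alpha>, i) (b :: nat). Last \<alpha> i"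
  define T where "T G j (k :: nat) = mps_contr d \<chi> G x p d (fst j) (snd j)" for G j k
  have finJ: "finite ?J" by simp
  let ?E = "(\<lambda>(j, b). ?ent j b) ` (?J \<times> {0})"
  let ?X = "\<Sum>I<d ^ n. (x I)\<^sup>2"
  have inj: "inj_on (\<lambda>(j, b). ?ent j b) (?J \<times> {0})" by (auto intro!: inj_onI)
  have law: "sqrt (entry_variance \<chi> e) = s" if "e \<in> ?E" for e
    using that by (auto simp: s_def)
  have disj: "left_entries d \<chi> p \<inter> ?E = {}" by (auto simp: left_entries_def)
  have dep: "T G j k = T G' j k" if "\<And>e. e \<in> left_entries d \<chi> p \<Longrightarrow> G e = G' e" "j \<in> ?J" "k \<in> {0}" for G G' j k
  proof -
    have "mps_left d \<chi> G p h (fst j) = mps_left d \<chi> G' p h (fst j)" if "h < d ^ (p + 1)" for h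
      using \<open>j \<in> ?J\<close> d that by (intro mps_left_cong \<open>\<And>e. e \<in> left_entries d \<chi> p \<Longrightarrow> G e = G' e\<close>) auto
    then show ?thesis by (auto simp: T_def mps_contr_def intro!: sum.cong)
  qed
  have meas: "(\<lambda>G. T G j k) \<in> borel_measurable (left_law d \<chi> p)" if "j \<in> ?J" "k \<in> {0}" for j k
    using that d unfolding T_def mps_contr_def
    by (auto intro!: borel_measurable_sum borel_measurable_times measurable_mps_left)
  define F where "F G = (\<Sum>\<beta><\<chi>. \<Sum>lo<d. (mps_contr d \<chi> G x p d \<beta> lo)\<^sup>2)" for G
  have t: "(\<Sum>j\<in>?J. \<Sum>k\<in>{0}. (T G j k)\<^sup>2) = F G" for G
    unfolding F_def
    using sum.cartesian_product[of "\<lambda>\<alpha> i. (mps_contr d \<chi> G x p d \<alpha> i)\<^sup>2" "{..<d}" "{..<\<chi>}"]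
    by (simp add: T_def split_beta)
  have Q: "(\<Sum>b\<in>{0::nat}. \<Sum>k\<in>{0::nat}. (\<Sum>j\<in>?J. T G j k * G (?ent j b))\<^sup>2) = (\<Sum>I<d ^ n. x I * mps_vec d n \<chi> G $ I)\<^sup>2" for G
    using d by (simp add: T_def mps_vec_scalar_prod[OF _ p] split_beta)
  have M: "core_law d n \<chi> = Pi\<^sub>M (left_entries d \<chi> p \<union> ?E) (entry_law \<chi>)"
    unfolding core_law_def p core_entries_eq ..
  have Fm: "F \<in> borel_measurable (left_law d \<chi> p)"
    unfolding t[abs_def, symmetric] by (intro borel_measurable_sum borel_measurable_power meas)
  note step = integrate_out_gaussian_block[where T = T and K = "{0}", OF \<chi> finJ _ _ s(1) inj refl finite_left_entries disj law dep meas,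
      unfolded t Q, folded M]
  note mom = mps_contr_moments[where x = x and p = p and m = d, OF \<chi> d, folded F_def]
  have dp: "d ^ (p + 1) * d = d ^ n" by (simp add: p)
  have "(\<integral>\<^sup>+G. ennreal ((\<Sum>I<d ^ n. x I * mps_vec d n \<chi> G $ I)\<^sup>2) \<partial>core_law d n \<chi>) =
      (\<integral>\<^sup>+G. ennreal (1 / sqrt \<chi> * F G) \<partial>left_law d \<chi> p)"
    using step(1) by (simp add: s(2))
  also have "\<dots> = ennreal (1 / sqrt \<chi>) * ennreal (sqrt \<chi> * ?X)"
  proof -
    have "ennreal (1 / sqrt \<chi> * F G) = ennreal (1 / sqrt \<chi>) * ennreal (F G)" for G
      by (rule ennreal_mult') simp
    then show ?thesis using Fm mom(1) unfolding dp by (simp only:) (subst nn_integral_cmult, auto)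
  qed
  also have "\<dots> = ennreal ?X"
    using \<chi> by (subst ennreal_mult'[symmetric]) auto
  finally show "(\<integral>\<^sup>+G. ennreal ((\<Sum>I<d ^ n. x I * mps_vec d n \<chi> G $ I)\<^sup>2) \<partial>core_law d n \<chi>) = ennreal ?X" .
  have "(\<integral>\<^sup>+G. ennreal ((\<Sum>I<d ^ n. x I * mps_vec d n \<chi> G $ I)^4) \<partial>core_law d n \<chi>) \<le>
      (\<integral>\<^sup>+G. ennreal (3 / \<chi> * (F G)\<^sup>2) \<partial>left_law d \<chi> p)"
    using step(2) by (simp add: s4 flip: power_mult)
  also have "\<dots> = ennreal (3 / \<chi>) * (\<integral>\<^sup>+G. ennreal ((F G)\<^sup>2) \<partial>left_law d \<chi> p)"
  proof -
    have "ennreal (3 / \<chi> * (F G)\<^sup>2) = ennreal (3 / \<chi>) * ennreal ((F G)\<^sup>2)" for G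
      by (rule ennreal_mult') simp
    then show ?thesis using Fm by (simp only:) (subst nn_integral_cmult, auto)
  qed
  also have "\<dots> \<le> ennreal (3 / \<chi>) * ennreal (\<chi> * (1 + 2 / \<chi>) ^ (p + 1) * ?X\<^sup>2)"
    using mom(2) unfolding dp by (intro mult_left_mono) auto
  also have "\<dots> = ennreal (3 * (1 + 2 / \<chi>) ^ (n - 1) * ?X\<^sup>2)"
    using \<chi> p by (subst ennreal_mult[symmetric]) auto
  finally show "(\<integral>\<^sup>+G. ennreal ((\<Sum>I<d ^ n. x I * mps_vec d n \<chi> G $ I)^4) \<partial>core_law d n \<chi>) \<le>
      ennreal (3 * (1 + 2 / \<chi>) ^ (n - 1) * ?X\<^sup>2)" .
qed

section \<open>Injectivity on a subspace from fourth moments\<close>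

text \<open>
  Rounding one coordinate after the other to the grid \<open>s \<int>\<close>, always in the direction in which the
  linear term of the quadratic form does not increase, costs only the trace of the form.
\<close>

lemma grid_rounding:
  fixes z :: "nat \<Rightarrow> 'j \<Rightarrow> real" and v :: "nat \<Rightarrow> real"
  assumes s: "0 < s"
  shows "\<exists>m :: nat \<Rightarrow> int. (\<forall>i<r. \<bar>s * m i - v i\<bar> \<le> s) \<and>
    (\<Sum>j\<in>S. (\<Sum>i<r. s * m i * z i j)\<^sup>2) \<le> (\<Sum>j\<in>S. (\<Sum>i<r. v i * z i j)\<^sup>2) + s\<^sup>2 * (\<Sum>j\<in>S. \<Sum>i<r. (z i j)\<^sup>2)"
proof -
  have "\<exists>m :: nat \<Rightarrow> int. (\<forall>i<t. \<bar>s * m i - v i\<bar> \<le> s) \<and>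
    (\<Sum>j\<in>S. ((\<Sum>i<t. s * m i * z i j) + c j)\<^sup>2) \<le>
    (\<Sum>j\<in>S. ((\<Sum>i<t. v i * z i j) + c j)\<^sup>2) + s\<^sup>2 * (\<Sum>j\<in>S. \<Sum>i<t. (z i j)\<^sup>2)" for t c
  proof (induction t arbitrary: c)
    case 0
    then show ?case by simp
  next
    case (Suc t)
    obtain m :: "nat \<Rightarrow> int" where m: "\<And>i. i < t \<Longrightarrow> \<bar>s * m i - v i\<bar> \<le> s"
      "(\<Sum>j\<in>S. ((\<Sum>i<t. s * m i * z i j) + (v t * z t j + c j))\<^sup>2) \<le>
       (\<Sum>j\<in>S. ((\<Sum>i<t. v i * z i j) + (v t * z t j + c j))\<^sup>2) + s\<^sup>2 * (\<Sum>j\<in>S. \<Sum>i<t. (z i j)\<^sup>2)"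
      using Suc.IH[of "\<lambda>j. v t * z t j + c j"] by blast
    define y where "y j = (\<Sum>i<t. s * m i * z i j) + (v t * z t j + c j)" for j
    define b where "b = (\<Sum>j\<in>S. y j * z t j)"
    define k where "k = (if 0 \<le> b then \<lfloor>v t / s\<rfloor> else \<lfloor>v t / s\<rfloor> + 1)"
    define \<delta> where "\<delta> = s * k - v t"
    have fl: "s * \<lfloor>v t / s\<rfloor> \<le> v t" "v t < s * (\<lfloor>v t / s\<rfloor> + 1)"
    proof -
      have "real_of_int \<lfloor>v t / s\<rfloor> \<le> v t / s" "v t / s < real_of_int \<lfloor>v t / s\<rfloor> + 1" by linarith+
      then show "s * \<lfloor>v t / s\<rfloor> \<le> v t" "v t < s * (\<lfloor>v t / s\<rfloor> + 1)"
        using pos_le_divide_eq[OF s, of "real_of_int \<lfloor>v t / s\<rfloor>" "v t"]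
          pos_divide_less_eq[OF s, of "v t" "real_of_int \<lfloor>v t / s\<rfloor> + 1"] by (simp_all add: mult.commute)
    qed
    have \<delta>: "\<bar>\<delta>\<bar> \<le> s" "\<delta> * b \<le> 0"
    proof -
      have sfl: "s * (\<lfloor>v t / s\<rfloor> + 1) = s * \<lfloor>v t / s\<rfloor> + s" by (simp add: distrib_left)
      show "\<bar>\<delta>\<bar> \<le> s"
        using fl sfl by (cases "0 \<le> b") (simp_all add: \<delta>_def k_def abs_le_iff distrib_left)
      show "\<delta> * b \<le> 0"
      proof (cases "0 \<le> b")
        case True
        then have "\<delta> \<le> 0" using fl by (simp add: \<delta>_def k_def)
        then show ?thesis using True by (rule mult_nonpos_nonneg)
      next
        case False
        then have "0 \<le> \<delta>" using fl by (simp add: \<delta>_def k_def)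
        then show ?thesis using False by (intro mult_nonneg_nonpos) auto
      qed
    qed
    have \<delta>2: "\<delta>\<^sup>2 \<le> s\<^sup>2" using \<delta>(1) s abs_le_square_iff[of \<delta> s] by simp
    show ?case
    proof (intro exI[of _ "m(t := k)"] conjI allI impI)
      show "\<bar>s * (m(t := k)) i - v i\<bar> \<le> s" if "i < Suc t" for i
        using that m(1) \<delta>(1) by (auto simp: less_Suc_eq \<delta>_def)
      have "(\<Sum>j\<in>S. ((\<Sum>i<Suc t. s * (m(t := k)) i * z i j) + c j)\<^sup>2) = (\<Sum>j\<in>S. (y j + \<delta> * z t j)\<^sup>2)"
        by (intro sum.cong refl) (simp add: y_def \<delta>_def algebra_simps)
      also have "\<dots> = (\<Sum>j\<in>S. (y j)\<^sup>2) + 2 * (\<delta> * b) + \<delta>\<^sup>2 * (\<Sum>j\<in>S. (z t j)\<^sup>2)"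
        by (simp add: b_def power2_sum power_mult_distrib sum.distrib sum_distrib_left mult_ac)
      also have "\<dots> \<le> (\<Sum>j\<in>S. (y j)\<^sup>2) + 0 + s\<^sup>2 * (\<Sum>j\<in>S. (z t j)\<^sup>2)"
        using \<delta>(2) \<delta>2 by (intro add_mono mult_right_mono order_refl sum_nonneg) auto
      also have "\<dots> \<le> (\<Sum>j\<in>S. ((\<Sum>i<t. v i * z i j) + (v t * z t j + c j))\<^sup>2) +
          s\<^sup>2 * (\<Sum>j\<in>S. \<Sum>i<t. (z i j)\<^sup>2) + s\<^sup>2 * (\<Sum>j\<in>S. (z t j)\<^sup>2)"
        using m(2) by (simp add: y_def)
      also have "\<dots> = (\<Sum>j\<in>S. ((\<Sum>i<Suc t. v i * z i j) + c j)\<^sup>2) + s\<^sup>2 * (\<Sum>j\<in>S. \<Sum>i<Suc t. (z i j)\<^sup>2)"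
        by (simp add: sum.distrib algebra_simps)
      finally show "(\<Sum>j\<in>S. ((\<Sum>i<Suc t. s * (m(t := k)) i * z i j) + c j)\<^sup>2) \<le>
          (\<Sum>j\<in>S. ((\<Sum>i<Suc t. v i * z i j) + c j)\<^sup>2) + s\<^sup>2 * (\<Sum>j\<in>S. \<Sum>i<Suc t. (z i j)\<^sup>2)" .
    qed
  qed
  from this[of r "\<lambda>_. 0"] show ?thesis by simp
qed

lemma sum_half_power_abs_le:
  "(\<Sum>j\<in>{- int K..int K}. (1 / 2 :: real) ^ nat \<bar>j\<bar>) \<le> 3"
proof -
  have "(\<Sum>j\<in>{- int K..int K}. (1 / 2 :: real) ^ nat \<bar>j\<bar>) = 3 - 2 * (1 / 2) ^ K"
  proof (induction K)
    case (Suc K)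
    have "{- int (Suc K)..int (Suc K)} = insert (- int (Suc K)) (insert (int (Suc K)) {- int K..int K})" by auto
    moreover have "nat (int K + 1) = Suc K" "nat (1 + int K) = Suc K" by auto
    ultimately show ?case using Suc by simp
  qed simp
  then show ?thesis by simp
qed

definition grid_net :: "nat \<Rightarrow> nat \<Rightarrow> (nat \<Rightarrow> int) set" where
  "grid_net r K = {m \<in> {..<r} \<rightarrow>\<^sub>E {- int K..int K}. (\<Sum>i<r. nat \<bar>m i\<bar>) \<le> K}"

lemma finite_grid_net: "finite (grid_net r K)"
  unfolding grid_net_def by (auto intro!: finite_subset[OF _ finite_PiE[of "{..<r}" "\<lambda>_. {- int K..int K}"]])

text \<open>Counting lattice points by the generating function \<open>\<Sum> 2\<^sup>-\<^sup>|\<^sup>m\<^sup>|\<close>.\<close>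

lemma card_grid_net: "real (card (grid_net r K)) \<le> 2 ^ (2 * r + K)"
proof -
  have "real (card (grid_net r K)) * (1 / 2) ^ K = (\<Sum>m\<in>grid_net r K. (1 / 2) ^ K)" by simp
  also have "\<dots> \<le> (\<Sum>m\<in>grid_net r K. \<Prod>i<r. (1 / 2) ^ nat \<bar>m i\<bar>)"
  proof (rule sum_mono)
    fix m assume "m \<in> grid_net r K"
    then have "(1 / 2 :: real) ^ K \<le> (1 / 2) ^ (\<Sum>i<r. nat \<bar>m i\<bar>)"
      by (intro power_decreasing) (auto simp: grid_net_def)
    then show "(1 / 2 :: real) ^ K \<le> (\<Prod>i<r. (1 / 2) ^ nat \<bar>m i\<bar>)" by (simp add: power_sum)
  qed
  also have "\<dots> \<le> (\<Sum>m\<in>{..<r} \<rightarrow>\<^sub>E {- int K..int K}. \<Prod>i<r. (1 / 2) ^ nat \<bar>m i\<bar>)"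
    by (intro sum_mono2 finite_PiE prod_nonneg) (auto simp: grid_net_def)
  also have "\<dots> = (\<Prod>i<r. \<Sum>j\<in>{- int K..int K}. (1 / 2) ^ nat \<bar>j\<bar>)"
    by (subst prod_sum_PiE) auto
  also have "\<dots> \<le> (\<Prod>i<r. 4)"
    using sum_half_power_abs_le[of K] by (intro prod_mono) (auto intro: sum_nonneg order_trans)
  also have "\<dots> = 2 ^ (2 * r)" by (simp add: power_mult)
  finally show ?thesis by (simp add: power_add power_divide field_simps)
qed

lemma exp_minus_le_quadratic: "0 \<le> t \<Longrightarrow> exp (- t) \<le> 1 - t + t\<^sup>2 / (2 :: real)"
proof -
  assume t: "0 \<le> t"
  define f where "f = (\<lambda>t :: real. 1 - t + t\<^sup>2 / 2 - exp (- t))"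
  have "f 0 \<le> f t"
  proof (rule DERIV_nonneg_imp_nondecreasing[OF t])
    fix x :: real
    have "(f has_real_derivative (- 1 + x + exp (- x))) (at x)"
      unfolding f_def by (auto intro!: derivative_eq_intros)
    moreover have "0 \<le> - 1 + x + exp (- x)" using exp_ge_add_one_self[of "- x"] by simp
    ultimately show "\<exists>y. (f has_real_derivative y) (at x) \<and> 0 \<le> y" by blast
  qed
  then show ?thesis by (simp add: f_def)
qed

context
  fixes \<mu> :: "'a measure" and k :: nat
  assumes prob: "prob_space \<mu>"
begin

interpretation \<mu>: prob_space \<mu> by (rule prob)

abbreviation samples :: "(nat \<Rightarrow> 'a) measure" where
  "samples \<equiv> Pi\<^sub>M {..<k} (\<lambda>_. \<mu>)"

lemma prob_space_samples: "prob_space samples"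
  by (intro prob_space_PiM prob)

lemma nn_integral_sample:
  assumes "finite I" "j \<in> I" "f \<in> borel_measurable \<mu>"
  shows "(\<integral>\<^sup>+\<omega>. f (\<omega> j) \<partial>Pi\<^sub>M I (\<lambda>_. \<mu>)) = (\<integral>\<^sup>+x. f x \<partial>\<mu>)"
proof -
  have "(\<integral>\<^sup>+x. f x \<partial>\<mu>) = (\<integral>\<^sup>+x. f x \<partial>distr (Pi\<^sub>M I (\<lambda>_. \<mu>)) \<mu> (\<lambda>\<omega>. \<omega> j))"
    using distr_PiM_component[of I "\<lambda>_. \<mu>" j] assms prob by simp
  also have "\<dots> = (\<integral>\<^sup>+\<omega>. f (\<omega> j) \<partial>Pi\<^sub>M I (\<lambda>_. \<mu>))"
    using assms by (intro nn_integral_distr) auto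
  finally show ?thesis by simp
qed

text \<open>
  The first two moments of the squares alone control the lower tail of their sum, because \<open>exp (- t) \<le> 1 - t + t\<^sup>2 / 2\<close> for \<open>t \<ge> 0\<close>.
\<close>

lemma lower_tail_squares:
  fixes L :: "'a \<Rightarrow> real"
  assumes meas[measurable]: "L \<in> borel_measurable \<mu>" and \<theta>: "0 < \<theta>" and h: "0 \<le> h"
    and m2: "(\<integral>\<^sup>+x. ennreal ((L x)\<^sup>2) \<partial>\<mu>) = ennreal a" and a: "0 \<le> a"
    and m4: "(\<integral>\<^sup>+x. ennreal ((L x)^4) \<partial>\<mu>) \<le> ennreal (h * a\<^sup>2)"
  shows "measure samples {\<omega> \<in> space samples. (\<Sum>j<k. (L (\<omega> j))\<^sup>2) \<le> k * (a - \<theta> * h * a\<^sup>2 / 2) - \<tau> / \<theta>} \<le> exp (- \<tau>)"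
proof -
  interpret S: prob_space samples by (rule prob_space_samples)
  interpret product_sigma_finite "\<lambda>_ :: nat. \<mu>" by standard
  define c where "c = - \<theta> * (a - \<theta> * h * a\<^sup>2 / 2)"
  have i2: "integrable \<mu> (\<lambda>x. (L x)\<^sup>2)" "(\<integral>x. (L x)\<^sup>2 \<partial>\<mu>) = a"
    using m2 a by (auto intro!: integrableI_nn_integral_finite[of _ _ a] simp: integral_eq_nn_integral)
  have i4: "integrable \<mu> (\<lambda>x. (L x)^4)"
    using m4 by (intro integrableI_bounded) (auto simp: top.extremum_strict ennreal_less_top intro: le_less_trans)
  have i4': "(\<integral>x. (L x)^4 \<partial>\<mu>) \<le> h * a\<^sup>2"
    using m4 h unfolding nn_integral_eq_integral[OF i4, simplified] by (simp add: ennreal_le_iff)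
  have ie: "integrable \<mu> (\<lambda>x. exp (- \<theta> * (L x)\<^sup>2))"
    using \<theta> by (intro \<mu>.integrable_const_bound[of _ 1]) auto
  have "(\<integral>x. exp (- \<theta> * (L x)\<^sup>2) \<partial>\<mu>) \<le> (\<integral>x. 1 - \<theta> * (L x)\<^sup>2 + \<theta>\<^sup>2 / 2 * (L x)^4 \<partial>\<mu>)"
  proof (rule integral_mono[OF ie])
    show "integrable \<mu> (\<lambda>x. 1 - \<theta> * (L x)\<^sup>2 + \<theta>\<^sup>2 / 2 * (L x)^4)" using i2 i4 by simp
    show "exp (- \<theta> * (L x)\<^sup>2) \<le> 1 - \<theta> * (L x)\<^sup>2 + \<theta>\<^sup>2 / 2 * (L x)^4" for x
      using exp_minus_le_quadratic[of "\<theta> * (L x)\<^sup>2"] \<theta> by (simp add: power_mult_distrib flip: power_mult)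
  qed
  also have "\<dots> = 1 - \<theta> * a + \<theta>\<^sup>2 / 2 * (\<integral>x. (L x)^4 \<partial>\<mu>)"
    using i2 i4 by (simp add: \<mu>.prob_space)
  also have "\<dots> \<le> 1 - \<theta> * a + \<theta>\<^sup>2 / 2 * (h * a\<^sup>2)"
    using i4' by (intro add_left_mono mult_left_mono) auto
  also have "\<dots> = 1 + c" by (simp add: c_def algebra_simps power2_eq_square)
  also have "\<dots> \<le> exp c" by (rule exp_ge_add_one_self)
  finally have mgf: "(\<integral>\<^sup>+x. ennreal (exp (- \<theta> * (L x)\<^sup>2)) \<partial>\<mu>) \<le> ennreal (exp c)"
    using nn_integral_eq_integral[OF ie] by (simp add: ennreal_leI)
  define X where "X \<omega> = exp (- \<theta> * (\<Sum>j<k. (L (\<omega> j))\<^sup>2))" for \<omega>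
  have X[measurable]: "X \<in> borel_measurable samples" unfolding X_def by measurable
  have "(\<integral>\<^sup>+\<omega>. ennreal (X \<omega>) \<partial>samples) = (\<integral>\<^sup>+\<omega>. (\<Prod>j<k. ennreal (exp (- \<theta> * (L (\<omega> j))\<^sup>2))) \<partial>samples)"
    by (simp add: X_def prod_ennreal sum_distrib_left sum_negf[symmetric] exp_sum)
  also have "\<dots> = (\<Prod>j<k. \<integral>\<^sup>+x. ennreal (exp (- \<theta> * (L x)\<^sup>2)) \<partial>\<mu>)"
    by (intro product_nn_integral_prod) auto
  also have "\<dots> \<le> (\<Prod>j<k. ennreal (exp c))" by (intro prod_mono_ennreal mgf)
  also have "\<dots> = ennreal (exp (k * c))" by (simp add: ennreal_power exp_of_nat_mult)
  finally have E: "(\<integral>\<^sup>+\<omega>. ennreal (X \<omega>) \<partial>samples) \<le> ennreal (exp (k * c))" .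
  let ?e = "ennreal (exp (- (k * c + \<tau>)))"
  let ?A = "{\<omega> \<in> space samples. (\<Sum>j<k. (L (\<omega> j))\<^sup>2) \<le> k * (a - \<theta> * h * a\<^sup>2 / 2) - \<tau> / \<theta>}"
  have "emeasure samples ?A \<le> emeasure samples {\<omega> \<in> space samples. 1 \<le> ?e * ennreal (X \<omega>)}"
  proof (rule emeasure_mono)
    show "?A \<subseteq> {\<omega> \<in> space samples. 1 \<le> ?e * ennreal (X \<omega>)}"
    proof safe
      fix \<omega> assume le: "(\<Sum>j<k. (L (\<omega> j))\<^sup>2) \<le> k * (a - \<theta> * h * a\<^sup>2 / 2) - \<tau> / \<theta>"
      have "\<theta> * (\<Sum>j<k. (L (\<omega> j))\<^sup>2) \<le> \<theta> * (k * (a - \<theta> * h * a\<^sup>2 / 2) - \<tau> / \<theta>)"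
        using le \<theta> by (intro mult_left_mono) auto
      also have "\<dots> = - (k * c + \<tau>)" using \<theta> by (simp add: c_def algebra_simps)
      finally have "1 \<le> exp (- (k * c + \<tau>)) * X \<omega>"
        by (simp add: X_def exp_add[symmetric])
      then show "1 \<le> ?e * ennreal (X \<omega>)" by (subst ennreal_mult[symmetric]) (auto simp: X_def)
    qed
  qed measurable
  also have "\<dots> \<le> ?e * (\<integral>\<^sup>+\<omega>\<in>space samples. ennreal (X \<omega>) \<partial>samples)"
    by (intro nn_integral_Markov_inequality) auto
  also have "(\<integral>\<^sup>+\<omega>\<in>space samples. ennreal (X \<omega>) \<partial>samples) = (\<integral>\<^sup>+\<omega>. ennreal (X \<omega>) \<partial>samples)"
    by (intro nn_integral_cong) auto
  also have "?e * \<dots> \<le> ?e * ennreal (exp (k * c))" using E by (intro mult_left_mono) auto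
  also have "\<dots> = ennreal (exp (- \<tau>))"
    by (subst ennreal_mult[symmetric]) (auto simp: exp_add[symmetric])
  finally show ?thesis by (simp add: S.emeasure_eq_measure)
qed

lemma markov_above:
  assumes X: "X \<in> borel_measurable samples" and X0: "\<And>\<omega>. 0 \<le> X \<omega>"
    and E: "(\<integral>\<^sup>+\<omega>. ennreal (X \<omega>) \<partial>samples) \<le> ennreal c" and c: "0 \<le> c" and b: "0 < b"
  shows "measure samples {\<omega> \<in> space samples. b * c < X \<omega>} \<le> 1 / b"
proof -
  interpret S: prob_space samples by (rule prob_space_samples)
  note X[measurable]
  show ?thesis
  proof (cases "c = 0")
    case True
    then have "(\<integral>\<^sup>+\<omega>. ennreal (X \<omega>) \<partial>samples) = 0" using E by simp
    then have "AE \<omega> in samples. X \<omega> = 0" using X0 by (simp add: nn_integral_0_iff_AE)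
    then have "AE \<omega> in samples. \<omega> \<notin> {\<omega> \<in> space samples. b * c < X \<omega>}" using True by auto
    then have "measure samples {\<omega> \<in> space samples. b * c < X \<omega>} = 0"
      by (intro S.prob_eq_0[THEN iffD2]) measurable
    then show ?thesis using b by simp
  next
    case False
    then have c: "0 < c" using c by simp
    have "emeasure samples {\<omega> \<in> space samples. b * c < X \<omega>} \<le>
        emeasure samples ({\<omega> \<in> space samples. 1 \<le> ennreal (1 / (b * c)) * ennreal (X \<omega>)})"
    proof (rule emeasure_mono)
      show "{\<omega> \<in> space samples. b * c < X \<omega>} \<subseteq>
        {\<omega> \<in> space samples. 1 \<le> ennreal (1 / (b * c)) * ennreal (X \<omega>)}"
      proof safe
        fix \<omega> assume "b * c < X \<omega>"
        then have "1 \<le> 1 / (b * c) * X \<omega>" using b c by (simp add: field_simps)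
        then show "1 \<le> ennreal (1 / (b * c)) * ennreal (X \<omega>)"
          using b c X0 by (subst ennreal_mult[symmetric]) auto
      qed
    qed measurable
    also have "\<dots> \<le> ennreal (1 / (b * c)) * (\<integral>\<^sup>+\<omega>\<in>space samples. ennreal (X \<omega>) \<partial>samples)"
      by (intro nn_integral_Markov_inequality) auto
    also have "(\<integral>\<^sup>+\<omega>\<in>space samples. ennreal (X \<omega>) \<partial>samples) = (\<integral>\<^sup>+\<omega>. ennreal (X \<omega>) \<partial>samples)"
      by (intro nn_integral_cong) auto
    also have "ennreal (1 / (b * c)) * \<dots> \<le> ennreal (1 / (b * c)) * ennreal c"
      using E by (intro mult_left_mono) auto
    also have "\<dots> = ennreal (1 / b)"
      using b c by (subst ennreal_mult[symmetric]) auto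
    finally show ?thesis using b by (simp add: S.emeasure_eq_measure)
  qed
qed

end

text \<open>
  A net of grid points of \<open>\<ell>\<^sub>1\<close> norm \<open>O(r)\<close> on the scale \<open>1 / sqrt r\<close> has only \<open>exp (O(r))\<close> points,
  so that the lower tail bound survives the union bound once \<open>k\<close> is a large multiple of \<open>h r\<close>.
  Some rounding of an arbitrary unit vector to the net increases the form by at most the
  \<open>s\<^sup>2\<close>-fold trace, which Markov's inequality bounds. With \<open>s = 1 / (100 sqrt r)\<close> the rounded vector
  has squared length between \<open>0.98\<close> and \<open>1.03\<close>.
\<close>

theorem subspace_injection:
  fixes Z :: "nat \<Rightarrow> 'a \<Rightarrow> real"
  assumes prob: "prob_space \<mu>" and r: "1 \<le> r" and h: "1 \<le> h"
    and meas: "\<And>i. i < r \<Longrightarrow> Z i \<in> borel_measurable \<mu>"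
    and m2: "\<And>u. (\<integral>\<^sup>+x. ennreal ((\<Sum>i<r. u i * Z i x)\<^sup>2) \<partial>\<mu>) = ennreal (\<Sum>i<r. (u i)\<^sup>2)"
    and m4: "\<And>u. (\<integral>\<^sup>+x. ennreal ((\<Sum>i<r. u i * Z i x)^4) \<partial>\<mu>) \<le> ennreal (h * (\<Sum>i<r. (u i)\<^sup>2)\<^sup>2)"
    and k: "2300 * h * real r \<le> real k"
  obtains G where "G \<in> sets (samples \<mu> k)" "measure (samples \<mu> k) (space (samples \<mu> k) - G) \<le> 2 / 1000"
    "\<And>\<omega> x. \<omega> \<in> G \<Longrightarrow> real k / 2 * (\<Sum>i<r. (x i)\<^sup>2) \<le> (\<Sum>j<k. (\<Sum>i<r. x i * Z i (\<omega> j))\<^sup>2)"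
proof -
  let ?S = "samples \<mu> k"
  interpret S: prob_space ?S by (rule prob_space_samples[OF prob])
  define s where "s = 1 / (100 * sqrt r)"
  have s: "0 < s" "s\<^sup>2 * r = 1 / 10000" using r by (simp_all add: s_def power_divide power_mult_distrib)
  define \<theta> where "\<theta> = 1 / (2 * h)"
  have \<theta>: "0 < \<theta>" using h by (simp add: \<theta>_def)
  define \<tau> where "\<tau> = real (103 * r) + 10"
  define N where "N = {m \<in> grid_net r (101 * r). 0.98 \<le> (\<Sum>i<r. (s * m i)\<^sup>2) \<and> (\<Sum>i<r. (s * m i)\<^sup>2) \<le> 1.03}"
  have N: "finite N" "real (card N) \<le> 2 ^ (103 * r)"
  proof -
    show "finite N" by (simp add: N_def finite_grid_net)
    have "card N \<le> card (grid_net r (101 * r))" by (intro card_mono finite_grid_net) (auto simp: N_def)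
    then show "real (card N) \<le> 2 ^ (103 * r)" using card_grid_net[of r "101 * r"] by simp
  qed
  define L where "L m x = (\<Sum>i<r. (s * real_of_int (m i)) * Z i x)" for m x
  have Lm: "L m \<in> borel_measurable \<mu>" for m unfolding L_def using meas by auto
  have comp: "(\<lambda>\<omega>. f (\<omega> j)) \<in> borel_measurable ?S" if "f \<in> borel_measurable \<mu>" "j < k" for f :: "'a \<Rightarrow> real" and j
    using that by (intro measurable_compose[OF measurable_component_singleton]) auto
  define bad where "bad m = {\<omega> \<in> space ?S. (\<Sum>j<k. (L m (\<omega> j))\<^sup>2) \<le> 0.6 * k}" for m
  define T where "T \<omega> = (\<Sum>j<k. \<Sum>i<r. (Z i (\<omega> j))\<^sup>2)" for \<omega> :: "nat \<Rightarrow> 'a"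
  have Tm: "T \<in> borel_measurable ?S"
    unfolding T_def using meas by (intro borel_measurable_sum borel_measurable_power comp) auto
  define bad' where "bad' = {\<omega> \<in> space ?S. 1000 * (real k * real r) < T \<omega>}"
  have badm: "bad m \<in> sets ?S" for m
  proof -
    have "(\<lambda>\<omega>. \<Sum>j<k. (L m (\<omega> j))\<^sup>2) \<in> borel_measurable ?S"
      by (intro borel_measurable_sum borel_measurable_power comp Lm) auto
    then show ?thesis unfolding bad_def by measurable
  qed
  have bad'm: "bad' \<in> sets ?S" using Tm unfolding bad'_def by measurable
  have pbad: "measure ?S (bad m) \<le> exp (- \<tau>)" if "m \<in> N" for m
  proof -
    define a where "a = (\<Sum>i<r. (s * m i)\<^sup>2)"
    have a: "0.98 \<le> a" "a \<le> 1.03" using that by (auto simp: N_def a_def)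
    have "(\<integral>\<^sup>+x. ennreal ((L m x)\<^sup>2) \<partial>\<mu>) = ennreal a" unfolding L_def a_def by (rule m2)
    moreover have "(\<integral>\<^sup>+x. ennreal ((L m x)^4) \<partial>\<mu>) \<le> ennreal (h * a\<^sup>2)" unfolding L_def a_def by (rule m4)
    ultimately have p: "measure ?S {\<omega> \<in> space ?S. (\<Sum>j<k. (L m (\<omega> j))\<^sup>2) \<le> k * (a - \<theta> * h * a\<^sup>2 / 2) - \<tau> / \<theta>} \<le> exp (- \<tau>)"
      using a h by (intro lower_tail_squares[OF prob Lm \<theta>]) auto
    have le: "0.6 * k \<le> k * (a - \<theta> * h * a\<^sup>2 / 2) - \<tau> / \<theta>"
    proof -
      have th: "\<theta> * h = 1 / 2" using h by (simp add: \<theta>_def)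
      have "a\<^sup>2 \<le> 1.03\<^sup>2" using a by (intro power_mono) auto
      then have "0.7 \<le> a - \<theta> * h * a\<^sup>2 / 2" unfolding th using a by (simp add: power2_eq_square)
      then have "k * 0.7 \<le> k * (a - \<theta> * h * a\<^sup>2 / 2)" by (intro mult_left_mono) auto
      moreover have "\<tau> / \<theta> \<le> 0.1 * k"
      proof -
        have "\<tau> \<le> 115 * real r" using r by (simp add: \<tau>_def)
        then have "2 * h * \<tau> \<le> 2 * h * (115 * real r)" using h by (intro mult_left_mono) auto
        also have "\<dots> \<le> 0.1 * k" using k by simp
        finally show ?thesis by (simp add: \<theta>_def mult.commute)
      qed
      ultimately show ?thesis by simp
    qed
    have "(\<lambda>\<omega>. \<Sum>j<k. (L m (\<omega> j))\<^sup>2) \<in> borel_measurable ?S"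
      by (intro borel_measurable_sum borel_measurable_power comp Lm) auto
    then have s: "{\<omega> \<in> space ?S. (\<Sum>j<k. (L m (\<omega> j))\<^sup>2) \<le> k * (a - \<theta> * h * a\<^sup>2 / 2) - \<tau> / \<theta>} \<in> sets ?S"
      by measurable
    have "measure ?S (bad m) \<le>
        measure ?S {\<omega> \<in> space ?S. (\<Sum>j<k. (L m (\<omega> j))\<^sup>2) \<le> k * (a - \<theta> * h * a\<^sup>2 / 2) - \<tau> / \<theta>}"
    proof (rule S.finite_measure_mono[OF subsetI s])
      fix \<omega> assume "\<omega> \<in> bad m"
      then show "\<omega> \<in> {\<omega> \<in> space ?S. (\<Sum>j<k. (L m (\<omega> j))\<^sup>2) \<le> k * (a - \<theta> * h * a\<^sup>2 / 2) - \<tau> / \<theta>}"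
        using order_trans[OF _ le] by (simp add: bad_def)
    qed
    then show ?thesis using p by (rule order_trans)
  qed
  have "measure ?S (\<Union>m\<in>N. bad m) \<le> (\<Sum>m\<in>N. measure ?S (bad m))"
    using N(1) badm by (intro S.finite_measure_subadditive_finite) auto
  also have "\<dots> \<le> (\<Sum>m\<in>N. exp (- \<tau>))" by (intro sum_mono pbad)
  also have "\<dots> \<le> 2 ^ (103 * r) * exp (- \<tau>)" using N(2) by (simp add: mult_right_mono)
  also have "\<dots> \<le> exp (real (103 * r)) * exp (- \<tau>)"
  proof -
    have "(2 :: real) \<le> exp 1" using exp_ge_add_one_self[of 1] by simp
    then have "(2 :: real) ^ (103 * r) \<le> exp 1 ^ (103 * r)" by (intro power_mono) auto
    also have "\<dots> = exp (real (103 * r))" by (simp flip: exp_of_nat_mult)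
    finally show ?thesis by (simp add: mult_right_mono)
  qed
  also have "\<dots> = exp (- 10)" by (simp add: \<tau>_def exp_add[symmetric])
  also have "\<dots> \<le> 1 / 1000"
  proof -
    have "(2 :: real) ^ 10 \<le> exp 1 ^ 10"
      using exp_ge_add_one_self[of 1] by (intro power_mono) auto
    also have "\<dots> = exp 10" by (simp flip: exp_of_nat_mult)
    finally have "1000 \<le> exp (10 :: real)" by simp
    then show ?thesis by (simp add: exp_minus field_simps)
  qed
  finally have P1: "measure ?S (\<Union>m\<in>N. bad m) \<le> 1 / 1000" .
  have P2: "measure ?S bad' \<le> 1 / 1000"
    unfolding bad'_def
  proof (rule markov_above[OF prob Tm])
    show "0 \<le> T \<omega>" for \<omega> unfolding T_def by (intro sum_nonneg) auto
    have Zi: "(\<integral>\<^sup>+x. ennreal ((Z i x)\<^sup>2) \<partial>\<mu>) = 1" if "i < r" for i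
    proof -
      have "(\<Sum>i'<r. (if i' = i then 1 else 0) * Z i' x) = Z i x" for x
        using that by (simp add: if_distrib[of "\<lambda>c. c * _"] cong: if_cong)
      moreover have "(\<Sum>i'<r. (if i' = i then 1 else 0 :: real)\<^sup>2) = 1"
        using that by (simp add: if_distrib[of "\<lambda>c. c\<^sup>2"] cong: if_cong)
      ultimately show ?thesis using m2[of "\<lambda>i'. if i' = i then 1 else 0"] by simp
    qed
    have "(\<integral>\<^sup>+\<omega>. ennreal (T \<omega>) \<partial>?S) = (\<integral>\<^sup>+\<omega>. (\<Sum>j<k. \<Sum>i<r. ennreal ((Z i (\<omega> j))\<^sup>2)) \<partial>?S)"
      unfolding T_def by (simp add: sum_nonneg)
    also have "\<dots> = (\<Sum>j<k. \<Sum>i<r. \<integral>\<^sup>+\<omega>. ennreal ((Z i (\<omega> j))\<^sup>2) \<partial>?S)"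
    proof -
      have c: "(\<lambda>\<omega>. ennreal ((Z i (\<omega> j))\<^sup>2)) \<in> borel_measurable ?S" if "i < r" "j < k" for i j
        using comp[OF meas[OF that(1)] that(2)] by measurable
      have "(\<integral>\<^sup>+\<omega>. (\<Sum>j<k. \<Sum>i<r. ennreal ((Z i (\<omega> j))\<^sup>2)) \<partial>?S) =
          (\<Sum>j<k. \<integral>\<^sup>+\<omega>. (\<Sum>i<r. ennreal ((Z i (\<omega> j))\<^sup>2)) \<partial>?S)"
        using c by (intro nn_integral_sum borel_measurable_sum) auto
      also have "\<dots> = (\<Sum>j<k. \<Sum>i<r. \<integral>\<^sup>+\<omega>. ennreal ((Z i (\<omega> j))\<^sup>2) \<partial>?S)"
        using c by (intro sum.cong refl nn_integral_sum) auto
      finally show ?thesis .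
    qed
    also have "\<dots> = (\<Sum>j<k. \<Sum>i<r. 1)"
    proof (intro sum.cong refl)
      fix j i assume ij: "j \<in> {..<k}" "i \<in> {..<r}"
      have "Z i \<in> borel_measurable \<mu>" using meas[of i] ij by auto
      then have "(\<lambda>x. ennreal ((Z i x)\<^sup>2)) \<in> borel_measurable \<mu>" by measurable
      from nn_integral_sample[OF prob finite_lessThan ij(1) this]
      show "(\<integral>\<^sup>+\<omega>. ennreal ((Z i (\<omega> j))\<^sup>2) \<partial>?S) = 1"
        using Zi[of i] ij by simp
    qed
    also have "\<dots> = ennreal (real k * real r)"
      by (simp add: ennreal_of_nat_eq_real_of_nat ennreal_mult)
    finally show "(\<integral>\<^sup>+\<omega>. ennreal (T \<omega>) \<partial>?S) \<le> ennreal (real k * real r)" by simp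
  qed auto
  define B where "B = (\<Union>m\<in>N. bad m) \<union> bad'"
  have Um: "(\<Union>m\<in>N. bad m) \<in> sets ?S" using N(1) badm by (intro sets.finite_UN) auto
  have Bm: "B \<in> sets ?S" unfolding B_def by (rule sets.Un[OF Um bad'm])
  have PB: "measure ?S B \<le> 2 / 1000"
  proof -
    have "measure ?S B \<le> measure ?S (\<Union>m\<in>N. bad m) + measure ?S bad'"
      unfolding B_def by (rule measure_Un_le[OF Um bad'm])
    then show ?thesis using P1 P2 by simp
  qed
  show thesis
  proof (rule that[of "space ?S - B"])
    show "space ?S - B \<in> sets ?S" using Bm by auto
    have "space ?S - (space ?S - B) = B" using sets.sets_into_space[OF Bm] by auto
    then show "measure ?S (space ?S - (space ?S - B)) \<le> 2 / 1000" using PB by simp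
    fix \<omega> x assume \<omega>: "\<omega> \<in> space ?S - B"
    define q where "q y = (\<Sum>j<k. (\<Sum>i<r. y i * Z i (\<omega> j))\<^sup>2)" for y :: "nat \<Rightarrow> real"
    have unit: "real k / 2 \<le> q y" if y: "(\<Sum>i<r. (y i)\<^sup>2) = 1" for y
    proof -
      obtain m :: "nat \<Rightarrow> int" where m: "\<And>i. i < r \<Longrightarrow> \<bar>s * m i - y i\<bar> \<le> s"
        and qm: "(\<Sum>j<k. (\<Sum>i<r. s * m i * Z i (\<omega> j))\<^sup>2) \<le> q y + s\<^sup>2 * T \<omega>"
        using grid_rounding[OF s(1), of r y "\<lambda>i j. Z i (\<omega> j)" "{..<k}"] unfolding q_def T_def by blast
      define m' where "m' = restrict m {..<r}"
      have m'm: "m' i = m i" if "i < r" for i using that by (simp add: m'_def)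
      have l1: "(\<Sum>i<r. nat \<bar>m' i\<bar>) \<le> 101 * r"
      proof -
        have "s * (\<Sum>i<r. \<bar>real_of_int (m i)\<bar>) \<le> (\<Sum>i<r. \<bar>y i\<bar> + s)"
          unfolding sum_distrib_left
        proof (rule sum_mono)
          fix i assume "i \<in> {..<r}"
          then have "\<bar>s * m i\<bar> \<le> \<bar>y i\<bar> + s" using m[of i] by auto
          then show "s * \<bar>real_of_int (m i)\<bar> \<le> \<bar>y i\<bar> + s" using s(1) by (simp add: abs_mult)
        qed
        also have "\<dots> = (\<Sum>i<r. \<bar>y i\<bar>) + s * r" by (simp add: sum.distrib)
        also have "(\<Sum>i<r. \<bar>y i\<bar>) \<le> sqrt r"
        proof (rule real_le_rsqrt)
          have "(\<Sum>i<r. \<bar>y i\<bar> * 1)\<^sup>2 \<le> (\<Sum>i<r. \<bar>y i\<bar>\<^sup>2) * (\<Sum>i<r. 1\<^sup>2)"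
            by (rule Cauchy_Schwarz_ineq_sum)
          then show "(\<Sum>i<r. \<bar>y i\<bar>)\<^sup>2 \<le> r" using y by simp
        qed
        also have "sqrt r + s * r = s * (101 * r)"
          using r by (simp add: s_def field_simps)
        finally have "(\<Sum>i<r. \<bar>real_of_int (m i)\<bar>) \<le> 101 * r" using s(1) by simp
        moreover have "real (\<Sum>i<r. nat \<bar>m' i\<bar>) = (\<Sum>i<r. \<bar>real_of_int (m i)\<bar>)"
          by (simp add: m'm)
        ultimately show ?thesis by linarith
      qed
      have "m' \<in> {..<r} \<rightarrow>\<^sub>E {- int (101 * r)..int (101 * r)}"
      proof (rule PiE_I)
        fix i assume i: "i \<in> {..<r}"
        have "nat \<bar>m' i\<bar> \<le> (\<Sum>i<r. nat \<bar>m' i\<bar>)" using i by (intro member_le_sum) auto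
        then have "nat \<bar>m' i\<bar> \<le> 101 * r" using l1 by simp
        then show "m' i \<in> {- int (101 * r)..int (101 * r)}" by auto
      qed (simp add: m'_def)
      then have net: "m' \<in> grid_net r (101 * r)" using l1 by (simp add: grid_net_def)
      define a where "a = (\<Sum>i<r. (s * m' i)\<^sup>2)"
      define D where "D = (\<Sum>i<r. (s * m i - y i)\<^sup>2)"
      define c where "c = (\<Sum>i<r. y i * (s * m i - y i))"
      have D: "D \<le> 1 / 10000"
      proof -
        have "D \<le> (\<Sum>i<r. s\<^sup>2)"
          unfolding D_def using m s(1) by (intro sum_mono) (simp add: abs_le_square_iff[symmetric])
        then show ?thesis using s(2) by (simp add: mult.commute)
      qed
      have "c\<^sup>2 \<le> 1 * D" unfolding c_def D_def y[symmetric] by (rule Cauchy_Schwarz_ineq_sum)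
      then have "c\<^sup>2 \<le> (1 / 100)\<^sup>2" using D by (simp add: power2_eq_square)
      then have c: "\<bar>c\<bar> \<le> 1 / 100" using abs_le_square_iff[of c "1 / 100"] by simp
      have D0: "0 \<le> D" unfolding D_def by (intro sum_nonneg) auto
      have "a = (\<Sum>i<r. (y i)\<^sup>2 + 2 * (y i * (s * m i - y i)) + (s * m i - y i)\<^sup>2)"
        unfolding a_def by (intro sum.cong refl) (simp add: m'm power2_eq_square algebra_simps)
      also have "\<dots> = 1 + 2 * c + D"
        by (simp add: sum.distrib y c_def D_def sum_distrib_left)
      finally have "0.98 \<le> a" "a \<le> 1.03" using c D D0 by (auto simp: abs_le_iff)
      then have "m' \<in> N" using net by (simp add: N_def a_def)
      then have "\<omega> \<notin> bad m'" "\<omega> \<notin> bad'" using \<omega> by (auto simp: B_def)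
      then have big: "0.6 * k < (\<Sum>j<k. (L m' (\<omega> j))\<^sup>2)" and tr: "T \<omega> \<le> 1000 * (real k * real r)"
        using \<omega> by (auto simp: bad_def bad'_def)
      have "(\<Sum>j<k. (L m' (\<omega> j))\<^sup>2) = (\<Sum>j<k. (\<Sum>i<r. s * m i * Z i (\<omega> j))\<^sup>2)"
        unfolding L_def by (simp add: m'm)
      also note qm
      also have "s\<^sup>2 * T \<omega> \<le> s\<^sup>2 * (1000 * (real k * real r))" using tr by (intro mult_left_mono) auto
      also have "\<dots> = 1000 * k * (s\<^sup>2 * r)" by simp
      also have "\<dots> = 0.1 * k" by (simp add: s(2))
      finally show ?thesis using big by simp
    qed
    define t where "t = sqrt (\<Sum>i<r. (x i)\<^sup>2)"
    have t2: "t\<^sup>2 = (\<Sum>i<r. (x i)\<^sup>2)" by (simp add: t_def sum_nonneg)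
    show "real k / 2 * (\<Sum>i<r. (x i)\<^sup>2) \<le> (\<Sum>j<k. (\<Sum>i<r. x i * Z i (\<omega> j))\<^sup>2)"
    proof (cases "t = 0")
      case True
      then have "(\<Sum>i<r. (x i)\<^sup>2) = 0" using t2 by simp
      then show ?thesis by (simp add: sum_nonneg)
    next
      case False
      have "(\<Sum>i<r. (x i / t)\<^sup>2) = 1"
        using False by (simp add: power_divide t2[symmetric] flip: sum_divide_distrib)
      from unit[OF this] have "real k / 2 * t\<^sup>2 \<le> q (\<lambda>i. x i / t) * t\<^sup>2" by (intro mult_right_mono) auto
      also have "\<dots> = q x"
      proof -
        have "(\<Sum>i<r. x i / t * Z i (\<omega> j)) = (\<Sum>i<r. x i * Z i (\<omega> j)) / t" for j
          by (simp add: sum_divide_distrib)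
        then show ?thesis using False by (simp add: q_def sum_distrib_right power_divide)
      qed
      finally show ?thesis by (simp add: t2 q_def)
    qed
  qed
qed

section \<open>Measurability of the approximation error\<close>

definition mat_measurable :: "'a measure \<Rightarrow> nat \<Rightarrow> nat \<Rightarrow> ('a \<Rightarrow> real mat) \<Rightarrow> bool" where
  "mat_measurable M nr nc F \<longleftrightarrow> (\<forall>\<omega>. F \<omega> \<in> carrier_mat nr nc) \<and>
     (\<forall>i<nr. \<forall>j<nc. (\<lambda>\<omega>. F \<omega> $$ (i, j)) \<in> borel_measurable M)"

lemma mat_measurable_carrier: "mat_measurable M nr nc F \<Longrightarrow> F \<omega> \<in> carrier_mat nr nc"
  and mat_measurable_entry: "mat_measurable M nr nc F \<Longrightarrow> i < nr \<Longrightarrow> j < nc \<Longrightarrow> (\<lambda>\<omega>. F \<omega> $$ (i, j)) \<in> borel_measurable M"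
  by (auto simp: mat_measurable_def)

lemma mat_measurable_const: "A \<in> carrier_mat nr nc \<Longrightarrow> mat_measurable M nr nc (\<lambda>_. A)"
  by (auto simp: mat_measurable_def)

lemma mat_measurable_mult:
  assumes F: "mat_measurable M a b F" and G: "mat_measurable M b c G"
  shows "mat_measurable M a c (\<lambda>\<omega>. F \<omega> * G \<omega>)"
  unfolding mat_measurable_def
proof (intro conjI allI impI)
  note FG = mat_measurable_carrier[OF F] mat_measurable_carrier[OF G]
  show "F \<omega> * G \<omega> \<in> carrier_mat a c" for \<omega> by (rule mult_carrier_mat[OF FG])
  fix i j assume ij: "i < a" "j < c"
  have "(F \<omega> * G \<omega>) $$ (i, j) = (\<Sum>l<b. F \<omega> $$ (i, l) * G \<omega> $$ (l, j))" for \<omega>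
    using ij FG[of \<omega>] by (auto simp: scalar_prod_def atLeast0LessThan intro!: sum.cong)
  moreover have "(\<lambda>\<omega>. \<Sum>l<b. F \<omega> $$ (i, l) * G \<omega> $$ (l, j)) \<in> borel_measurable M"
    using ij by (intro borel_measurable_sum borel_measurable_times mat_measurable_entry[OF F] mat_measurable_entry[OF G]) auto
  ultimately show "(\<lambda>\<omega>. (F \<omega> * G \<omega>) $$ (i, j)) \<in> borel_measurable M" by simp
qed

lemma mat_measurable_transpose:
  assumes F: "mat_measurable M a b F"
  shows "mat_measurable M b a (\<lambda>\<omega>. transpose_mat (F \<omega>))"
  unfolding mat_measurable_def
proof (intro conjI allI impI)
  show "transpose_mat (F \<omega>) \<in> carrier_mat b a" for \<omega> using mat_measurable_carrier[OF F] by simp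
  fix i j assume ij: "i < b" "j < a"
  have "transpose_mat (F \<omega>) $$ (i, j) = F \<omega> $$ (j, i)" for \<omega>
    using ij mat_measurable_carrier[OF F, of \<omega>] by auto
  then show "(\<lambda>\<omega>. transpose_mat (F \<omega>) $$ (i, j)) \<in> borel_measurable M"
    using mat_measurable_entry[OF F ij(2,1)] by simp
qed

lemma mat_measurable_add:
  assumes F: "mat_measurable M a b F" and G: "mat_measurable M a b G"
  shows "mat_measurable M a b (\<lambda>\<omega>. F \<omega> + G \<omega>)"
  unfolding mat_measurable_def
proof (intro conjI allI impI)
  show "F \<omega> + G \<omega> \<in> carrier_mat a b" for \<omega>
    using mat_measurable_carrier[OF F] mat_measurable_carrier[OF G] by simp
  fix i j assume ij: "i < a" "j < b"
  have "(F \<omega> + G \<omega>) $$ (i, j) = F \<omega> $$ (i, j) + G \<omega> $$ (i, j)" for \<omega>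
    using ij mat_measurable_carrier[OF G, of \<omega>] by auto
  then show "(\<lambda>\<omega>. (F \<omega> + G \<omega>) $$ (i, j)) \<in> borel_measurable M"
    using mat_measurable_entry[OF F ij] mat_measurable_entry[OF G ij] by simp
qed

lemma mat_measurable_minus:
  assumes F: "mat_measurable M a b F" and G: "mat_measurable M a b G"
  shows "mat_measurable M a b (\<lambda>\<omega>. F \<omega> - G \<omega>)"
  unfolding mat_measurable_def
proof (intro conjI allI impI)
  show "F \<omega> - G \<omega> \<in> carrier_mat a b" for \<omega>
    using minus_carrier_mat[OF mat_measurable_carrier[OF G]] .
  fix i j assume ij: "i < a" "j < b"
  have "(F \<omega> - G \<omega>) $$ (i, j) = F \<omega> $$ (i, j) - G \<omega> $$ (i, j)" for \<omega>
    using ij mat_measurable_carrier[OF G, of \<omega>] by auto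
  then show "(\<lambda>\<omega>. (F \<omega> - G \<omega>) $$ (i, j)) \<in> borel_measurable M"
    using mat_measurable_entry[OF F ij] mat_measurable_entry[OF G ij] by simp
qed

lemma borel_measurable_det:
  assumes F: "mat_measurable M n n F"
  shows "(\<lambda>\<omega>. det (F \<omega>)) \<in> borel_measurable M"
proof -
  have "det (F \<omega>) = (\<Sum>p | p permutes {0..<n}. signof p * (\<Prod>i = 0..<n. F \<omega> $$ (i, p i)))" for \<omega>
    by (rule det_def'[OF mat_measurable_carrier[OF F]])
  moreover have "(\<lambda>\<omega>. \<Sum>p | p permutes {0..<n}. signof p * (\<Prod>i = 0..<n. F \<omega> $$ (i, p i))) \<in> borel_measurable M"
  proof (intro borel_measurable_sum borel_measurable_times borel_measurable_prod borel_measurable_const)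
    fix p i assume "p \<in> {p. p permutes {0..<n}}" "i \<in> {0..<n}"
    then have "i < n" "p i < n" using permutes_in_image[of p "{0..<n}" i] by auto
    then show "(\<lambda>\<omega>. F \<omega> $$ (i, p i)) \<in> borel_measurable M" by (rule mat_measurable_entry[OF F])
  qed
  ultimately show ?thesis by simp
qed

lemma mat_measurable_adj_mat:
  assumes F: "mat_measurable M n n F"
  shows "mat_measurable M n n (\<lambda>\<omega>. adj_mat (F \<omega>))"
  unfolding mat_measurable_def
proof (intro conjI allI impI)
  note c = mat_measurable_carrier[OF F]
  show "adj_mat (F \<omega>) \<in> carrier_mat n n" for \<omega> by (rule adj_mat(1)[OF c])
  fix i j assume ij: "i < n" "j < n"
  have "mat_measurable M (n - 1) (n - 1) (\<lambda>\<omega>. mat_delete (F \<omega>) j i)"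
    unfolding mat_measurable_def
  proof (intro conjI allI impI)
    show "mat_delete (F \<omega>) j i \<in> carrier_mat (n - 1) (n - 1)" for \<omega> using c[of \<omega>] by (simp add: mat_delete_def)
    fix i' j' assume ij': "i' < n - 1" "j' < n - 1"
    have "mat_delete (F \<omega>) j i $$ (i', j') = F \<omega> $$ (if i' < j then i' else Suc i', if j' < i then j' else Suc j')" for \<omega>
      using ij' c[of \<omega>] by (simp add: mat_delete_def)
    then show "(\<lambda>\<omega>. mat_delete (F \<omega>) j i $$ (i', j')) \<in> borel_measurable M"
      using mat_measurable_entry[OF F, of "if i' < j then i' else Suc i'" "if j' < i then j' else Suc j'"] ij' by auto
  qed
  from borel_measurable_det[OF this]
  have "(\<lambda>\<omega>. (- 1) ^ (j + i) * det (mat_delete (F \<omega>) j i)) \<in> borel_measurable M" by measurable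
  moreover have "adj_mat (F \<omega>) $$ (i, j) = (- 1) ^ (j + i) * det (mat_delete (F \<omega>) j i)" for \<omega>
    using ij c[of \<omega>] by (simp add: adj_mat_def cofactor_def)
  ultimately show "(\<lambda>\<omega>. adj_mat (F \<omega>) $$ (i, j)) \<in> borel_measurable M" by simp
qed

lemma mat_measurable_reg_inv:
  assumes F: "mat_measurable M n n F"
  shows "mat_measurable M n n (\<lambda>\<omega>. reg_inv (F \<omega>) m)"
proof -
  define T where "T \<omega> = F \<omega> + (1 / real (Suc m)) \<cdot>\<^sub>m 1\<^sub>m n" for \<omega>
  have T: "mat_measurable M n n T"
    unfolding T_def by (intro mat_measurable_add F mat_measurable_const) simp
  have R: "reg_inv (F \<omega>) m = (1 / det (T \<omega>)) \<cdot>\<^sub>m adj_mat (T \<omega>)" for \<omega>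
    using mat_measurable_carrier[OF F, of \<omega>] by (simp add: reg_inv_def Let_def T_def)
  show ?thesis
    unfolding R mat_measurable_def
  proof (intro conjI allI impI)
    note c = mat_measurable_carrier[OF mat_measurable_adj_mat[OF T]]
    show "(1 / det (T \<omega>)) \<cdot>\<^sub>m adj_mat (T \<omega>) \<in> carrier_mat n n" for \<omega> using c by simp
    fix i j assume ij: "i < n" "j < n"
    have "((1 / det (T \<omega>)) \<cdot>\<^sub>m adj_mat (T \<omega>)) $$ (i, j) = 1 / det (T \<omega>) * adj_mat (T \<omega>) $$ (i, j)" for \<omega>
      using ij c[of \<omega>] by auto
    then show "(\<lambda>\<omega>. ((1 / det (T \<omega>)) \<cdot>\<^sub>m adj_mat (T \<omega>)) $$ (i, j)) \<in> borel_measurable M"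
      using borel_measurable_det[OF T] mat_measurable_entry[OF mat_measurable_adj_mat[OF T] ij] by simp
  qed
qed

lemma mat_measurable_pinv:
  assumes F: "mat_measurable M n n F" and psd: "\<And>\<omega>. psd (F \<omega>)"
  shows "mat_measurable M n n (\<lambda>\<omega>. pinv (F \<omega>))"
  unfolding mat_measurable_def
proof (intro conjI allI impI)
  note c = mat_measurable_carrier[OF F]
  show "pinv (F \<omega>) \<in> carrier_mat n n" for \<omega>
    using symmetric_is_pinv_pinv(1)[OF c[of \<omega>]] psd[of \<omega>] c[of \<omega>] by (auto simp: is_pinv_def psd_def)
  fix i j assume ij: "i < n" "j < n"
  show "(\<lambda>\<omega>. pinv (F \<omega>) $$ (i, j)) \<in> borel_measurable M"
  proof (rule borel_measurable_LIMSEQ_real)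
    show "(\<lambda>m. (reg_inv (F \<omega>) m * F \<omega> * reg_inv (F \<omega>) m) $$ (i, j)) \<longlonglongrightarrow> pinv (F \<omega>) $$ (i, j)" for \<omega>
      by (rule pinv_limit[OF psd c ij])
    show "(\<lambda>\<omega>. (reg_inv (F \<omega>) m * F \<omega> * reg_inv (F \<omega>) m) $$ (i, j)) \<in> borel_measurable M" for m
      by (rule mat_measurable_entry[OF mat_measurable_mult[OF mat_measurable_mult[OF
            mat_measurable_reg_inv[OF F] F] mat_measurable_reg_inv[OF F]] ij])
  qed
qed

lemma mat_measurable_nystrom:
  assumes A: "psd A" "A \<in> carrier_mat n n" and F: "mat_measurable M n k F"
  shows "mat_measurable M n n (\<lambda>\<omega>. nystrom A (F \<omega>))"
proof -
  note c = mat_measurable_const[OF A(2), of M]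
  note FT = mat_measurable_transpose[OF F]
  have "psd (transpose_mat (F \<omega>) * A * F \<omega>)" for \<omega>
    by (rule psd_congruence[OF A mat_measurable_carrier[OF F]])
  note P = mat_measurable_pinv[OF mat_measurable_mult[OF mat_measurable_mult[OF FT c] F] this]
  show ?thesis unfolding nystrom_def
    by (rule mat_measurable_mult[OF mat_measurable_mult[OF mat_measurable_mult[OF c F] P] mat_measurable_mult[OF FT c]])
qed

lemma borel_measurable_frob_norm:
  assumes F: "mat_measurable M a b F"
  shows "(\<lambda>\<omega>. frob_norm (F \<omega>)) \<in> borel_measurable M"
proof -
  have "frob_norm (F \<omega>) = sqrt (\<Sum>i<a. \<Sum>j<b. (F \<omega> $$ (i, j))\<^sup>2)" for \<omega>
    using mat_measurable_carrier[OF F, of \<omega>] by (simp add: frob_norm_def)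
  moreover have "(\<lambda>\<omega>. sqrt (\<Sum>i<a. \<Sum>j<b. (F \<omega> $$ (i, j))\<^sup>2)) \<in> borel_measurable M"
  proof -
    have "(\<lambda>\<omega>. \<Sum>i<a. \<Sum>j<b. (F \<omega> $$ (i, j))\<^sup>2) \<in> borel_measurable M"
      using mat_measurable_entry[OF F] by (intro borel_measurable_sum borel_measurable_power) auto
    then show ?thesis by measurable
  qed
  ultimately show ?thesis by simp
qed

lemma borel_measurable_mat_tr:
  assumes F: "mat_measurable M n n F"
  shows "(\<lambda>\<omega>. mat_tr (F \<omega>)) \<in> borel_measurable M"
proof -
  have "mat_tr (F \<omega>) = (\<Sum>i<n. F \<omega> $$ (i, i))" for \<omega>
    using mat_measurable_carrier[OF F, of \<omega>] by (simp add: mat_tr_def)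
  moreover have "(\<lambda>\<omega>. \<Sum>i<n. F \<omega> $$ (i, i)) \<in> borel_measurable M"
    using mat_measurable_entry[OF F] by (intro borel_measurable_sum) auto
  ultimately show ?thesis by simp
qed

lemma measurable_nystrom_guarantees:
  assumes A: "psd A" "A \<in> carrier_mat n n" and F: "mat_measurable M n k F"
  shows "{\<omega> \<in> space M. nystrom_guarantees C r A B (nystrom A (F \<omega>))} \<in> sets M"
proof -
  have E: "mat_measurable M n n (\<lambda>\<omega>. A - nystrom A (F \<omega>))"
    by (intro mat_measurable_minus mat_measurable_const[OF A(2)] mat_measurable_nystrom[OF A F])
  note res = nystrom_residual[OF A mat_measurable_carrier[OF F]]
  have nuc: "nuclear_norm (A - nystrom A (F \<omega>)) = mat_tr (A - nystrom A (F \<omega>))" for \<omega>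
    by (rule nuclear_norm_psd[OF res(1,2)])
  note [measurable] = borel_measurable_frob_norm[OF E] borel_measurable_mat_tr[OF E]
  show ?thesis unfolding nystrom_guarantees_def nuc by measurable
qed

lemma borel_measurable_mps_vec:
  assumes "1 \<le> d" "2 \<le> n" "I < d ^ n"
  shows "(\<lambda>G. mps_vec d n \<chi> G $ I) \<in> borel_measurable (core_law d n \<chi>)"
proof -
  obtain p where p: "n = p + 2" using assms(2) by (metis add.commute le_Suc_ex)
  have hd: "I div d < d ^ (p + 1)"
    using assms p by (simp add: less_mult_imp_div_less mult.commute)
  have "(\<lambda>G. \<Sum>\<alpha><\<chi>. mps_left d \<chi> G p (I div d) \<alpha> * G (Last \<alpha> (I mod d)))
      \<in> borel_measurable (Pi\<^sub>M (core_entries d n \<chi>) (entry_law \<chi>))"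
    using assms hd by (intro borel_measurable_sum borel_measurable_times measurable_mps_left measurable_entry)
      (auto simp: p core_entries_eq core_entries_def left_entries_def)
  then show ?thesis by (simp add: mps_vec_eq_mps_left[OF p assms(3)] core_law_def)
qed

lemma rmps_test_matrix_carrier: "rmps_test_matrix d n \<chi> k \<omega> \<in> carrier_mat (d ^ n) k"
  by (simp add: rmps_test_matrix_def mat_of_cols_def)

lemma col_rmps_test_matrix:
  assumes "j < k"
  shows "col (rmps_test_matrix d n \<chi> k \<omega>) j = (1 / sqrt k) \<cdot>\<^sub>v mps_vec d n \<chi> (\<omega> j)"
proof -
  have "col (mat_of_cols (d ^ n) (map (\<lambda>j. mps_vec d n \<chi> (\<omega> j)) [0..<k])) j = mps_vec d n \<chi> (\<omega> j)"
    using assms by (simp add: col_mat_of_cols mps_vec_def)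
  then show ?thesis using assms by (simp add: rmps_test_matrix_def)
qed

lemma mat_measurable_rmps_test_matrix:
  assumes "1 \<le> d" "2 \<le> n"
  shows "mat_measurable (rmps_space d n \<chi> k) (d ^ n) k (rmps_test_matrix d n \<chi> k)"
  unfolding mat_measurable_def
proof (intro conjI allI impI rmps_test_matrix_carrier)
  fix i j assume ij: "i < d ^ n" "j < k"
  have "rmps_test_matrix d n \<chi> k \<omega> $$ (i, j) = col (rmps_test_matrix d n \<chi> k \<omega>) j $ i" for \<omega>
    using ij rmps_test_matrix_carrier[of d n \<chi> k \<omega>] by auto
  then have "rmps_test_matrix d n \<chi> k \<omega> $$ (i, j) = 1 / sqrt k * mps_vec d n \<chi> (\<omega> j) $ i" for \<omega>
    using ij by (simp add: col_rmps_test_matrix mps_vec_def)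
  moreover have "(\<lambda>\<omega>. mps_vec d n \<chi> (\<omega> j) $ i) \<in> borel_measurable (rmps_space d n \<chi> k)"
    unfolding rmps_space_def using ij(2) borel_measurable_mps_vec[OF assms ij(1), of \<chi>]
    by (intro measurable_compose[where f = "\<lambda>\<omega>. \<omega> j" and g = "\<lambda>G. mps_vec d n \<chi> G $ i"]) auto
  ultimately show "(\<lambda>\<omega>. rmps_test_matrix d n \<chi> k \<omega> $$ (i, j)) \<in> borel_measurable (rmps_space d n \<chi> k)"
    by simp
qed

section \<open>The tail of the sketched matrix\<close>

text \<open>
  The Frobenius norm of the sketched tail splits into pairs of samples: the \<open>k\<close> diagonal pairs need
  fourth moments, the others only isotropy. Since \<open>k\<close> is at least of order \<open>h r\<close>, dividing by \<open>k\<^sup>2\<close> turns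
  the diagonal part into the term \<open>(\<Sum> l i)\<^sup>2 / r\<close> of the Frobenius bound.
\<close>

lemma tail_sketch_moments:
  fixes Z :: "nat \<Rightarrow> 'a \<Rightarrow> real" and l :: "nat \<Rightarrow> real"
  assumes prob: "prob_space \<mu>" and I: "finite I" and h: "0 \<le> h"
    and meas: "\<And>i. i \<in> I \<Longrightarrow> Z i \<in> borel_measurable \<mu>" and l: "\<And>i. i \<in> I \<Longrightarrow> 0 \<le> l i"
    and m2: "\<And>u. (\<integral>\<^sup>+x. ennreal ((\<Sum>i\<in>I. u i * Z i x)\<^sup>2) \<partial>\<mu>) = ennreal (\<Sum>i\<in>I. (u i)\<^sup>2)"
    and m4: "\<And>u. (\<integral>\<^sup>+x. ennreal ((\<Sum>i\<in>I. u i * Z i x)^4) \<partial>\<mu>) \<le> ennreal (h * (\<Sum>i\<in>I. (u i)\<^sup>2)\<^sup>2)"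
  shows "(\<integral>\<^sup>+\<omega>. ennreal (\<Sum>j<k. \<Sum>i\<in>I. l i * (Z i (\<omega> j))\<^sup>2) \<partial>samples \<mu> k) = ennreal (k * (\<Sum>i\<in>I. l i))"
    and "(\<integral>\<^sup>+\<omega>. ennreal (\<Sum>j<k. \<Sum>j'<k. (\<Sum>i\<in>I. l i * Z i (\<omega> j) * Z i (\<omega> j'))\<^sup>2) \<partial>samples \<mu> k) \<le>
      ennreal (real k * (h * (\<Sum>i\<in>I. l i)\<^sup>2) + (real k)\<^sup>2 * (\<Sum>i\<in>I. (l i)\<^sup>2))"
proof -
  let ?S = "samples \<mu> k"
  interpret product_sigma_finite "\<lambda>_ :: nat. \<mu>"
    by (intro product_sigma_finite.intro prob_space_imp_sigma_finite prob)
  have comp: "(\<lambda>\<omega>. f (\<omega> j)) \<in> borel_measurable ?S" if "f \<in> borel_measurable \<mu>" "j < k" for f :: "'a \<Rightarrow> real" and j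
    using that by (intro measurable_compose[OF measurable_component_singleton]) auto
  have single: "(\<Sum>i'\<in>I. (if i' = i then 1 else 0) * Z i' x) = Z i x" "(\<Sum>i'\<in>I. (if i' = i then 1 else 0 :: real)\<^sup>2) = 1"
    if "i \<in> I" for i x
    using that I by (simp_all add: if_distrib[of "\<lambda>c. c * _"] if_distrib[of "\<lambda>c. c\<^sup>2"] cong: if_cong)
  have Z2: "(\<integral>\<^sup>+x. ennreal ((Z i x)\<^sup>2) \<partial>\<mu>) = 1" if "i \<in> I" for i
    using m2[of "\<lambda>i'. if i' = i then 1 else 0"] single[OF that] by simp
  have Z4: "(\<integral>\<^sup>+x. ennreal ((Z i x)^4) \<partial>\<mu>) \<le> ennreal h" if "i \<in> I" for i
    using m4[of "\<lambda>i'. if i' = i then 1 else 0"] single[OF that] by simp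
  have quad: "(\<integral>\<^sup>+x. ennreal (\<Sum>i\<in>I. c i * (Z i x)\<^sup>2) \<partial>\<mu>) = ennreal (\<Sum>i\<in>I. c i)"
    if c: "\<And>i. i \<in> I \<Longrightarrow> 0 \<le> c i" for c
  proof -
    have "(\<integral>\<^sup>+x. ennreal (\<Sum>i\<in>I. c i * (Z i x)\<^sup>2) \<partial>\<mu>) = (\<integral>\<^sup>+x. (\<Sum>i\<in>I. ennreal (c i) * ennreal ((Z i x)\<^sup>2)) \<partial>\<mu>)"
      using c by (intro nn_integral_cong) (subst sum_ennreal[symmetric], auto intro!: sum.cong simp: ennreal_mult)
    also have "\<dots> = (\<Sum>i\<in>I. \<integral>\<^sup>+x. ennreal (c i) * ennreal ((Z i x)\<^sup>2) \<partial>\<mu>)"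
      using meas by (intro nn_integral_sum) auto
    also have "\<dots> = (\<Sum>i\<in>I. ennreal (c i))"
      using meas by (intro sum.cong refl) (simp add: nn_integral_cmult Z2)
    also have "\<dots> = ennreal (\<Sum>i\<in>I. c i)" using c by (intro sum_ennreal) auto
    finally show ?thesis .
  qed
  have lin: "(\<lambda>x. \<Sum>i\<in>I. c i * (Z i x)\<^sup>2) \<in> borel_measurable \<mu>" for c
    using meas by (intro borel_measurable_sum borel_measurable_times borel_measurable_power) auto
  have "(\<integral>\<^sup>+\<omega>. ennreal (\<Sum>j<k. \<Sum>i\<in>I. l i * (Z i (\<omega> j))\<^sup>2) \<partial>?S) =
      (\<integral>\<^sup>+\<omega>. (\<Sum>j<k. ennreal (\<Sum>i\<in>I. l i * (Z i (\<omega> j))\<^sup>2)) \<partial>?S)"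
    using l by (intro nn_integral_cong sum_ennreal[symmetric] sum_nonneg) auto
  also have "\<dots> = (\<Sum>j<k. \<integral>\<^sup>+\<omega>. ennreal (\<Sum>i\<in>I. l i * (Z i (\<omega> j))\<^sup>2) \<partial>?S)"
    using comp[OF lin] by (intro nn_integral_sum) auto
  also have "\<dots> = (\<Sum>j<k. ennreal (\<Sum>i\<in>I. l i))"
  proof (intro sum.cong refl)
    fix j assume j: "j \<in> {..<k}"
    have "(\<lambda>x. ennreal (\<Sum>i\<in>I. l i * (Z i x)\<^sup>2)) \<in> borel_measurable \<mu>" using lin[of l] by measurable
    from nn_integral_sample[OF prob finite_lessThan j this]
    show "(\<integral>\<^sup>+\<omega>. ennreal (\<Sum>i\<in>I. l i * (Z i (\<omega> j))\<^sup>2) \<partial>?S) = ennreal (\<Sum>i\<in>I. l i)"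
      using quad[OF l] by simp
  qed
  also have "\<dots> = ennreal (k * (\<Sum>i\<in>I. l i))"
    using l by (simp add: ennreal_mult sum_nonneg ennreal_of_nat_eq_real_of_nat)
  finally show "(\<integral>\<^sup>+\<omega>. ennreal (\<Sum>j<k. \<Sum>i\<in>I. l i * (Z i (\<omega> j))\<^sup>2) \<partial>?S) = ennreal (k * (\<Sum>i\<in>I. l i))" .
  define t1 t2 where "t1 = (\<Sum>i\<in>I. l i)" and "t2 = (\<Sum>i\<in>I. (l i)\<^sup>2)"
  have t: "0 \<le> t1" "0 \<le> t2" using l by (auto simp: t1_def t2_def intro!: sum_nonneg)
  define q where "q x y = (\<Sum>i\<in>I. l i * Z i x * Z i y)\<^sup>2" for x y
  have qm: "(\<lambda>\<omega>. ennreal (q (\<omega> j) (\<omega> j'))) \<in> borel_measurable ?S" if "j < k" "j' < k" for j j'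
  proof (rule measurable_compose[OF _ measurable_ennreal])
    show "(\<lambda>\<omega>. q (\<omega> j) (\<omega> j')) \<in> borel_measurable ?S"
      unfolding q_def
      by (intro borel_measurable_power borel_measurable_sum borel_measurable_times borel_measurable_const
        comp[OF meas] that)
  qed
  \<comment> \<open>equal samples: Cauchy-Schwarz reduces to fourth moments\<close>
  have diag: "(\<integral>\<^sup>+\<omega>. ennreal (q (\<omega> j) (\<omega> j)) \<partial>?S) \<le> ennreal (h * t1\<^sup>2)" if j: "j < k" for j
  proof -
    have m: "(\<lambda>x. ennreal (q x x)) \<in> borel_measurable \<mu>"
    proof (rule measurable_compose[OF _ measurable_ennreal])
      show "(\<lambda>x. q x x) \<in> borel_measurable \<mu>"
        unfolding q_def
        by (intro borel_measurable_power borel_measurable_sum borel_measurable_times borel_measurable_const meas)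
    qed
    have "(\<integral>\<^sup>+\<omega>. ennreal (q (\<omega> j) (\<omega> j)) \<partial>?S) = (\<integral>\<^sup>+x. ennreal (q x x) \<partial>\<mu>)"
      using nn_integral_sample[OF prob finite_lessThan _ m, of j k] j by simp
    also have "\<dots> \<le> (\<integral>\<^sup>+x. (\<Sum>i\<in>I. ennreal (t1 * l i) * ennreal ((Z i x)^4)) \<partial>\<mu>)"
    proof (rule nn_integral_mono)
      fix x
      have "q x x = (\<Sum>i\<in>I. sqrt (l i) * (sqrt (l i) * (Z i x)\<^sup>2))\<^sup>2"
        unfolding q_def using l
        by (intro arg_cong[of _ _ "\<lambda>s. s\<^sup>2"] sum.cong refl) (simp add: power2_eq_square mult.assoc[symmetric])
      also have "\<dots> \<le> (\<Sum>i\<in>I. (sqrt (l i))\<^sup>2) * (\<Sum>i\<in>I. (sqrt (l i) * (Z i x)\<^sup>2)\<^sup>2)"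
        by (rule Cauchy_Schwarz_ineq_sum)
      also have "(\<Sum>i\<in>I. (sqrt (l i))\<^sup>2) = t1" unfolding t1_def using l by (intro sum.cong refl) simp
      also have "(\<Sum>i\<in>I. (sqrt (l i) * (Z i x)\<^sup>2)\<^sup>2) = (\<Sum>i\<in>I. l i * (Z i x)^4)"
        using l by (intro sum.cong refl) (simp add: power_mult_distrib flip: power_mult)
      also have "t1 * (\<Sum>i\<in>I. l i * (Z i x)^4) = (\<Sum>i\<in>I. t1 * l i * (Z i x)^4)"
        by (simp add: sum_distrib_left mult.assoc)
      finally have "ennreal (q x x) \<le> ennreal (\<Sum>i\<in>I. t1 * l i * (Z i x)^4)" by (rule ennreal_leI)
      also have "\<dots> = (\<Sum>i\<in>I. ennreal (t1 * l i) * ennreal ((Z i x)^4))"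
        using l t by (subst sum_ennreal[symmetric]) (auto intro!: sum.cong simp: ennreal_mult)
      finally show "ennreal (q x x) \<le> (\<Sum>i\<in>I. ennreal (t1 * l i) * ennreal ((Z i x)^4))" .
    qed
    also have "\<dots> = (\<Sum>i\<in>I. \<integral>\<^sup>+x. ennreal (t1 * l i) * ennreal ((Z i x)^4) \<partial>\<mu>)"
      using meas by (intro nn_integral_sum) auto
    also have "\<dots> \<le> (\<Sum>i\<in>I. ennreal (t1 * l i) * ennreal h)"
      using meas Z4 by (intro sum_mono) (auto simp: nn_integral_cmult intro!: mult_left_mono)
    also have "\<dots> = ennreal (\<Sum>i\<in>I. t1 * l i * h)"
      using l t h by (subst sum_ennreal[symmetric]) (auto intro!: sum.cong simp: ennreal_mult)
    also have "(\<Sum>i\<in>I. t1 * l i * h) = h * t1\<^sup>2"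
      by (simp add: t1_def power2_eq_square sum_distrib_left sum_distrib_right mult_ac)
    finally show ?thesis .
  qed
  \<comment> \<open>distinct samples: integrate one of them out by isotropy\<close>
  have off: "(\<integral>\<^sup>+\<omega>. ennreal (q (\<omega> j) (\<omega> j')) \<partial>?S) = ennreal t2" if j: "j < k" "j' < k" "j \<noteq> j'" for j j'
  proof -
    have ins: "insert j' ({..<k} - {j'}) = {..<k}" using j by auto
    have "(\<integral>\<^sup>+\<omega>. ennreal (q (\<omega> j) (\<omega> j')) \<partial>?S) =
        (\<integral>\<^sup>+\<omega>. \<integral>\<^sup>+y. ennreal (q (fun_upd \<omega> j' y j) (fun_upd \<omega> j' y j')) \<partial>\<mu> \<partial>Pi\<^sub>M ({..<k} - {j'}) (\<lambda>_. \<mu>))"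
      using product_nn_integral_insert[of "{..<k} - {j'}" j' "\<lambda>\<omega>. ennreal (q (\<omega> j) (\<omega> j'))"] qm[OF j(1,2)]
      unfolding ins by simp
    also have "\<dots> = (\<integral>\<^sup>+\<omega>. ennreal (\<Sum>i\<in>I. (l i)\<^sup>2 * (Z i (\<omega> j))\<^sup>2) \<partial>Pi\<^sub>M ({..<k} - {j'}) (\<lambda>_. \<mu>))"
    proof (intro nn_integral_cong)
      fix \<omega>
      show "(\<integral>\<^sup>+y. ennreal (q (fun_upd \<omega> j' y j) (fun_upd \<omega> j' y j')) \<partial>\<mu>) = ennreal (\<Sum>i\<in>I. (l i)\<^sup>2 * (Z i (\<omega> j))\<^sup>2)"
        using j(3) m2[of "\<lambda>i. l i * Z i (\<omega> j)"] by (simp add: q_def power_mult_distrib)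
    qed
    also have "\<dots> = (\<integral>\<^sup>+x. ennreal (\<Sum>i\<in>I. (l i)\<^sup>2 * (Z i x)\<^sup>2) \<partial>\<mu>)"
    proof (rule nn_integral_sample[OF prob])
      show "(\<lambda>x. ennreal (\<Sum>i\<in>I. (l i)\<^sup>2 * (Z i x)\<^sup>2)) \<in> borel_measurable \<mu>"
        using lin[of "\<lambda>i. (l i)\<^sup>2"] by measurable
    qed (use j in auto)
    also have "\<dots> = ennreal t2" unfolding t2_def by (rule quad) simp
    finally show ?thesis .
  qed
  have "(\<integral>\<^sup>+\<omega>. ennreal (\<Sum>j<k. \<Sum>j'<k. q (\<omega> j) (\<omega> j')) \<partial>?S) =
      (\<integral>\<^sup>+\<omega>. (\<Sum>j<k. \<Sum>j'<k. ennreal (q (\<omega> j) (\<omega> j'))) \<partial>?S)"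
    by (simp add: q_def sum_nonneg)
  also have "\<dots> = (\<Sum>j<k. \<integral>\<^sup>+\<omega>. (\<Sum>j'<k. ennreal (q (\<omega> j) (\<omega> j'))) \<partial>?S)"
    using qm by (intro nn_integral_sum borel_measurable_sum) auto
  also have "\<dots> = (\<Sum>j<k. \<Sum>j'<k. \<integral>\<^sup>+\<omega>. ennreal (q (\<omega> j) (\<omega> j')) \<partial>?S)"
    using qm by (intro sum.cong refl nn_integral_sum) auto
  also have "\<dots> \<le> (\<Sum>j<k. \<Sum>j'<k. ennreal ((if j' = j then h * t1\<^sup>2 else 0) + t2))"
  proof (intro sum_mono)
    fix j j' assume "j \<in> {..<k}" "j' \<in> {..<k}"
    then have j: "j < k" "j' < k" by auto
    show "(\<integral>\<^sup>+\<omega>. ennreal (q (\<omega> j) (\<omega> j')) \<partial>?S) \<le> ennreal ((if j' = j then h * t1\<^sup>2 else 0) + t2)"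
    proof (cases "j' = j")
      case True
      then show ?thesis using order_trans[OF diag[OF j(1)] ennreal_leI] t by simp
    next
      case False
      then show ?thesis using off[OF j] by simp
    qed
  qed
  also have "\<dots> = ennreal (\<Sum>j<k. \<Sum>j'<k. (if j' = j then h * t1\<^sup>2 else 0) + t2)"
  proof -
    define c where "c j j' = (if j' = j then h * t1\<^sup>2 else 0) + t2" for j j' :: nat
    have c: "0 \<le> c j j'" for j j' using h t by (simp add: c_def)
    have "(\<Sum>j<k. \<Sum>j'<k. ennreal (c j j')) = (\<Sum>j<k. ennreal (\<Sum>j'<k. c j j'))"
      using c by (intro sum.cong refl sum_ennreal) auto
    also have "\<dots> = ennreal (\<Sum>j<k. \<Sum>j'<k. c j j')"
      using c by (intro sum_ennreal sum_nonneg) auto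
    finally show ?thesis by (simp only: c_def)
  qed
  also have "(\<Sum>j<k. \<Sum>j'<k. (if j' = j then h * t1\<^sup>2 else 0) + t2) = real k * (h * t1\<^sup>2) + (real k)\<^sup>2 * t2"
    by (simp add: sum.distrib power2_eq_square algebra_simps)
  finally show "(\<integral>\<^sup>+\<omega>. ennreal (\<Sum>j<k. \<Sum>j'<k. (\<Sum>i\<in>I. l i * Z i (\<omega> j) * Z i (\<omega> j'))\<^sup>2) \<partial>?S) \<le>
      ennreal (real k * (h * (\<Sum>i\<in>I. l i)\<^sup>2) + (real k)\<^sup>2 * (\<Sum>i\<in>I. (l i)\<^sup>2))"
    by (simp add: q_def t1_def t2_def)
qed

section \<open>The error guarantees\<close>

text \<open>
  Coordinates in an orthonormal basis have the same moments as the entries, because the moments depend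
  only on the length of the test vector.
\<close>

lemma mps_basis_moments:
  assumes \<chi>: "1 \<le> \<chi>" and d: "1 \<le> d" and n: "2 \<le> n" and v: "onb (d ^ n) v" and I: "I \<subseteq> {..<d ^ n}"
  shows "(\<integral>\<^sup>+G. ennreal ((\<Sum>i\<in>I. u i * (v i \<bullet> mps_vec d n \<chi> G))\<^sup>2) \<partial>core_law d n \<chi>) = ennreal (\<Sum>i\<in>I. (u i)\<^sup>2)"
    and "(\<integral>\<^sup>+G. ennreal ((\<Sum>i\<in>I. u i * (v i \<bullet> mps_vec d n \<chi> G))^4) \<partial>core_law d n \<chi>) \<le>
      ennreal (3 * (1 + 2 / \<chi>) ^ (n - 1) * (\<Sum>i\<in>I. (u i)\<^sup>2)\<^sup>2)"
proof -
  have fin: "finite I" using I finite_subset by blast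
  define x where "x a = (\<Sum>i\<in>I. u i * v i $ a)" for a
  have lin: "(\<Sum>i\<in>I. u i * (v i \<bullet> mps_vec d n \<chi> G)) = (\<Sum>a<d ^ n. x a * mps_vec d n \<chi> G $ a)" for G
  proof -
    have "(\<Sum>i\<in>I. u i * (v i \<bullet> mps_vec d n \<chi> G)) = (\<Sum>i\<in>I. \<Sum>a<d ^ n. u i * v i $ a * mps_vec d n \<chi> G $ a)"
      by (intro sum.cong refl)
        (simp add: scalar_prod_def mps_vec_def atLeast0LessThan sum_distrib_left mult.assoc)
    also have "\<dots> = (\<Sum>a<d ^ n. \<Sum>i\<in>I. u i * v i $ a * mps_vec d n \<chi> G $ a)" by (rule sum.swap)
    also have "\<dots> = (\<Sum>a<d ^ n. x a * mps_vec d n \<chi> G $ a)" by (simp add: x_def sum_distrib_right)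
    finally show ?thesis .
  qed
  have norm: "(\<Sum>a<d ^ n. (x a)\<^sup>2) = (\<Sum>i\<in>I. (u i)\<^sup>2)"
  proof -
    have dot: "(\<Sum>a<d ^ n. v i $ a * v j $ a) = (if j = i then 1 else 0)" if "i \<in> I" "j \<in> I" for i j
    proof -
      have ij: "i < d ^ n" "j < d ^ n" using that I by auto
      show ?thesis using onb_dot[OF v ij] onb_carrier[OF v ij(2)] by (simp add: scalar_prod_def atLeast0LessThan)
    qed
    have "(\<Sum>a<d ^ n. (x a)\<^sup>2) = (\<Sum>a<d ^ n. \<Sum>i\<in>I. \<Sum>j\<in>I. u i * u j * (v i $ a * v j $ a))"
      by (simp add: x_def power2_eq_square sum_product mult_ac)
    also have "\<dots> = (\<Sum>i\<in>I. \<Sum>a<d ^ n. \<Sum>j\<in>I. u i * u j * (v i $ a * v j $ a))" by (rule sum.swap)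
    also have "\<dots> = (\<Sum>i\<in>I. \<Sum>j\<in>I. \<Sum>a<d ^ n. u i * u j * (v i $ a * v j $ a))" by (intro sum.cong refl sum.swap)
    also have "\<dots> = (\<Sum>i\<in>I. \<Sum>j\<in>I. if j = i then (u i)\<^sup>2 else 0)"
      by (intro sum.cong refl) (simp add: dot power2_eq_square flip: sum_distrib_left)
    also have "\<dots> = (\<Sum>i\<in>I. (u i)\<^sup>2)" using fin by simp
    finally show ?thesis .
  qed
  show "(\<integral>\<^sup>+G. ennreal ((\<Sum>i\<in>I. u i * (v i \<bullet> mps_vec d n \<chi> G))\<^sup>2) \<partial>core_law d n \<chi>) = ennreal (\<Sum>i\<in>I. (u i)\<^sup>2)"
    unfolding lin norm[symmetric] by (rule mps_moments(1)[OF \<chi> d n])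
  show "(\<integral>\<^sup>+G. ennreal ((\<Sum>i\<in>I. u i * (v i \<bullet> mps_vec d n \<chi> G))^4) \<partial>core_law d n \<chi>) \<le>
      ennreal (3 * (1 + 2 / \<chi>) ^ (n - 1) * (\<Sum>i\<in>I. (u i)\<^sup>2)\<^sup>2)"
    unfolding lin norm[symmetric] by (rule mps_moments(2)[OF \<chi> d n])
qed

text \<open>
  The constants: \<open>6900 = 3 * 2300\<close>, where \<open>3\<close> comes from the fourth moment and \<open>2300\<close> from
  \<open>subspace_injection\<close>, which fails with probability at most \<open>0.002\<close>; each of the two Markov bounds for
  the sketched tail fails with probability at most \<open>0.001\<close> and costs a factor \<open>1000\<close>. The injectivity
  constant is \<open>\<alpha> = 1 / 2\<close>, so the Frobenius bound has the constant \<open>8 + 32 * 1000 < 33000\<close>.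
\<close>

theorem nystrom_rmps_guarantees:
  fixes A B :: "real mat"
  assumes d: "1 \<le> d" and \<chi>: "1 \<le> \<chi>" and n: "2 \<le> n"
    and A: "A \<in> carrier_mat (d ^ n) (d ^ n)" "psd A" and r: "1 \<le> r" "r \<le> d ^ n"
    and B: "best_rank_approx r A B" and k: "6900 * (1 + 2 / real \<chi>) ^ (n - 1) * real r \<le> real k"
  shows "\<P>(\<omega> in rmps_space d n \<chi> k.
    nystrom_guarantees 33000 r A B (nystrom A (rmps_test_matrix d n \<chi> k \<omega>))) \<ge> 0.99"
proof -
  define N where "N = d ^ n"
  define \<mu> where "\<mu> = core_law d n \<chi>"
  define h where "h = 3 * (1 + 2 / real \<chi>) ^ (n - 1)"
  have "1 \<le> (1 + 2 / real \<chi>) ^ (n - 1)" by (rule one_le_power) simp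
  then have h: "1 \<le> h" unfolding h_def by linarith
  have kh: "2300 * h * real r \<le> real k" using k by (simp add: h_def)
  have "0 < 2300 * h * real r" using h r by simp
  then have k0: "0 < real k" using kh by linarith
  have prob: "prob_space \<mu>"
    unfolding \<mu>_def core_law_def by (intro prob_space_PiM prob_space_entry_law \<chi>)
  have S: "rmps_space d n \<chi> k = samples \<mu> k" by (simp add: rmps_space_def \<mu>_def)
  let ?S = "samples \<mu> k"
  interpret S: prob_space ?S by (rule prob_space_samples[OF prob])
  have A': "A \<in> carrier_mat N N" using A by (simp add: N_def)
  have rN: "r \<le> N" using r by (simp add: N_def)
  have symA: "transpose_mat A = A" using A by (simp add: psd_def)
  obtain v l where v: "onb N v" and ev: "\<And>i. i < N \<Longrightarrow> A *\<^sub>v v i = l i \<cdot>\<^sub>v v i"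
    and dec: "\<And>i j. i \<le> j \<Longrightarrow> j < N \<Longrightarrow> l j \<le> l i"
    using symmetric_sorted_eigenbasis[OF A' symA] by blast
  have l0: "0 \<le> l i" if "i < N" for i using psd_eigenvalue_nonneg[OF A(2) A' v that ev[OF that]] .
  define I where "I = {r..<N}"
  have IN: "I \<subseteq> {..<d ^ n}" "finite I" by (auto simp: I_def N_def)
  define Z where "Z i G = v i \<bullet> mps_vec d n \<chi> G" for i G
  have Zm: "Z i \<in> borel_measurable \<mu>" for i
  proof -
    have "Z i = (\<lambda>G. \<Sum>a<d ^ n. v i $ a * mps_vec d n \<chi> G $ a)"
      by (simp add: Z_def fun_eq_iff scalar_prod_def mps_vec_def atLeast0LessThan)
    then show ?thesis
      unfolding \<mu>_def by (simp only:) (intro borel_measurable_sum borel_measurable_times borel_measurable_const borel_measurable_mps_vec d n, simp)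
  qed
  note mom = mps_basis_moments[OF \<chi> d n v[unfolded N_def], folded Z_def \<mu>_def h_def]
  obtain G where G: "G \<in> sets ?S" "measure ?S (space ?S - G) \<le> 2 / 1000"
    and inj: "\<And>\<omega> x. \<omega> \<in> G \<Longrightarrow> real k / 2 * (\<Sum>i<r. (x i)\<^sup>2) \<le> (\<Sum>j<k. (\<Sum>i<r. x i * Z i (\<omega> j))\<^sup>2)"
    using subspace_injection[OF prob r(1) h Zm mom kh] r(2) by blast
  define \<tau>1 \<tau>2 where "\<tau>1 = (\<Sum>i\<in>I. l i)" and "\<tau>2 = (\<Sum>i\<in>I. (l i)\<^sup>2)"
  have \<tau>: "0 \<le> \<tau>1" "0 \<le> \<tau>2" using l0 by (auto simp: \<tau>1_def \<tau>2_def I_def intro!: sum_nonneg)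
  define T1 where "T1 \<omega> = (\<Sum>j<k. \<Sum>i\<in>I. l i * (Z i (\<omega> j))\<^sup>2)" for \<omega>
  define T2 where "T2 \<omega> = (\<Sum>j<k. \<Sum>j'<k. (\<Sum>i\<in>I. l i * Z i (\<omega> j) * Z i (\<omega> j'))\<^sup>2)" for \<omega>
  define e2 where "e2 = k * (h * \<tau>1\<^sup>2) + (real k)\<^sup>2 * \<tau>2"
  have comp: "(\<lambda>\<omega>. Z i (\<omega> j)) \<in> borel_measurable ?S" if "j < k" for i j
    using that Zm by (intro measurable_compose[OF measurable_component_singleton]) auto
  have T1m: "T1 \<in> borel_measurable ?S" and T2m: "T2 \<in> borel_measurable ?S"
    unfolding T1_def T2_def using comp
    by (auto intro!: borel_measurable_sum borel_measurable_times borel_measurable_power)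
  have lI: "0 \<le> l i" if "i \<in> I" for i using that l0 by (simp add: I_def)
  have h0: "0 \<le> h" using h by simp
  have tail: "(\<integral>\<^sup>+\<omega>. ennreal (T1 \<omega>) \<partial>?S) = ennreal (real k * \<tau>1)"
    "(\<integral>\<^sup>+\<omega>. ennreal (T2 \<omega>) \<partial>?S) \<le> ennreal e2"
    unfolding T1_def T2_def \<tau>1_def \<tau>2_def e2_def
    by (rule tail_sketch_moments[OF prob IN(2) h0 Zm lI mom[OF IN(1)]]; assumption)+
  have T10: "0 \<le> T1 \<omega>" and T20: "0 \<le> T2 \<omega>" for \<omega>
    using lI by (auto simp: T1_def T2_def intro!: sum_nonneg)
  define B1 B2 where "B1 = {\<omega> \<in> space ?S. 1000 * (real k * \<tau>1) < T1 \<omega>}"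
    and "B2 = {\<omega> \<in> space ?S. 1000 * e2 < T2 \<omega>}"
  have Bm: "B1 \<in> sets ?S" "B2 \<in> sets ?S" unfolding B1_def B2_def using T1m T2m by measurable
  have pB1: "measure ?S B1 \<le> 1 / 1000"
    unfolding B1_def by (rule markov_above[OF prob T1m T10]) (use tail(1) \<tau> in auto)
  have e20: "0 \<le> e2" using h \<tau> by (simp add: e2_def)
  have pB2: "measure ?S B2 \<le> 1 / 1000"
    unfolding B2_def by (rule markov_above[OF prob T2m T20 tail(2) e20]) simp
  let ?W = "rmps_test_matrix d n \<chi> k"
  let ?good = "{\<omega> \<in> space ?S. nystrom_guarantees 33000 r A B (nystrom A (?W \<omega>))}"
  have goodm: "?good \<in> sets ?S"
    using measurable_nystrom_guarantees[where C = 33000 and r = r and B = B, OF A(2) A(1) mat_measurable_rmps_test_matrix[OF d n, of \<chi> k]]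
    unfolding S .
  have Bc: "B \<in> carrier_mat N N" "mat_rank B \<le> r"
    using B A' by (auto simp: best_rank_approx_def)
  note lower = tail_sums_le_low_rank_error[OF A' symA Bc rN v ev dec l0, folded I_def, folded \<tau>1_def \<tau>2_def]
  have good: "\<omega> \<in> ?good" if \<omega>: "\<omega> \<in> space ?S" "\<omega> \<in> G" "\<omega> \<notin> B1" "\<omega> \<notin> B2" for \<omega>
  proof -
    have Wc: "?W \<omega> \<in> carrier_mat N k" using rmps_test_matrix_carrier by (simp add: N_def)
    have vW: "v i \<bullet> col (?W \<omega>) j = Z i (\<omega> j) / sqrt k" if "i < N" "j < k" for i j
    proof -
      have "mps_vec d n \<chi> (\<omega> j) \<in> carrier_vec N" by (simp add: mps_vec_def N_def)
      then show ?thesis using onb_carrier[OF v that(1)] that by (simp add: col_rmps_test_matrix Z_def)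
    qed
    have "1 / 2 * (x \<bullet> x) \<le> (\<Sum>j<k. (\<Sum>i<r. x $ i * (v i \<bullet> col (?W \<omega>) j))\<^sup>2)" if x: "x \<in> carrier_vec r" for x
    proof -
      have "(\<Sum>j<k. (\<Sum>i<r. x $ i * (v i \<bullet> col (?W \<omega>) j))\<^sup>2) = (\<Sum>j<k. (\<Sum>i<r. x $ i * Z i (\<omega> j))\<^sup>2 / k)"
      proof (intro sum.cong refl)
        fix j assume "j \<in> {..<k}"
        then have "(\<Sum>i<r. x $ i * (v i \<bullet> col (?W \<omega>) j)) = (\<Sum>i<r. x $ i * Z i (\<omega> j)) / sqrt k"
          using rN by (simp add: vW sum_divide_distrib)
        then show "(\<Sum>i<r. x $ i * (v i \<bullet> col (?W \<omega>) j))\<^sup>2 = (\<Sum>i<r. x $ i * Z i (\<omega> j))\<^sup>2 / k"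
          by (simp add: power_divide)
      qed
      also have "\<dots> = (\<Sum>j<k. (\<Sum>i<r. x $ i * Z i (\<omega> j))\<^sup>2) / k" by (simp add: sum_divide_distrib)
      also have "\<dots> \<ge> (real k / 2 * (\<Sum>i<r. (x $ i)\<^sup>2)) / k"
        using inj[OF \<omega>(2)] by (intro divide_right_mono) auto
      also have "(real k / 2 * (\<Sum>i<r. (x $ i)\<^sup>2)) / k = 1 / 2 * (x \<bullet> x)"
        using k0 x by (simp add: scalar_prod_def atLeast0LessThan power2_eq_square)
      finally show ?thesis .
    qed
    note err = nystrom_error_bounds[OF A(2) A' Wc rN v ev _ this, folded I_def, simplified]
    have s1: "(\<Sum>j<k. \<Sum>i\<in>I. l i * (v i \<bullet> col (?W \<omega>) j)\<^sup>2) = T1 \<omega> / k"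
    proof -
      have "(\<Sum>j<k. \<Sum>i\<in>I. l i * (v i \<bullet> col (?W \<omega>) j)\<^sup>2) = (\<Sum>j<k. \<Sum>i\<in>I. l i * (Z i (\<omega> j))\<^sup>2 / k)"
        by (intro sum.cong refl) (simp add: vW I_def power_divide)
      then show ?thesis by (simp add: T1_def sum_divide_distrib)
    qed
    have s2: "(\<Sum>j<k. \<Sum>j'<k. (\<Sum>i\<in>I. l i * (v i \<bullet> col (?W \<omega>) j) * (v i \<bullet> col (?W \<omega>) j'))\<^sup>2) = T2 \<omega> / (real k)\<^sup>2"
    proof -
      have e: "(\<Sum>i\<in>I. l i * (v i \<bullet> col (?W \<omega>) j) * (v i \<bullet> col (?W \<omega>) j')) = (\<Sum>i\<in>I. l i * Z i (\<omega> j) * Z i (\<omega> j')) / k"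
        if "j < k" "j' < k" for j j'
        unfolding sum_divide_distrib using that by (intro sum.cong refl) (simp add: vW I_def)
      have "(\<Sum>j<k. \<Sum>j'<k. (\<Sum>i\<in>I. l i * (v i \<bullet> col (?W \<omega>) j) * (v i \<bullet> col (?W \<omega>) j'))\<^sup>2) =
          (\<Sum>j<k. \<Sum>j'<k. (\<Sum>i\<in>I. l i * Z i (\<omega> j) * Z i (\<omega> j'))\<^sup>2 / (real k)\<^sup>2)"
        by (intro sum.cong refl) (simp only: lessThan_iff e power_divide)
      then show ?thesis by (simp only: T2_def sum_divide_distrib)
    qed
    have t1: "T1 \<omega> \<le> 1000 * (real k * \<tau>1)" and t2: "T2 \<omega> \<le> 1000 * e2"
      using \<omega> by (auto simp: B1_def B2_def)
    have nuc: "nuclear_norm (A - nystrom A (?W \<omega>)) \<le> 33000 * \<tau>1"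
    proof -
      have "nuclear_norm (A - nystrom A (?W \<omega>)) = mat_tr (A - nystrom A (?W \<omega>))"
        by (rule nuclear_norm_psd[OF nystrom_residual(1,2)[OF A(2) A' Wc]])
      also have "\<dots> \<le> 2 * \<tau>1 + 4 * (T1 \<omega> / k)" using err(1) by (simp add: s1 \<tau>1_def)
      also have "T1 \<omega> / k \<le> 1000 * \<tau>1" using t1 k0 by (simp add: field_simps)
      finally show ?thesis using \<tau> by simp
    qed
    have frob: "(frob_norm (A - nystrom A (?W \<omega>)))\<^sup>2 \<le> 33000 * (\<tau>2 + 1 / r * \<tau>1\<^sup>2)"
    proof -
      have "(frob_norm (A - nystrom A (?W \<omega>)))\<^sup>2 \<le> 8 * \<tau>2 + 32 * (T2 \<omega> / (real k)\<^sup>2)"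
        using err(2) by (simp add: s2 \<tau>2_def power_divide)
      also have "T2 \<omega> / (real k)\<^sup>2 \<le> 1000 * e2 / (real k)\<^sup>2" using t2 by (intro divide_right_mono) auto
      also have "1000 * e2 / (real k)\<^sup>2 = 1000 * (h / k * \<tau>1\<^sup>2 + \<tau>2)"
        using k0 by (simp add: e2_def field_simps power2_eq_square)
      also have "h / k * \<tau>1\<^sup>2 \<le> 1 / r * \<tau>1\<^sup>2"
      proof (rule mult_right_mono)
        have "h * real r \<le> real k" using kh h r by (simp add: mult.assoc)
        then show "h / k \<le> 1 / r" using k0 r by (simp add: field_simps)
      qed simp
      finally have "(frob_norm (A - nystrom A (?W \<omega>)))\<^sup>2 \<le> 8 * \<tau>2 + 32 * (1000 * (1 / r * \<tau>1\<^sup>2 + \<tau>2))" by simp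
      also have "\<dots> \<le> 33000 * (\<tau>2 + 1 / r * \<tau>1\<^sup>2)"
      proof -
        have const: "8 * a + 32 * (1000 * (b + a)) \<le> 33000 * (a + b)" if "0 \<le> a" "0 \<le> b" for a b :: real
          using that by simp
        show ?thesis by (rule const[OF \<tau>(2)]) simp
      qed
      finally show ?thesis .
    qed
    have "33000 * (\<tau>2 + 1 / r * \<tau>1\<^sup>2) \<le> 33000 * ((frob_norm (A - B))\<^sup>2 + 1 / r * (nuclear_norm (A - B))\<^sup>2)"
      using lower \<tau> by (intro mult_left_mono add_mono power_mono) auto
    then show ?thesis
      using \<omega>(1) nuc frob lower(1) by (simp add: nystrom_guarantees_def)
  qed
  have sub: "space ?S - ?good \<subseteq> (space ?S - G) \<union> B1 \<union> B2" using good by blast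
  have Gc: "space ?S - G \<in> sets ?S" using G by auto
  have "measure ?S (space ?S - ?good) \<le> measure ?S ((space ?S - G) \<union> B1 \<union> B2)"
    using sub Gc Bm by (intro S.finite_measure_mono) auto
  also have "\<dots> \<le> measure ?S (space ?S - G) + measure ?S B1 + measure ?S B2"
    using measure_Un_le[of "(space ?S - G) \<union> B1" ?S B2] measure_Un_le[of "space ?S - G" ?S B1] Gc Bm by auto
  also have "\<dots> \<le> 4 / 1000" using G(2) pB1 pB2 by simp
  finally have "measure ?S (space ?S - ?good) \<le> 4 / 1000" .
  then have "measure ?S ?good \<ge> 0.99" using S.prob_compl[OF goodm] by simp
  then show ?thesis unfolding S .
qed

theorem theorem3p2:
  shows "\<exists>C\<^sub>0 > 0. \<exists>C\<^sub>1 > 0.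
    (\<forall>(d::nat) (n::nat) (\<chi>::nat) (k::nat) (r::nat) (A::real mat) (B::real mat).
       1 \<le> d \<longrightarrow> 1 \<le> \<chi> \<longrightarrow> 2 \<le> n \<longrightarrow>
       A \<in> carrier_mat (d ^ n) (d ^ n) \<longrightarrow> psd A \<longrightarrow>
       1 \<le> r \<longrightarrow> r \<le> d ^ n \<longrightarrow> best_rank_approx r A B \<longrightarrow>
       real k \<ge> C\<^sub>0 * (1 + 2 / real \<chi>) ^ (n - 1) * real r \<longrightarrow>
       \<P>(\<omega> in rmps_space d n \<chi> k.
          nystrom_guarantees C\<^sub>1 r A B (nystrom A (rmps_test_matrix d n \<chi> k \<omega>))) \<ge> 0.99) \<and>
    (\<exists>C\<^sub>2 > 0. \<exists>C\<^sub>3 > 0.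
     \<forall>(d::nat) (n::nat) (\<chi>::nat) (k::nat) (r::nat) (A::real mat) (B::real mat).
       1 \<le> d \<longrightarrow> 1 \<le> \<chi> \<longrightarrow> 2 \<le> n \<longrightarrow>
       A \<in> carrier_mat (d ^ n) (d ^ n) \<longrightarrow> psd A \<longrightarrow>
       1 \<le> r \<longrightarrow> r \<le> d ^ n \<longrightarrow> best_rank_approx r A B \<longrightarrow>
       real \<chi> \<ge> C\<^sub>2 * real n \<longrightarrow> real k \<ge> C\<^sub>3 * real r \<longrightarrow>
       \<P>(\<omega> in rmps_space d n \<chi> k.
          nystrom_guarantees C\<^sub>1 r A B (nystrom A (rmps_test_matrix d n \<chi> k \<omega>))) \<ge> 0.99)"
proof -
  have 1: "\<P>(\<omega> in rmps_space d n \<chi> k.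
          nystrom_guarantees 33000 r A B (nystrom A (rmps_test_matrix d n \<chi> k \<omega>))) \<ge> 0.99"
    if hyps: "1 \<le> d" "1 \<le> \<chi>" "2 \<le> n" "A \<in> carrier_mat (d ^ n) (d ^ n)" "psd A"
      "1 \<le> r" "r \<le> d ^ n" "best_rank_approx r A B"
      and "real k \<ge> 6900 * (1 + 2 / real \<chi>) ^ (n - 1) * real r"
    for d n \<chi> k r :: nat and A B :: "real mat"
    by (rule nystrom_rmps_guarantees) (use that in auto)
  have 2: "\<P>(\<omega> in rmps_space d n \<chi> k.
          nystrom_guarantees 33000 r A B (nystrom A (rmps_test_matrix d n \<chi> k \<omega>))) \<ge> 0.99"
    if hyps: "1 \<le> d" "1 \<le> \<chi>" "2 \<le> n" "A \<in> carrier_mat (d ^ n) (d ^ n)" "psd A"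
      "1 \<le> r" "r \<le> d ^ n" "best_rank_approx r A B"
      and \<chi>: "real \<chi> \<ge> 1 * real n" and k: "real k \<ge> 6900 * exp 2 * real r"
    for d n \<chi> k r :: nat and A B :: "real mat"
  proof (rule 1[OF hyps])
    have "(1 + 2 / real \<chi>) ^ (n - 1) \<le> exp (2 / real \<chi>) ^ (n - 1)"
      by (intro power_mono exp_ge_add_one_self) auto
    also have "\<dots> = exp (real (n - 1) * (2 / real \<chi>))" by (rule exp_of_nat_mult[symmetric])
    also have "\<dots> \<le> exp 2"
    proof -
      have "real (n - 1) \<le> real \<chi>" using \<chi> by simp
      then show ?thesis using hyps(2) by (simp add: field_simps)
    qed
    finally have "6900 * (1 + 2 / real \<chi>) ^ (n - 1) * real r \<le> 6900 * exp 2 * real r"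
      by (intro mult_right_mono) auto
    then show "6900 * (1 + 2 / real \<chi>) ^ (n - 1) * real r \<le> real k" using k by linarith
  qed
  show ?thesis
  proof (intro exI conjI)
    show "(0 :: real) < 6900" "(0 :: real) < 33000" "(0 :: real) < 1" "(0 :: real) < 6900 * exp 2" by simp_all
  qed (use 1 2 in blast)+
qed

end
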